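(* Let $(G,w)$ be a weighted game graph. If there are $d$ integer values $w_1,\dots,w_d$ and a window size $\delta$ such that for every edge $(u,v)$ of $G$ we have $w(u,v)\in\{w_i-\delta,\dots,w_i+\delta\}$ for some $1\le i\le d$, then the minimal energies $e^*_{G,w}(v)$ of all nodes can be computed in $O(m\delta n^{d+1})$ time.
   Context: A weighted game graph $(G,w)$ consists of a finite directed graph $G=(V,E)$ in which every node has out-degree at least $1$, a partition $V=V_A\cup V_B$ into nodes of Alice and of Bob, and integer edge weights $w:E\to\mathbb{Z}$; $n=|V|$, $m=|E|$. A (positional) strategy $\sigma$ of Alice picks for each $u\in V_A$ an out-neighbor $\sigma(u)$; a strategy $\tau$ of Bob picks for each $u\in V_B$ an out-neighbor $\tau(u)$. $G(\sigma,\tau)$ is the subgraph with edges $\{(u,\sigma(u)):u\in V_A\}\cup\{(u,\tau(u)):u\in V_B\}$; from any node $s$ there is a unique cycle $C$ reachable in it. $w(P)$ is the total weight of a path/cycle $P$. Set $e^*_{G(\sigma,\tau),w}(s)=\infty$ if $w(C)<0$, else $\max\{0,-\min_P w(P)\}$ over simple paths $P$ in $G(\sigma,\tau)$ starting at $s$. The minimal energy is $e^*_{G,w}(s)=\min_\sigma\max_\tau e^*_{G(\sigma,\tau),w}(s)$. *)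

theory Defs
  imports
    "Graph_Theory.Pair_Digraph"
    "HOL-Library.Extended_Nat"
    "HOL-Library.FuncSet"
begin

section \<open>Energy games\<close>

locale game_graph = pair_fin_digraph G
  for G :: "'v pair_pre_digraph" +
  fixes V\<^sub>A V\<^sub>B :: "'v set"
  assumes partition: "V\<^sub>A \<union> V\<^sub>B = pverts G" "V\<^sub>A \<inter> V\<^sub>B = {}"
    and out_degree_pos: "\<And>u. u \<in> pverts G \<Longrightarrow> out_degree G u \<ge> 1"

definition strategies :: "'v pair_pre_digraph \<Rightarrow> 'v set \<Rightarrow> ('v \<Rightarrow> 'v) set" where
  "strategies G U = (\<Pi>\<^sub>E u\<in>U. {v. (u, v) \<in> parcs G})"

definition play_graph ::
  "'v pair_pre_digraph \<Rightarrow> 'v set \<Rightarrow> 'v set \<Rightarrow> ('v \<Rightarrow> 'v) \<Rightarrow> ('v \<Rightarrow> 'v) \<Rightarrow> 'v pair_pre_digraph" where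
  "play_graph G V\<^sub>A V\<^sub>B \<sigma> \<tau> =
     \<lparr> pverts = pverts G, parcs = {(u, \<sigma> u) | u. u \<in> V\<^sub>A} \<union> {(u, \<tau> u) | u. u \<in> V\<^sub>B} \<rparr>"

definition weight :: "('v \<times> 'v \<Rightarrow> int) \<Rightarrow> ('v \<times> 'v) list \<Rightarrow> int" where
  "weight w p = sum_list (map w p)"

text \<open>
  In a graph \<open>H\<close> of out-degree one, all arc lists \<open>C\<close> below are rotations of the unique cycle
  reachable from \<open>s\<close>, and therefore have the same weight.  The empty path from \<open>s\<close> is included
  in the minimum.
\<close>

definition play_energy :: "'v pair_pre_digraph \<Rightarrow> ('v \<times> 'v \<Rightarrow> int) \<Rightarrow> 'v \<Rightarrow> enat" where
  "play_energy H w s =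
     (if \<exists>C. pre_digraph.cycle (with_proj H) C \<and> s \<rightarrow>\<^sup>*\<^bsub>with_proj H\<^esub> fst (hd C) \<and> weight w C < 0
      then \<infinity>
      else enat (nat (max 0 (- Min {weight w P | P. \<exists>v. pre_digraph.apath (with_proj H) s P v}))))"

definition min_energy ::
  "'v pair_pre_digraph \<Rightarrow> 'v set \<Rightarrow> 'v set \<Rightarrow> ('v \<times> 'v \<Rightarrow> int) \<Rightarrow> 'v \<Rightarrow> enat" where
  "min_energy G V\<^sub>A V\<^sub>B w s =
     (MIN \<sigma>\<in>strategies G V\<^sub>A. MAX \<tau>\<in>strategies G V\<^sub>B.
        play_energy (play_graph G V\<^sub>A V\<^sub>B \<sigma> \<tau>) w s)"

section \<open>Model of computation\<close>

text \<open>
  Programs for a random access machine with unit-cost addition, subtraction and comparison of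
  integers (no multiplication, no bit operations) and indirect addressing.  The memory is divided
  into named segments, of which a program uses only finitely many; cell 0 of a segment also serves
  as a scalar variable.  A negative address refers to cell 0.
\<close>

type_synonym memory = "string \<Rightarrow> nat \<Rightarrow> int"

datatype aexp = Const int | Cell string aexp | Add aexp aexp | Sub aexp aexp

datatype bexp = Less aexp aexp | Not bexp | And bexp bexp

datatype com =
    Skip
  | Store string aexp aexp
  | Seq com com
  | If bexp com com
  | While bexp com

fun aval :: "aexp \<Rightarrow> memory \<Rightarrow> int" where
  "aval (Const k) M = k"
| "aval (Cell x e) M = M x (nat (aval e M))"
| "aval (Add e\<^sub>1 e\<^sub>2) M = aval e\<^sub>1 M + aval e\<^sub>2 M"
| "aval (Sub e\<^sub>1 e\<^sub>2) M = aval e\<^sub>1 M - aval e\<^sub>2 M"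

fun bval :: "bexp \<Rightarrow> memory \<Rightarrow> bool" where
  "bval (Less e\<^sub>1 e\<^sub>2) M = (aval e\<^sub>1 M < aval e\<^sub>2 M)"
| "bval (Not b) M = (\<not> bval b M)"
| "bval (And b\<^sub>1 b\<^sub>2) M = (bval b\<^sub>1 M \<and> bval b\<^sub>2 M)"

text \<open>The cost of evaluating an expression is its number of constructors.\<close>

fun acost :: "aexp \<Rightarrow> nat" where
  "acost (Const k) = 1"
| "acost (Cell x e) = acost e + 1"
| "acost (Add e\<^sub>1 e\<^sub>2) = acost e\<^sub>1 + acost e\<^sub>2 + 1"
| "acost (Sub e\<^sub>1 e\<^sub>2) = acost e\<^sub>1 + acost e\<^sub>2 + 1"

fun bcost :: "bexp \<Rightarrow> nat" where
  "bcost (Less e\<^sub>1 e\<^sub>2) = acost e\<^sub>1 + acost e\<^sub>2 + 1"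
| "bcost (Not b) = bcost b + 1"
| "bcost (And b\<^sub>1 b\<^sub>2) = bcost b\<^sub>1 + bcost b\<^sub>2 + 1"

text \<open>\<open>exec c M t M'\<close>: started in memory \<open>M\<close>, \<open>c\<close> halts after exactly \<open>t\<close> steps in memory \<open>M'\<close>.\<close>

inductive exec :: "com \<Rightarrow> memory \<Rightarrow> nat \<Rightarrow> memory \<Rightarrow> bool" where
  Skip: "exec Skip M 1 M"
| Store: "exec (Store x e\<^sub>1 e\<^sub>2) M (acost e\<^sub>1 + acost e\<^sub>2 + 1)
            (M(x := (M x)(nat (aval e\<^sub>1 M) := aval e\<^sub>2 M)))"
| Seq: "\<lbrakk> exec c\<^sub>1 M t\<^sub>1 M'; exec c\<^sub>2 M' t\<^sub>2 M'' \<rbrakk> \<Longrightarrow> exec (Seq c\<^sub>1 c\<^sub>2) M (t\<^sub>1 + t\<^sub>2) M''"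
| IfTrue: "\<lbrakk> bval b M; exec c\<^sub>1 M t M' \<rbrakk> \<Longrightarrow> exec (If b c\<^sub>1 c\<^sub>2) M (bcost b + t + 1) M'"
| IfFalse: "\<lbrakk> \<not> bval b M; exec c\<^sub>2 M t M' \<rbrakk> \<Longrightarrow> exec (If b c\<^sub>1 c\<^sub>2) M (bcost b + t + 1) M'"
| WhileFalse: "\<not> bval b M \<Longrightarrow> exec (While b c) M (bcost b + 1) M"
| WhileTrue: "\<lbrakk> bval b M; exec c M t\<^sub>1 M'; exec (While b c) M' t\<^sub>2 M'' \<rbrakk> \<Longrightarrow>
    exec (While b c) M (bcost b + t\<^sub>1 + t\<^sub>2 + 1) M''"

inductive_cases exec_elims:
  "exec Skip M t M'"
  "exec (Store x e\<^sub>1 e\<^sub>2) M t M'"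
  "exec (Seq c\<^sub>1 c\<^sub>2) M t M'"
  "exec (If b c\<^sub>1 c\<^sub>2) M t M'"
  "exec (While b c) M t M'"

section \<open>Input and output\<close>

definition index_of :: "'v list \<Rightarrow> 'v \<Rightarrow> nat" where
  "index_of vs v = (THE i. i < length vs \<and> vs ! i = v)"

text \<open>
  A weighted game graph is given as the numbers of nodes and arcs, the owner of each node, and an
  arc list, with nodes represented by their positions in an enumeration \<open>vs\<close> and arcs listed in the
  order \<open>es\<close>.
\<close>

definition input_memory ::
  "'v set \<Rightarrow> ('v \<times> 'v \<Rightarrow> int) \<Rightarrow> 'v list \<Rightarrow> ('v \<times> 'v) list \<Rightarrow> memory" where
  "input_memory V\<^sub>A w vs es x i =
     (if x = ''n'' \<and> i = 0 then int (length vs)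
      else if x = ''m'' \<and> i = 0 then int (length es)
      else if x = ''alice'' \<and> i < length vs then (if vs ! i \<in> V\<^sub>A then 1 else 0)
      else if x = ''source'' \<and> i < length es then int (index_of vs (fst (es ! i)))
      else if x = ''target'' \<and> i < length es then int (index_of vs (snd (es ! i)))
      else if x = ''weight'' \<and> i < length es then w (es ! i)
      else 0)"

definition encode_energy :: "enat \<Rightarrow> int" where
  "encode_energy e = (case e of enat k \<Rightarrow> int k | \<infinity> \<Rightarrow> -1)"

definition computes_min_energies_within ::
  "com \<Rightarrow> 'v pair_pre_digraph \<Rightarrow> 'v set \<Rightarrow> 'v set \<Rightarrow> ('v \<times> 'v \<Rightarrow> int) \<Rightarrow> nat \<Rightarrow> bool" where
  "computes_min_energies_within prog G V\<^sub>A V\<^sub>B w T \<longleftrightarrow>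
     (\<forall>vs es. distinct vs \<and> set vs = pverts G \<and> distinct es \<and> set es = parcs G \<longrightarrow>
        (\<exists>t M. exec prog (input_memory V\<^sub>A w vs es) t M \<and> t \<le> T \<and>
           (\<forall>i < length vs. M ''energy'' i = encode_energy (min_energy G V\<^sub>A V\<^sub>B w (vs ! i)))))"

end

theory Submission
  imports Defs
begin

text \<open>
  Value iteration: all nodes start with the value 0, and as long as the Bellman inequality fails at
  some node, its value is raised to the next element of a finite set \<open>A\<close> of admissible values, or to
  \<open>\<infinity>\<close>.  The minimal energies are the least nonnegative solution of the Bellman inequalities, and a
  finite minimal energy is 0 or \<open>- w(P)\<close> for a simple path \<open>P\<close>; so if \<open>A\<close> contains these numbers, the
  iteration never exceeds the minimal energies and stops exactly there.

  The program knows neither the \<open>w\<^sub>i\<close> nor \<open>\<delta>\<close> and therefore uses the set \<open>A\<close> of all sums of at most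
  \<open>n - 1\<close> negated weights.  Such a sum is determined, up to an error of \<open>(n - 1) \<delta>\<close>, by how often each
  \<open>w\<^sub>i\<close> occurs, hence \<open>A\<close> has at most \<open>n\<^sup>d (2 (n - 1) \<delta> + 1)\<close> elements.  After a shift that makes
  all summands nonnegative, \<open>A\<close> is produced in increasing order with \<open>O(m)\<close> work per element by
  moving one pointer per summand through the sums found so far.  Raising a node costs time
  proportional to its degree, and each node is raised at most \<open>|A|\<close> times, so that both phases take
  \<open>O(m |A|)\<close> time.
\<close>

section \<open>Minimal energies and the Bellman inequalities\<close>

text \<open>On the game side the obstacle is that Bob's strategies are positional: once Alice's
  strategy is fixed, a walk may leave a node of Bob by several arcs, and no single play graph
  contains it. Bounds on all such walks are obtained by cutting out cycles. They show that the
  minimal energies themselves satisfy the Bellman inequalities; conversely, Alice reads a strategy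
  off any nonnegative solution. On the algorithmic side even a logarithmic factor for sorting
  \<open>A\<close> or searching in it would be too much. Merging by pointers avoids it, but the
  limit on the number of summands complicates the merge: each sum must carry its least number of
  summands, since this decides whether it may be extended. Node values are represented by positions
  in the sorted list, so that moving to the next admissible value is an increment. Rescanning all
  arcs of a node is avoided by counting its failing arcs, and the work of the iteration is charged
  to the raises that are still possible.\<close>

lemma weight_simps [simp]:
  "weight w [] = 0" "weight w (e # p) = w e + weight w p"
  "weight w (p @ q) = weight w p + weight w q"
  by (simp_all add: weight_def)

lemma pcas_append_iff [simp]: "pcas u (p @ q) v \<longleftrightarrow> (\<exists>x. pcas u p x \<and> pcas x q v)"
  by (induction p arbitrary: u) auto

text \<open>The weights telescope along the walk. \<open>P\<close> is the region where the potential
  is meant to be finite; arcs never lead out of it, so it is carried along in the induction.\<close>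

lemma pcas_potential:
  assumes "pcas u p v" "P u"
    and "\<And>x y. (x, y) \<in> set p \<Longrightarrow> P x \<Longrightarrow> P y \<and> h y \<le> h x + w (x, y)"
  shows "P v \<and> h v \<le> h u + weight w p"
  using assms
proof (induction p arbitrary: u)
  case (Cons e p)
  have "P (snd e) \<and> h (snd e) \<le> h u + w e"
    using Cons.prems by (cases e) auto
  moreover have "P v \<and> h v \<le> h (snd e) + weight w p"
    by (rule Cons.IH) (use Cons.prems calculation in auto)
  ultimately show ?case by simp
qed simp

lemma pcas_replicate:
  "pcas v C v \<Longrightarrow> pcas v (concat (replicate k C)) v"
  by (induction k) auto

lemma weight_replicate: "weight w (concat (replicate k C)) = int k * weight w C"
  by (induction k) (auto simp: algebra_simps)

lemma pcas_verts:
  "pcas u p v \<Longrightarrow> pawalk_verts u p = map fst p @ [v]"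
  by (induction p arbitrary: u) auto

lemma pcas_tl_verts:
  "pcas u p v \<Longrightarrow> tl (pawalk_verts u p) = map snd p"
proof (induction p arbitrary: u)
  case (Cons e p)
  then show ?case by (cases p) auto
qed simp

text \<open>On a closed walk every node is entered as often as it is left. Distinctness of the
  visited nodes thus turns into distinctness of the arc sources, the form needed for reading a
  strategy off a walk.\<close>

lemma pcas_closed_verts:
  assumes "pcas u p u" shows "mset (map snd p) = mset (map fst p)"
proof -
  \<comment> \<open>The induction needs open walks, where the two ends are the only
    imbalance.\<close>
  have "add_mset u (mset (map snd p)) = add_mset v (mset (map fst p))" if "pcas u p v" for v
    using that
  proof (induction p arbitrary: u)
    case (Cons e p)
    from Cons.IH[of "snd e"] Cons.prems show ?case by auto
  qed simp
  from this[OF assms] show ?thesis by simp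
qed

section \<open>Cycles, simple paths and energies in a fixed play graph\<close>

lemma pair_cycle_iff:
  "pre_digraph.cycle (with_proj H) C \<longleftrightarrow>
     (\<exists>u\<in>pverts H. set C \<subseteq> parcs H \<and> pcas u C u \<and> distinct (map fst C) \<and> C \<noteq> [])"
proof -
  have "distinct (tl (pawalk_verts u C)) \<longleftrightarrow> distinct (map fst C)" if "pcas u C u" for u
    using pcas_closed_verts[OF that] pcas_tl_verts[OF that] mset_eq_imp_distinct_iff by metis
  then show ?thesis
    by (auto simp: pre_digraph.cycle_def pre_digraph.awalk_def cas_with_proj_eq
        awalk_verts_with_proj_eq)
qed

lemma pair_apath_iff:
  "pre_digraph.apath (with_proj H) u p v \<longleftrightarrow>
     u \<in> pverts H \<and> set p \<subseteq> parcs H \<and> pcas u p v \<and> distinct (map fst p @ [v])"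
  by (auto simp: pre_digraph.apath_def pre_digraph.awalk_def cas_with_proj_eq
      awalk_verts_with_proj_eq pcas_verts) force

lemma pair_reachable_iff:
  assumes "pair_wf_digraph H"
  shows "u \<rightarrow>\<^sup>*\<^bsub>with_proj H\<^esub> v \<longleftrightarrow> (\<exists>p. u \<in> pverts H \<and> set p \<subseteq> parcs H \<and> pcas u p v)"
proof -
  interpret pair_wf_digraph H by fact
  show ?thesis by (auto simp: reachable_awalk awalk_def)
qed

lemma pair_apath_length:
  assumes "pair_fin_digraph H" "pre_digraph.apath (with_proj H) u p v"
  shows "length p < card (pverts H)"
proof -
  interpret pair_fin_digraph H by fact
  from assms(2) have p: "u \<in> pverts H" "set p \<subseteq> parcs H" "pcas u p v" "distinct (map fst p @ [v])"
    by (auto simp: pair_apath_iff)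
  have "v \<in> pverts H"
    using p(1-3) by (induction p arbitrary: u) (auto dest: arc_snd_in_verts)
  with p(2) have "set (map fst p @ [v]) \<subseteq> pverts H" by (auto dest: arc_fst_in_verts)
  then have "card (set (map fst p @ [v])) \<le> card (pverts H)"
    using pair_finite_verts card_mono by blast
  with p(4) show ?thesis unfolding distinct_card[OF p(4)] by simp
qed

lemma finite_pair_apath_weights:
  assumes "pair_fin_digraph H"
  shows "finite {weight w p | p. \<exists>v. pre_digraph.apath (with_proj H) u p v}"
proof -
  interpret pair_fin_digraph H by fact
  have "{p. \<exists>v. apath u p v} \<subseteq> {p. set p \<subseteq> parcs H \<and> length p \<le> card (pverts H)}"
    using pair_apath_length[OF assms] by (fastforce simp: pair_apath_iff)
  then have "finite {p. \<exists>v. apath u p v}"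
    using finite_lists_length_le[OF pair_finite_arcs] finite_subset by blast
  then show ?thesis
    by (rule rev_finite_subset[OF finite_imageI[where h = "weight w"]]) auto
qed

text \<open>Removes \<open>Min\<close>, \<open>nat\<close> and the case of infinite energy.
  Reachability of a cycle is expressed by a walk \<open>p\<close>, so that it can be concatenated
  with other walks.\<close>

lemma play_energy_le_iff:
  assumes H: "pair_fin_digraph H" and s: "s \<in> pverts H"
  shows "play_energy H w s \<le> enat x \<longleftrightarrow>
    (\<forall>C p. pre_digraph.cycle (with_proj H) C \<longrightarrow> set p \<subseteq> parcs H \<longrightarrow> pcas s p (fst (hd C)) \<longrightarrow>
        0 \<le> weight w C) \<and>
    (\<forall>p v. pre_digraph.apath (with_proj H) s p v \<longrightarrow> - int x \<le> weight w p)"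
proof -
  interpret pair_fin_digraph H by fact
  let ?S = "{weight w p | p. \<exists>v. apath s p v}"
  have fin: "finite ?S" using finite_pair_apath_weights[OF H] .
  \<comment> \<open>The empty path makes the set of path weights nonempty, as
    \<open>Min_ge_iff\<close> requires.\<close>
  have "weight w [] \<in> ?S" using s unfolding mem_Collect_eq pair_apath_iff
    by (intro exI[of _ "[]"] conjI refl exI[of _ s]) auto
  then have "- int x \<le> Min ?S \<longleftrightarrow> (\<forall>p v. apath s p v \<longrightarrow> - int x \<le> weight w p)"
    by (subst Min_ge_iff[OF fin]) auto
  moreover have "(nat (max 0 (- m)) \<le> x) = (- int x \<le> m)" for m by auto
  moreover have "s \<rightarrow>\<^sup>*\<^bsub>with_proj H\<^esub> v \<longleftrightarrow> (\<exists>p. set p \<subseteq> parcs H \<and> pcas s p v)" for v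
    using pair_reachable_iff[of H s v] s pair_wf_digraph_axioms by blast
  ultimately show ?thesis
    unfolding play_energy_def by (simp add: not_less) (meson not_less)
qed

text \<open>The least path weight is attained by a simple path, whose length is below the number of
  nodes. This is the origin of the limit of \<open>n - 1\<close> summands.\<close>

lemma play_energy_eqD:
  assumes H: "pair_fin_digraph H" and s: "s \<in> pverts H" and "play_energy H w s = enat x"
  shows "x = 0 \<or> (\<exists>p. set p \<subseteq> parcs H \<and> length p < card (pverts H) \<and> int x = - weight w p)"
proof -
  interpret pair_fin_digraph H by fact
  let ?S = "{weight w p | p. \<exists>v. apath s p v}"
  have fin: "finite ?S" using finite_pair_apath_weights[OF H] .
  have "weight w [] \<in> ?S" using s unfolding mem_Collect_eq pair_apath_iff
    by (intro exI[of _ "[]"] conjI refl exI[of _ s]) auto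
  then have "Min ?S \<in> ?S" using fin Min_in by blast
  then obtain p v where p: "apath s p v" "Min ?S = weight w p" by auto
  have "x = nat (max 0 (- Min ?S))"
    using assms(3) unfolding play_energy_def by (auto split: if_splits)
  then have "x = 0 \<or> int x = - weight w p" using p(2) by auto
  moreover have "set p \<subseteq> parcs H" using p(1) by (simp add: pair_apath_iff)
  ultimately show ?thesis using pair_apath_length[OF H p(1)] by blast
qed

text \<open>Telescoping around a cycle gives \<open>0 \<le> weight w C\<close>; along a path to
  \<open>v\<close> it gives \<open>weight w p \<ge> h v - h s \<ge> - h s\<close>.\<close>

lemma play_energy_le_potential:
  assumes H: "pair_fin_digraph H" and s: "s \<in> pverts H" "P s"
    and step: "\<And>x y. (x, y) \<in> parcs H \<Longrightarrow> P x \<Longrightarrow> P y \<and> h y \<le> h x + w (x, y)"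
    and nonneg: "\<And>x. x \<in> pverts H \<Longrightarrow> P x \<Longrightarrow> 0 \<le> (h x :: int)"
  shows "play_energy H w s \<le> enat (nat (h s))"
proof (subst play_energy_le_iff[OF H s(1)], intro conjI allI impI)
  interpret pair_fin_digraph H by fact
  fix C p assume C: "cycle C" and p: "set p \<subseteq> parcs H" "pcas s p (fst (hd C))"
  from C obtain u where u: "set C \<subseteq> parcs H" "pcas u C u" "C \<noteq> []"
    by (auto simp: pair_cycle_iff)
  then have "u = fst (hd C)" by (cases C) auto
  then have "P u" using pcas_potential[where h = h and w = w and P = P, OF p(2) s(2)] step p(1) by blast
  then show "0 \<le> weight w C"
    using pcas_potential[where h = h and w = w and P = P, OF u(2)] step u(1) by fastforce
next
  interpret pair_fin_digraph H by fact
  fix p v assume "apath s p v"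
  then have p: "set p \<subseteq> parcs H" "pcas s p v" by (auto simp: pair_apath_iff)
  have v: "v \<in> pverts H"
    using p s(1) by (induction p arbitrary: s) (auto dest: arc_snd_in_verts)
  have "P v \<and> h v \<le> h s + weight w p"
    using pcas_potential[where h = h and w = w and P = P, OF p(2) s(2)] step p(1) by blast
  with nonneg[OF v] nonneg[OF s] show "- int (nat (h s)) \<le> weight w p" by simp
qed

section \<open>Strategies and the Bellman inequalities of the game\<close>

context game_graph
begin

lemma out_neighbor_exists: "u \<in> pverts G \<Longrightarrow> \<exists>v. (u, v) \<in> parcs G"
proof -
  assume "u \<in> pverts G"
  then have "card (out_arcs (with_proj G) u) \<ge> 1"
    using out_degree_pos by (simp add: out_degree_def)
  then have "out_arcs (with_proj G) u \<noteq> {}" by (metis card.empty not_one_le_zero)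
  then show ?thesis by (auto simp: out_arcs_def)
qed

lemma finite_players: "finite V\<^sub>A" "finite V\<^sub>B"
  using partition pair_finite_verts by (metis finite_Un)+

lemma finite_strategies:
  assumes "finite U" shows "finite (strategies G U)"
proof -
  have "{v. (u, v) \<in> parcs G} \<subseteq> snd ` parcs G" for u by force
  then show ?thesis unfolding strategies_def
    using assms pair_finite_arcs by (meson finite_PiE finite_imageI finite_subset)
qed

lemma strategies_nonempty:
  assumes "U \<subseteq> pverts G" shows "strategies G U \<noteq> {}"
  using assms out_neighbor_exists unfolding strategies_def by (auto simp: PiE_eq_empty_iff)

lemma play_graph_fin:
  assumes "\<sigma> \<in> strategies G V\<^sub>A" "\<tau> \<in> strategies G V\<^sub>B"
  shows "pair_fin_digraph (play_graph G V\<^sub>A V\<^sub>B \<sigma> \<tau>)"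
proof -
  have "parcs (play_graph G V\<^sub>A V\<^sub>B \<sigma> \<tau>) \<subseteq> parcs G"
    using assms by (auto simp: play_graph_def strategies_def)
  moreover from this have "finite (parcs (play_graph G V\<^sub>A V\<^sub>B \<sigma> \<tau>))"
    using pair_finite_arcs finite_subset by blast
  ultimately show ?thesis
    using pair_finite_verts
    by unfold_locales (auto simp: play_graph_def dest!: subsetD intro: wellformed')
qed

lemma play_graph_arcs:
  assumes "\<sigma> \<in> strategies G V\<^sub>A" "\<tau> \<in> strategies G V\<^sub>B"
  shows "parcs (play_graph G V\<^sub>A V\<^sub>B \<sigma> \<tau>) =
    {(u, v) \<in> parcs G. (u \<in> V\<^sub>A \<longrightarrow> v = \<sigma> u) \<and> (u \<in> V\<^sub>B \<longrightarrow> v = \<tau> u)}"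
  using assms partition by (auto simp: play_graph_def strategies_def dest: in_arcsD1)

lemma pverts_play_graph [simp]: "pverts (play_graph G V\<^sub>A V\<^sub>B \<sigma> \<tau>) = pverts G"
  by (simp add: play_graph_def)

lemma min_energy_le_iff:
  "min_energy G V\<^sub>A V\<^sub>B w s \<le> e \<longleftrightarrow> (\<exists>\<sigma>\<in>strategies G V\<^sub>A. \<forall>\<tau>\<in>strategies G V\<^sub>B.
     play_energy (play_graph G V\<^sub>A V\<^sub>B \<sigma> \<tau>) w s \<le> e)"
proof -
  have A: "V\<^sub>A \<subseteq> pverts G" "V\<^sub>B \<subseteq> pverts G" using partition by auto
  note facts = finite_strategies[OF finite_players(1)] finite_strategies[OF finite_players(2)]
    strategies_nonempty[OF A(1)] strategies_nonempty[OF A(2)]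
  show ?thesis
    unfolding min_energy_def using facts by (subst Min_le_iff) auto
qed

text \<open>\<open>Min\<close> and \<open>Max\<close> over the finite nonempty strategy sets are
  attained, so a finite value is the energy of one particular play graph.\<close>

lemma min_energy_eqD:
  assumes "min_energy G V\<^sub>A V\<^sub>B w s = enat x" "s \<in> pverts G"
  shows "x = 0 \<or> (\<exists>p. set p \<subseteq> parcs G \<and> length p < card (pverts G) \<and> int x = - weight w p)"
proof -
  have A: "V\<^sub>A \<subseteq> pverts G" "V\<^sub>B \<subseteq> pverts G" using partition by auto
  note facts = finite_strategies[OF finite_players(1)] finite_strategies[OF finite_players(2)]
    strategies_nonempty[OF A(1)] strategies_nonempty[OF A(2)]
  let ?e = "\<lambda>\<sigma> \<tau>. play_energy (play_graph G V\<^sub>A V\<^sub>B \<sigma> \<tau>) w s"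
  have "min_energy G V\<^sub>A V\<^sub>B w s \<in> (\<lambda>\<sigma>. MAX \<tau>\<in>strategies G V\<^sub>B. ?e \<sigma> \<tau>) ` strategies G V\<^sub>A"
    unfolding min_energy_def using facts by (intro Min_in) auto
  then obtain \<sigma> where \<sigma>: "\<sigma> \<in> strategies G V\<^sub>A" "enat x = (MAX \<tau>\<in>strategies G V\<^sub>B. ?e \<sigma> \<tau>)"
    using assms by auto
  have "(MAX \<tau>\<in>strategies G V\<^sub>B. ?e \<sigma> \<tau>) \<in> ?e \<sigma> ` strategies G V\<^sub>B"
    using facts by (intro Max_in) auto
  then obtain \<tau> where \<tau>: "\<tau> \<in> strategies G V\<^sub>B" "?e \<sigma> \<tau> = enat x" using \<sigma>(2) by auto
  from play_energy_eqD[OF play_graph_fin[OF \<sigma>(1) \<tau>(1)] _ \<tau>(2)] assms(2)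
  show ?thesis using play_graph_arcs[OF \<sigma>(1) \<tau>(1)] by auto
qed

text \<open>At every node in \<open>P\<close> Alice follows an arc that respects the potential. This
  one strategy serves against every answer of Bob, whose arcs all respect it by assumption.\<close>

lemma min_energy_le_potential:
  assumes nonneg: "\<And>u. u \<in> pverts G \<Longrightarrow> P u \<Longrightarrow> 0 \<le> (h u :: int)"
    and alice: "\<And>u. u \<in> V\<^sub>A \<Longrightarrow> P u \<Longrightarrow> \<exists>v. (u, v) \<in> parcs G \<and> P v \<and> h v \<le> h u + w (u, v)"
    and bob: "\<And>u v. u \<in> V\<^sub>B \<Longrightarrow> P u \<Longrightarrow> (u, v) \<in> parcs G \<Longrightarrow> P v \<and> h v \<le> h u + w (u, v)"
    and s: "s \<in> pverts G" "P s"
  shows "min_energy G V\<^sub>A V\<^sub>B w s \<le> enat (nat (h s))"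
proof -
  \<comment> \<open>Outside \<open>P\<close> any arc is good, so that the choice yields a strategy
    on all of \<open>V\<^sub>A\<close>.\<close>
  define good where "good u v \<longleftrightarrow> (u, v) \<in> parcs G \<and> (P u \<longrightarrow> P v \<and> h v \<le> h u + w (u, v))" for u v
  have "\<exists>v. good u v" if "u \<in> V\<^sub>A" for u
    using alice[OF that] out_neighbor_exists[of u] that partition unfolding good_def by blast
  then have good: "good u (SOME v. good u v)" if "u \<in> V\<^sub>A" for u
    using that by (meson someI_ex)
  define \<sigma> where "\<sigma> = (\<lambda>u\<in>V\<^sub>A. SOME v. good u v)"
  have \<sigma>: "\<sigma> \<in> strategies G V\<^sub>A"
    using good unfolding \<sigma>_def strategies_def good_def by auto
  have "play_energy (play_graph G V\<^sub>A V\<^sub>B \<sigma> \<tau>) w s \<le> enat (nat (h s))"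
    if \<tau>: "\<tau> \<in> strategies G V\<^sub>B" for \<tau>
  proof (rule play_energy_le_potential[where P = P, OF play_graph_fin[OF \<sigma> \<tau>]])
    fix x y assume "(x, y) \<in> parcs (play_graph G V\<^sub>A V\<^sub>B \<sigma> \<tau>)" and "P x"
    then have xy: "(x, y) \<in> parcs G" "x \<in> V\<^sub>A \<Longrightarrow> y = \<sigma> x"
      unfolding play_graph_arcs[OF \<sigma> \<tau>] by auto
    show "P y \<and> h y \<le> h x + w (x, y)"
    proof (cases "x \<in> V\<^sub>A")
      case True
      then show ?thesis using good[OF True] xy \<open>P x\<close> by (simp add: \<sigma>_def good_def)
    next
      case False
      then have "x \<in> V\<^sub>B" using xy(1) partition in_arcsD1 by auto
      then show ?thesis using bob \<open>P x\<close> xy(1) by auto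
    qed
  qed (use nonneg s in auto)
  with \<sigma> show ?thesis unfolding min_energy_le_iff by blast
qed

text \<open>A walk is realised by a positional strategy of Bob as long as no node is left twice.\<close>

lemma distinct_walk_realizable:
  assumes \<sigma>: "\<sigma> \<in> strategies G V\<^sub>A"
    and p: "set p \<subseteq> {(u, v) \<in> parcs G. u \<in> V\<^sub>A \<longrightarrow> v = \<sigma> u}" "distinct (map fst p)"
  obtains \<tau> where "\<tau> \<in> strategies G V\<^sub>B" "set p \<subseteq> parcs (play_graph G V\<^sub>A V\<^sub>B \<sigma> \<tau>)"
proof -
  define good where "good u v \<longleftrightarrow> (u, v) \<in> parcs G \<and> (\<forall>v'. (u, v') \<in> set p \<longrightarrow> v = v')" for u v
  have uniq: "v = v'" if "(u, v) \<in> set p" "(u, v') \<in> set p" for u v v'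
    using p(2) that by (meson eq_key_imp_eq_value)
  have "\<exists>v. good u v" if "u \<in> V\<^sub>B" for u
  proof (cases "\<exists>v. (u, v) \<in> set p")
    case True
    then show ?thesis using uniq p(1) unfolding good_def by blast
  next
    case False
    then show ?thesis using out_neighbor_exists[of u] that partition unfolding good_def by blast
  qed
  then have good: "good u (SOME v. good u v)" if "u \<in> V\<^sub>B" for u
    using that by (meson someI_ex)
  define \<tau> where "\<tau> = (\<lambda>u\<in>V\<^sub>B. SOME v. good u v)"
  have \<tau>: "\<tau> \<in> strategies G V\<^sub>B"
    using good unfolding \<tau>_def strategies_def good_def by auto
  have "v = \<tau> u" if "(u, v) \<in> set p" "u \<in> V\<^sub>B" for u v
    using good[OF that(2)] that unfolding \<tau>_def good_def by auto
  then have "set p \<subseteq> parcs (play_graph G V\<^sub>A V\<^sub>B \<sigma> \<tau>)"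
    using p(1) unfolding play_graph_arcs[OF \<sigma> \<tau>] by auto
  with \<tau> that show thesis by blast
qed

text \<open>The walk may leave a node of Bob by different arcs at different visits and then fits no
  play graph. Induction on its length cuts out one cycle at a time, chosen such that it forms, with
  the part before it, a lasso with distinct sources. Such a lasso is realisable, so the removed
  cycle has nonnegative weight. What finally remains is a simple path.\<close>

lemma walk_weight_ge:
  assumes \<sigma>: "\<sigma> \<in> strategies G V\<^sub>A" and s: "s \<in> pverts G"
    and win: "\<And>\<tau>. \<tau> \<in> strategies G V\<^sub>B \<Longrightarrow> play_energy (play_graph G V\<^sub>A V\<^sub>B \<sigma> \<tau>) w s \<le> enat x"
    and p: "set p \<subseteq> {(u, v) \<in> parcs G. u \<in> V\<^sub>A \<longrightarrow> v = \<sigma> u}" "pcas s p t"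
  shows "- int x \<le> weight w p"
proof -
  let ?R = "{(u, v) \<in> parcs G. u \<in> V\<^sub>A \<longrightarrow> v = \<sigma> u}"
  \<comment> \<open>A lasso with distinct sources lies in one play graph, where the finite energy at
    \<open>s\<close> forbids a negative cycle.\<close>
  have cycle: "0 \<le> weight w q2"
    if "set (q1 @ q2) \<subseteq> ?R" "distinct (map fst (q1 @ q2))" "pcas s q1 y" "pcas y q2 y" "q2 \<noteq> []" for q1 q2 y
  proof -
    from distinct_walk_realizable[OF \<sigma> that(1,2)] obtain \<tau> where \<tau>: "\<tau> \<in> strategies G V\<^sub>B"
      and sub: "set (q1 @ q2) \<subseteq> parcs (play_graph G V\<^sub>A V\<^sub>B \<sigma> \<tau>)" by blast
    let ?H = "play_graph G V\<^sub>A V\<^sub>B \<sigma> \<tau>"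
    have fin: "pair_fin_digraph ?H" using play_graph_fin[OF \<sigma> \<tau>] .
    have y: "y = fst (hd q2)" using that(4,5) by (cases q2) auto
    have "hd q2 \<in> ?R" using that(1,5) by (cases q2) auto
    then have "y \<in> pverts ?H" unfolding y by (auto dest: in_arcsD1)
    then have "pre_digraph.cycle (with_proj ?H) q2"
      using sub that unfolding pair_cycle_iff by auto
    then show ?thesis
      using win[OF \<tau>] sub that(3) y s unfolding play_energy_le_iff[OF fin, simplified, OF s] by auto
  qed
  show ?thesis using p
  proof (induction "length p" arbitrary: p rule: less_induct)
    case less
    show ?case
    proof (cases "distinct (map fst p)")
      case True
      show ?thesis
      proof (cases "t \<in> fst ` set p")
        case False
        from distinct_walk_realizable[OF \<sigma> less.prems(1) True] obtain \<tau>
          where \<tau>: "\<tau> \<in> strategies G V\<^sub>B"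
            and sub: "set p \<subseteq> parcs (play_graph G V\<^sub>A V\<^sub>B \<sigma> \<tau>)" by blast
        have "pre_digraph.apath (with_proj (play_graph G V\<^sub>A V\<^sub>B \<sigma> \<tau>)) s p t"
          using sub less.prems(2) True False s by (simp add: pair_apath_iff)
        then show ?thesis
          using win[OF \<tau>] s play_energy_le_iff[OF play_graph_fin[OF \<sigma> \<tau>]] by auto
      next
        case t: True
        \<comment> \<open>All sources are distinct, but the walk ends in a node that it has left:
          its tail from there is a cycle.\<close>
        then obtain p1 e p2 where e: "p = p1 @ e # p2" "fst e = t"
          by (metis imageE split_list)
        with less.prems(2) have w: "pcas s p1 t" "pcas t (e # p2) t" by auto
        have "0 \<le> weight w (e # p2)"
          using cycle[of p1 "e # p2" t] e(1) less.prems(1) True w by simp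
        moreover have "- int x \<le> weight w p1"
          by (rule less.hyps) (use e less.prems w in auto)
        ultimately show ?thesis using e(1) by simp
      qed
    next
      case False
      \<comment> \<open>The shortest prefix that repeats a source: everything before the second
        visit of \<open>y\<close> has distinct sources, and the part since the first visit closes
        the lasso.\<close>
      then obtain ys y zs where q: "y \<in> set ys" "distinct ys" "map fst p = ys @ y # zs"
        by (auto simp: not_distinct_conv_prefix)
      then obtain q e r where p_eq: "p = q @ e # r" "ys = map fst q" "fst e = y"
        by (auto simp: map_eq_append_conv map_eq_Cons_conv)
      obtain q1 f q2 where q_eq: "q = q1 @ f # q2" "fst f = y"
        using q(1) p_eq(2) by (metis (no_types, lifting) imageE list.set_map split_list)
      have w: "pcas s q1 y" "pcas y (f # q2) y" "pcas y (e # r) t"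
        using less.prems(2) p_eq q_eq by auto
      have "0 \<le> weight w (f # q2)"
        using cycle[of q1 "f # q2" y] p_eq q_eq q(2) less.prems(1) w by simp
      moreover have "- int x \<le> weight w (q1 @ e # r)"
        by (rule less.hyps) (use p_eq q_eq less.prems w in auto)
      ultimately show ?thesis using p_eq q_eq by simp
    qed
  qed
qed

text \<open>Every walk from \<open>v\<close> that respects \<sigma> becomes one from
  \<open>u\<close> by prepending the arc, so the same \<sigma> is good from \<open>v\<close>. If
  \<open>u\<close> belongs to Bob, \<tau> may prescribe another arc at \<open>u\<close>; the
  prepended walk is then outside the play graph of \<sigma> and \<tau>, and the bound on arbitrary
  walks takes over.\<close>

lemma strategy_step:
  assumes \<sigma>: "\<sigma> \<in> strategies G V\<^sub>A"
    and win: "\<And>\<tau>. \<tau> \<in> strategies G V\<^sub>B \<Longrightarrow> play_energy (play_graph G V\<^sub>A V\<^sub>B \<sigma> \<tau>) w u \<le> enat x"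
    and arc: "(u, v) \<in> parcs G" "u \<in> V\<^sub>A \<Longrightarrow> v = \<sigma> u"
  shows "0 \<le> int x + w (u, v)"
    and "min_energy G V\<^sub>A V\<^sub>B w v \<le> enat (nat (int x + w (u, v)))"
proof -
  let ?R = "{(u, v) \<in> parcs G. u \<in> V\<^sub>A \<longrightarrow> v = \<sigma> u}"
  have u: "u \<in> pverts G" and v: "v \<in> pverts G" using arc(1) by (auto dest: wellformed')
  have step: "- int x \<le> w (u, v) + weight w p" if "set p \<subseteq> ?R" "pcas v p t" for p t
    using walk_weight_ge[OF \<sigma> u win, of "(u, v) # p" t] that arc by auto
  from step[of "[]" v] show nonneg: "0 \<le> int x + w (u, v)" by simp
  have "play_energy (play_graph G V\<^sub>A V\<^sub>B \<sigma> \<tau>) w v \<le> enat (nat (int x + w (u, v)))"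
    if \<tau>: "\<tau> \<in> strategies G V\<^sub>B" for \<tau>
  proof -
    let ?H = "play_graph G V\<^sub>A V\<^sub>B \<sigma> \<tau>"
    have sub: "parcs ?H \<subseteq> ?R" using play_graph_arcs[OF \<sigma> \<tau>] by auto
    have fin: "pair_fin_digraph ?H" using play_graph_fin[OF \<sigma> \<tau>] .
    show ?thesis
    proof (subst play_energy_le_iff[OF fin], use v in simp, intro conjI allI impI)
      fix C p assume C: "pre_digraph.cycle (with_proj ?H) C" and p: "set p \<subseteq> parcs ?H" "pcas v p (fst (hd C))"
      from C obtain y where y: "set C \<subseteq> parcs ?H" "pcas y C y" "C \<noteq> []"
        by (auto simp: pair_cycle_iff)
      then have "y = fst (hd C)" by (cases C) auto
      with p have p': "pcas v p y" by simp
      show "0 \<le> weight w C"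
      proof (rule ccontr)
        assume "\<not> 0 \<le> weight w C"
        \<comment> \<open>Enough turns around a negative cycle, each losing at least 1, to push the
          weight of the walk below \<open>- int x\<close>.\<close>
        define k where "k = Suc x + nat (w (u, v) + weight w p)"
        have "set (p @ concat (replicate k C)) \<subseteq> ?R" using p(1) y(1) sub by auto
        moreover have "pcas v (p @ concat (replicate k C)) y" using p' pcas_replicate[OF y(2)] by auto
        ultimately have "- int x \<le> w (u, v) + weight w (p @ concat (replicate k C))" by (rule step)
        moreover have "int k * weight w C \<le> - int k"
          using mult_left_mono[of "weight w C" "-1" "int k"] \<open>\<not> 0 \<le> weight w C\<close> by simp
        moreover have "int x + w (u, v) + weight w p < int k" unfolding k_def by simp
        ultimately show False by (simp only: weight_simps weight_replicate)
      qed
    next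
      fix p t assume "pre_digraph.apath (with_proj ?H) v p t"
      then have "set p \<subseteq> ?R" "pcas v p t" using sub by (auto simp: pair_apath_iff)
      from step[OF this] show "- int (nat (int x + w (u, v))) \<le> weight w p" using nonneg by simp
    qed
  qed
  with \<sigma> show "min_energy G V\<^sub>A V\<^sub>B w v \<le> enat (nat (int x + w (u, v)))"
    unfolding min_energy_le_iff by blast
qed

lemma min_energy_step_bob:
  assumes "min_energy G V\<^sub>A V\<^sub>B w u = enat x" "u \<in> V\<^sub>B" "(u, v) \<in> parcs G"
  shows "0 \<le> int x + w (u, v) \<and> min_energy G V\<^sub>A V\<^sub>B w v \<le> enat (nat (int x + w (u, v)))"
proof -
  have "min_energy G V\<^sub>A V\<^sub>B w u \<le> enat x" using assms by simp
  then obtain \<sigma> where \<sigma>: "\<sigma> \<in> strategies G V\<^sub>A"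
    "\<And>\<tau>. \<tau> \<in> strategies G V\<^sub>B \<Longrightarrow> play_energy (play_graph G V\<^sub>A V\<^sub>B \<sigma> \<tau>) w u \<le> enat x"
    unfolding min_energy_le_iff by blast
  moreover have "u \<notin> V\<^sub>A" using assms(2) partition by auto
  ultimately show ?thesis using strategy_step[OF \<sigma> assms(3)] by auto
qed

lemma min_energy_step_alice:
  assumes "min_energy G V\<^sub>A V\<^sub>B w u = enat x" "u \<in> V\<^sub>A"
  shows "\<exists>v. (u, v) \<in> parcs G \<and> 0 \<le> int x + w (u, v) \<and>
    min_energy G V\<^sub>A V\<^sub>B w v \<le> enat (nat (int x + w (u, v)))"
proof -
  have "min_energy G V\<^sub>A V\<^sub>B w u \<le> enat x" using assms by simp
  then obtain \<sigma> where \<sigma>: "\<sigma> \<in> strategies G V\<^sub>A"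
    "\<And>\<tau>. \<tau> \<in> strategies G V\<^sub>B \<Longrightarrow> play_energy (play_graph G V\<^sub>A V\<^sub>B \<sigma> \<tau>) w u \<le> enat x"
    unfolding min_energy_le_iff by blast
  moreover have "(u, \<sigma> u) \<in> parcs G" using \<sigma>(1) assms(2) unfolding strategies_def by auto
  ultimately show ?thesis using strategy_step[OF \<sigma>, of "\<sigma> u"] by auto
qed

end

section \<open>Total correctness with time credits\<close>

declare One_nat_def [simp del]

text \<open>The postcondition receives the unspent credit \<open>k - t\<close>, so loop invariants
  can hold credit and amortised bounds need no separate accounting. The rules for everything but
  loops are equivalences, with which simplification executes the code symbolically.\<close>

definition run :: "com \<Rightarrow> memory \<Rightarrow> nat \<Rightarrow> (memory \<Rightarrow> nat \<Rightarrow> bool) \<Rightarrow> bool" where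
  "run c M k Q \<longleftrightarrow> (\<exists>t M'. exec c M t M' \<and> t \<le> k \<and> Q M' (k - t))"

lemma run_Skip [simp]: "run Skip M k Q \<longleftrightarrow> 1 \<le> k \<and> Q M (k - 1)"
  unfolding run_def by (metis exec.Skip exec_elims(1))

lemma run_Store [simp]:
  "run (Store x e\<^sub>1 e\<^sub>2) M k Q \<longleftrightarrow> acost e\<^sub>1 + acost e\<^sub>2 + 1 \<le> k \<and>
     Q (M(x := (M x)(nat (aval e\<^sub>1 M) := aval e\<^sub>2 M))) (k - (acost e\<^sub>1 + acost e\<^sub>2 + 1))"
proof
  assume "run (Store x e\<^sub>1 e\<^sub>2) M k Q"
  then show "acost e\<^sub>1 + acost e\<^sub>2 + 1 \<le> k \<and>
     Q (M(x := (M x)(nat (aval e\<^sub>1 M) := aval e\<^sub>2 M))) (k - (acost e\<^sub>1 + acost e\<^sub>2 + 1))"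
    unfolding run_def by (elim exE conjE exec_elims) (simp only: Suc_eq_plus1)
qed (unfold run_def, blast intro: exec.Store)

lemma run_Seq [simp]: "run (Seq c\<^sub>1 c\<^sub>2) M k Q \<longleftrightarrow> run c\<^sub>1 M k (\<lambda>M' k'. run c\<^sub>2 M' k' Q)"
proof
  assume "run (Seq c\<^sub>1 c\<^sub>2) M k Q"
  then obtain t\<^sub>1 t\<^sub>2 M\<^sub>1 M\<^sub>2 where "exec c\<^sub>1 M t\<^sub>1 M\<^sub>1" "exec c\<^sub>2 M\<^sub>1 t\<^sub>2 M\<^sub>2" "t\<^sub>1 + t\<^sub>2 \<le> k" "Q M\<^sub>2 (k - (t\<^sub>1 + t\<^sub>2))"
    unfolding run_def by (auto elim: exec_elims)
  moreover from this have "t\<^sub>1 \<le> k" "t\<^sub>2 \<le> k - t\<^sub>1" "k - t\<^sub>1 - t\<^sub>2 = k - (t\<^sub>1 + t\<^sub>2)" by auto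
  ultimately show "run c\<^sub>1 M k (\<lambda>M' k'. run c\<^sub>2 M' k' Q)"
    unfolding run_def by metis
next
  assume "run c\<^sub>1 M k (\<lambda>M' k'. run c\<^sub>2 M' k' Q)"
  then obtain t\<^sub>1 t\<^sub>2 M\<^sub>1 M\<^sub>2 where "exec c\<^sub>1 M t\<^sub>1 M\<^sub>1" "t\<^sub>1 \<le> k" "exec c\<^sub>2 M\<^sub>1 t\<^sub>2 M\<^sub>2" "t\<^sub>2 \<le> k - t\<^sub>1" "Q M\<^sub>2 (k - t\<^sub>1 - t\<^sub>2)"
    unfolding run_def by auto
  then show "run (Seq c\<^sub>1 c\<^sub>2) M k Q"
    unfolding run_def by (intro exI[of _ "t\<^sub>1 + t\<^sub>2"] exI[of _ M\<^sub>2]) (auto intro: exec.Seq)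
qed

lemma run_If [simp]:
  "run (If b c\<^sub>1 c\<^sub>2) M k Q \<longleftrightarrow> bcost b + 1 \<le> k \<and>
     (bval b M \<longrightarrow> run c\<^sub>1 M (k - (bcost b + 1)) Q) \<and>
     (\<not> bval b M \<longrightarrow> run c\<^sub>2 M (k - (bcost b + 1)) Q)"
  (is "?L \<longleftrightarrow> ?R")
proof
  assume ?L
  then obtain t M' where t: "exec (If b c\<^sub>1 c\<^sub>2) M t M'" "t \<le> k" "Q M' (k - t)"
    unfolding run_def by auto
  from t(1) obtain t' where t': "t = bcost b + t' + 1"
    "bval b M \<and> exec c\<^sub>1 M t' M' \<or> \<not> bval b M \<and> exec c\<^sub>2 M t' M'"
    by (auto elim: exec_elims)
  moreover have "t' \<le> k - (bcost b + 1)" "k - (bcost b + 1) - t' = k - t" "bcost b + 1 \<le> k"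
    using t(2) t'(1) by auto
  ultimately show ?R using t(3) unfolding run_def by metis
next
  assume R: ?R
  show ?L
  proof (cases "bval b M")
    case True
    with R obtain t M' where "exec c\<^sub>1 M t M'" "t \<le> k - (bcost b + 1)" "Q M' (k - (bcost b + 1) - t)"
      unfolding run_def by auto
    moreover from this have "bcost b + t + 1 \<le> k" "k - (bcost b + 1) - t = k - (bcost b + t + 1)"
      using R by auto
    moreover have "exec (If b c\<^sub>1 c\<^sub>2) M (bcost b + t + 1) M'"
      using exec.IfTrue[OF True] calculation(1) .
    ultimately show ?thesis unfolding run_def
      by (intro exI[of _ "bcost b + t + 1"] exI[of _ M'] conjI) (simp_all only:)
  next
    case False
    with R obtain t M' where "exec c\<^sub>2 M t M'" "t \<le> k - (bcost b + 1)" "Q M' (k - (bcost b + 1) - t)"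
      unfolding run_def by auto
    moreover from this have "bcost b + t + 1 \<le> k" "k - (bcost b + 1) - t = k - (bcost b + t + 1)"
      using R by auto
    moreover have "exec (If b c\<^sub>1 c\<^sub>2) M (bcost b + t + 1) M'"
      using exec.IfFalse[OF False] calculation(1) .
    ultimately show ?thesis unfolding run_def
      by (intro exI[of _ "bcost b + t + 1"] exI[of _ M'] conjI) (simp_all only:)
  qed
qed

text \<open>No variant is needed: every iteration consumes credit.\<close>

lemma run_While:
  assumes "I M k"
    and cost: "\<And>M k. I M k \<Longrightarrow> bcost b + 1 \<le> k"
    and body: "\<And>M k. I M k \<Longrightarrow> bval b M \<Longrightarrow> run c M (k - (bcost b + 1)) I"
    and exit: "\<And>M k. I M k \<Longrightarrow> \<not> bval b M \<Longrightarrow> Q M (k - (bcost b + 1))"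
  shows "run (While b c) M k Q"
  using assms(1)
proof (induction k arbitrary: M rule: less_induct)
  case (less k)
  show ?case
  proof (cases "bval b M")
    case True
    from body[OF less.prems True] obtain t M' where t: "exec c M t M'" "t \<le> k - (bcost b + 1)"
      "I M' (k - (bcost b + 1) - t)"
      unfolding run_def by auto
    have "k - (bcost b + 1) - t < k" using cost[OF less.prems] by simp
    from less.IH[OF this t(3)] obtain t' M'' where t': "exec (While b c) M' t' M''"
      "t' \<le> k - (bcost b + 1) - t" "Q M'' (k - (bcost b + 1) - t - t')"
      unfolding run_def by auto
    then show ?thesis using cost[OF less.prems] t(2) exec.WhileTrue[OF True t(1) t'(1)]
      unfolding run_def by (intro exI[of _ "bcost b + t + t' + 1"] exI[of _ M'']) (auto simp: algebra_simps)
  next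
    case False
    then show ?thesis using cost[OF less.prems] exit[OF less.prems] exec.WhileFalse[OF False]
      unfolding run_def by (intro exI[of _ "bcost b + 1"] exI[of _ M]) auto
  qed
qed

fun writes :: "com \<Rightarrow> string set" where
  "writes Skip = {}"
| "writes (Store x _ _) = {x}"
| "writes (Seq c\<^sub>1 c\<^sub>2) = writes c\<^sub>1 \<union> writes c\<^sub>2"
| "writes (If _ c\<^sub>1 c\<^sub>2) = writes c\<^sub>1 \<union> writes c\<^sub>2"
| "writes (While _ c) = writes c"

lemma exec_writes: "exec c M t M' \<Longrightarrow> x \<notin> writes c \<Longrightarrow> M' x = M x"
  by (induction rule: exec.induct) auto

text \<open>A subprogram is verified once with its own budget \<open>C\<close>; the context keeps
  the other \<open>k - C\<close> credits and all segments that \<open>c\<close> does not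
  write.\<close>

lemma run_frame:
  assumes "run c M C Q" "C \<le> k"
    and "\<And>M' k'. Q M' k' \<Longrightarrow> (\<And>x. x \<notin> writes c \<Longrightarrow> M' x = M x) \<Longrightarrow> R M' (k - C + k')"
  shows "run c M k R"
proof -
  from assms(1) obtain t M' where t: "exec c M t M'" "t \<le> C" "Q M' (C - t)"
    unfolding run_def by auto
  have "R M' (k - C + (C - t))" using assms(3)[OF t(3)] exec_writes[OF t(1)] by blast
  then show ?thesis using t assms(2) unfolding run_def by (intro exI[of _ t] exI[of _ M']) auto
qed

lemma run_mono:
  assumes "run c M k Q" "\<And>M' k'. Q M' k' \<Longrightarrow> R M' k'"
  shows "run c M k R"
  using assms unfolding run_def by blast

abbreviation var :: "string \<Rightarrow> aexp" where "var x \<equiv> Cell x (Const 0)"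
abbreviation assign :: "string \<Rightarrow> aexp \<Rightarrow> com" (infix "::=" 61) where "x ::= e \<equiv> Store x (Const 0) e"
abbreviation seq :: "com \<Rightarrow> com \<Rightarrow> com" (infixr ";;" 60) where "c ;; d \<equiv> Seq c d"
abbreviation set_var :: "memory \<Rightarrow> string \<Rightarrow> int \<Rightarrow> memory" where
  "set_var M x v \<equiv> M(x := (M x)(0 := v))"

definition For :: "string \<Rightarrow> string \<Rightarrow> com \<Rightarrow> com" where
  "For x y c = x ::= Const 0 ;;
     While (Less (var x) (var y)) (c ;; x ::= Add (var x) (Const 1))"

lemma writes_For [simp]: "writes (For x y c) = insert x (writes c)"
  by (auto simp: For_def)

text \<open>Besides \<open>C\<close>, an iteration pays 6 for the test and 6 for the increment; the
  9 pays for the initialisation (3) and the failing test (6). The invariant is demanded of the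
  memory with the counter already incremented, so that its preservation by the increment is no
  separate obligation.\<close>

lemma run_For:
  assumes x: "x \<notin> writes c" "y \<notin> writes c" "x \<noteq> y" and N: "M y 0 = int N"
    and k: "N * (C + 12) + 9 \<le> k"
    and init: "J 0 (set_var M x 0)"
    and body: "\<And>i M'. i < N \<Longrightarrow> M' x 0 = int i \<Longrightarrow> M' y 0 = int N \<Longrightarrow> J i M' \<Longrightarrow>
      (\<And>z. z \<notin> insert x (writes c) \<Longrightarrow> M' z = M z) \<Longrightarrow>
      run c M' C (\<lambda>M'' _. J (Suc i) (set_var M'' x (int (Suc i))))"
    and post: "\<And>M' k'. J N M' \<Longrightarrow> (\<And>z. z \<notin> insert x (writes c) \<Longrightarrow> M' z = M z) \<Longrightarrow>
      k - (N * (C + 12) + 9) \<le> k' \<Longrightarrow> R M' k'"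
  shows "run (For x y c) M k R"
proof -
  define I where "I M' k' \<longleftrightarrow> (\<exists>i\<le>N. M' x 0 = int i \<and> J i M' \<and>
    (\<forall>z. z \<notin> insert x (writes c) \<longrightarrow> M' z = M z) \<and>
    k - (N * (C + 12) + 9) + (N - i) * (C + 12) + 6 \<le> k')" for M' k'
  have "run (While (Less (var x) (var y)) (c ;; x ::= Add (var x) (Const 1))) (set_var M x 0) (k - 3) R"
  proof (rule run_While[where I = I])
    show "I (set_var M x 0) (k - 3)"
      unfolding I_def using init k by (intro exI[of _ 0]) auto
  next
    fix M' k' assume "I M' k'"
    then show "bcost (Less (var x) (var y)) + 1 \<le> k'" unfolding I_def by auto
  next
    fix M' k' assume I: "I M' k'" and b: "bval (Less (var x) (var y)) M'"
    from I obtain i where i: "i \<le> N" "M' x 0 = int i" "J i M'"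
      "\<And>z. z \<notin> insert x (writes c) \<Longrightarrow> M' z = M z"
      "k - (N * (C + 12) + 9) + (N - i) * (C + 12) + 6 \<le> k'" unfolding I_def by blast
    have y: "M' y 0 = int N" using i(4)[of y] x N by auto
    have "i < N" using b i(2) y by simp
    then have split: "(N - i) * (C + 12) = (N - Suc i) * (C + 12) + (C + 12)"
      by (metis Suc_diff_Suc add.commute mult_Suc)
    show "run (c ;; x ::= Add (var x) (Const 1)) M' (k' - (bcost (Less (var x) (var y)) + 1)) I"
      unfolding run_Seq
    proof (rule run_frame[OF body[OF \<open>i < N\<close> i(2) y i(3,4)]])
      show "C \<le> k' - (bcost (Less (var x) (var y)) + 1)" using i(5) split by simp
    next
      fix M'' k'' assume J: "J (Suc i) (set_var M'' x (int (Suc i)))"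
        and fr: "\<And>z. z \<notin> writes c \<Longrightarrow> M'' z = M' z"
      have "M'' x 0 = int i" using fr x i(2) by metis
      moreover have "M'' z = M z" if "z \<notin> insert x (writes c)" for z
        using fr[of z] i(4)[of z] that by auto
      ultimately have "I (set_var M'' x (int (Suc i))) kk"
        if "k - (N * (C + 12) + 9) + (N - Suc i) * (C + 12) + 6 \<le> kk" for kk
        unfolding I_def using J \<open>i < N\<close> that by (intro exI[of _ "Suc i"]) auto
      then show "run (x ::= Add (var x) (Const 1)) M''
          (k' - (bcost (Less (var x) (var y)) + 1) - C + k'') I"
        using i(5) split \<open>M'' x 0 = int i\<close> by (simp add: add.commute)
    qed auto
  next
    fix M' k' assume I: "I M' k'" and b: "\<not> bval (Less (var x) (var y)) M'"
    from I obtain i where i: "i \<le> N" "M' x 0 = int i" "J i M'"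
      "\<And>z. z \<notin> insert x (writes c) \<Longrightarrow> M' z = M z"
      "k - (N * (C + 12) + 9) + (N - i) * (C + 12) + 6 \<le> k'" unfolding I_def by blast
    have y: "M' y 0 = int N" using i(4)[of y] x N by auto
    have "i = N" using b i(1,2) y by simp
    then show "R M' (k' - (bcost (Less (var x) (var y)) + 1))"
      using post[of M'] i by simp
  qed
  then show ?thesis using k unfolding For_def by simp
qed

section \<open>Enumerating sums in increasing order\<close>

primrec sums_of :: "(nat \<Rightarrow> int) \<Rightarrow> nat \<Rightarrow> nat \<Rightarrow> int set" where
  "sums_of b q 0 = {0}"
| "sums_of b q (Suc k) = (\<lambda>(x, j). x + b j) ` (sums_of b q k \<times> {..<q})"

lemma finite_sums_of [simp]: "finite (sums_of b q k)"
  by (induction k) auto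

lemma sums_of_SucI: "x \<in> sums_of b q k \<Longrightarrow> j < q \<Longrightarrow> x + b j \<in> sums_of b q (Suc k)"
  by force

lemma sums_of_SucE:
  assumes "y \<in> sums_of b q (Suc k)"
  obtains x j where "y = x + b j" "x \<in> sums_of b q k" "j < q"
  using assms by auto

declare sums_of.simps(2) [simp del]

text \<open>A zero summand can be added at will, so sums of exactly \<open>k'\<close> summands also
  cover those of fewer.\<close>

lemma sums_of_pad:
  assumes "j < q" "b j = 0" "k \<le> k'" shows "sums_of b q k \<subseteq> sums_of b q k'"
  using assms(3)
proof (induction k' rule: dec_induct)
  case (step k')
  then show ?case using sums_of_SucI[OF _ assms(1), of _ b k'] assms(2) by fastforce
qed simp

lemma sums_of_nonneg: "(\<And>j. j < q \<Longrightarrow> 0 \<le> b j) \<Longrightarrow> x \<in> sums_of b q k \<Longrightarrow> 0 \<le> x"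
  by (induction k arbitrary: x) (auto elim!: sums_of_SucE)

text \<open>All sums have the same number of summands, so shifting the summands shifts every sum by
  the same amount. This reduces the enumeration to nonnegative summands without changing the order
  of the sums.\<close>

lemma sums_of_shift: "x \<in> sums_of (\<lambda>j. a j - c) q k \<longleftrightarrow> x + int k * c \<in> sums_of a q k"
proof (induction k arbitrary: x)
  case (Suc k)
  show ?case
  proof
    assume "x \<in> sums_of (\<lambda>j. a j - c) q (Suc k)"
    then obtain y j where "x = y + (a j - c)" "y \<in> sums_of (\<lambda>j. a j - c) q k" "j < q"
      by (rule sums_of_SucE)
    then show "x + int (Suc k) * c \<in> sums_of a q (Suc k)"
      using Suc.IH[of y] sums_of_SucI[of "y + int k * c" a q k j]
      by (simp add: algebra_simps) (metis add.commute add.left_commute)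
  next
    assume "x + int (Suc k) * c \<in> sums_of a q (Suc k)"
    then obtain y j where "x + int (Suc k) * c = y + a j" "y \<in> sums_of a q k" "j < q"
      by (rule sums_of_SucE)
    then have "x = (y - int k * c) + (a j - c)" "y - int k * c \<in> sums_of (\<lambda>j. a j - c) q k"
      using Suc.IH[of "y - int k * c"] by (auto simp: algebra_simps)
    then show "x \<in> sums_of (\<lambda>j. a j - c) q (Suc k)"
      using sums_of_SucI[OF _ \<open>j < q\<close>] by metis
  qed
qed simp

definition enumerates :: "(nat \<Rightarrow> int) \<Rightarrow> nat \<Rightarrow> int set \<Rightarrow> bool" where
  "enumerates f k S \<longleftrightarrow> strict_mono_on {..<k} f \<and> f ` {..<k} = S"

lemma enumerates_snoc:
  assumes "enumerates f k S" "\<And>y. y \<in> S \<Longrightarrow> y < x" "\<And>i. i < k \<Longrightarrow> f' i = f i" "f' k = x"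
  shows "enumerates f' (Suc k) (insert x S)"
proof -
  have "strict_mono_on {..<Suc k} f'"
  proof (rule strict_mono_onI)
    fix r s assume "r \<in> {..<Suc k}" "s \<in> {..<Suc k}" "r < s"
    then show "f' r < f' s"
      using assms strict_mono_onD[of "{..<k}" f r s] unfolding enumerates_def
      by (cases "s = k") auto
  qed
  moreover have "f' ` {..<Suc k} = insert x S"
    using assms unfolding enumerates_def by (auto simp: lessThan_Suc)
  ultimately show ?thesis unfolding enumerates_def by blast
qed

lemma enumerates_less: "enumerates f k S \<Longrightarrow> i < i' \<Longrightarrow> i' < k \<Longrightarrow> f i < f i'"
  using strict_mono_onD[of "{..<k}" f i i'] unfolding enumerates_def by auto

lemma enumerates_card: "enumerates f k S \<Longrightarrow> card S = k"
  unfolding enumerates_def by (metis card_image card_lessThan strict_mono_on_imp_inj_on)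

section \<open>Order and summand counts of the shifted sums\<close>

locale sum_generation =
  fixes wt :: "nat \<Rightarrow> int" and mn lo :: int and q K :: nat
  assumes mn_le: "\<And>j. j < q \<Longrightarrow> mn \<le> - wt j" and mn_attained: "\<exists>j<q. mn = - wt j"
begin

abbreviation b :: "nat \<Rightarrow> int" where "b j \<equiv> - wt j - mn"

definition T :: "int set" where "T = sums_of b q K"

text \<open>A sum may arise with different numbers of summands. The least one decides whether it can
  be extended within the limit \<open>K\<close>, so it suffices to keep each sum once, with this
  number.\<close>

definition cnt :: "int \<Rightarrow> nat" where "cnt x = (LEAST k. x \<in> sums_of b q k)"

lemma finite_T [simp]: "finite T" by (simp add: T_def)

lemma sums_subset_T: "k \<le> K \<Longrightarrow> sums_of b q k \<subseteq> T"
  using sums_of_pad[of _ q b k K] mn_attained unfolding T_def by auto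

lemma T_nonneg: "x \<in> T \<Longrightarrow> 0 \<le> x"
  using sums_of_nonneg[of q b] mn_le unfolding T_def by force

lemma cnt_le: "x \<in> sums_of b q k \<Longrightarrow> cnt x \<le> k"
  unfolding cnt_def by (rule Least_le)

lemma cnt_T: assumes "x \<in> T" shows "cnt x \<le> K" "x \<in> sums_of b q (cnt x)"
  using assms cnt_le unfolding T_def cnt_def by (auto intro: LeastI)

lemma zero_T: "0 \<in> T" and cnt_0: "cnt 0 = 0"
  using sums_subset_T[of 0] cnt_le[of 0 0] by auto

lemma cand_sound:
  assumes "s \<in> T" "cnt s < K" "j < q"
  shows "s + b j \<in> T" "cnt (s + b j) \<le> cnt s + 1"
proof -
  have "s + b j \<in> sums_of b q (Suc (cnt s))"
    using sums_of_SucI[OF cnt_T(2)[OF assms(1)] assms(3)] .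
  then show "s + b j \<in> T" "cnt (s + b j) \<le> cnt s + 1"
    using sums_subset_T[of "Suc (cnt s)"] cnt_le[of "s + b j" "Suc (cnt s)"] assms(2) by force+
qed

text \<open>
  A minimal representation of the next sum \<open>t\<close> has a last summand \<open>b j\<close>; the rest \<open>t - b j\<close> is
  smaller than \<open>t\<close> because a zero summand could be dropped.
\<close>

lemma next_decompose:
  assumes "t \<in> T" "0 < t"
  obtains s j where "j < q" "s \<in> T" "cnt s < K" "cnt s + 1 \<le> cnt t" "s < t" "t = s + b j"
proof -
  have "cnt t \<noteq> 0" using cnt_T(2)[OF assms(1)] assms(2) by (cases "cnt t") auto
  then obtain k where k: "cnt t = Suc k" by (cases "cnt t") auto
  with cnt_T(2)[OF assms(1)] obtain s j where s: "t = s + b j" "s \<in> sums_of b q k" "j < q"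
    by (metis sums_of_SucE)
  have "cnt s \<le> k" using cnt_le[OF s(2)] .
  have "k < K" using cnt_T(1)[OF assms(1)] k by simp
  then have "s \<in> T" using s(2) sums_subset_T[of k] by auto
  have "b j \<noteq> 0" using s k cnt_le[of t k] by auto
  then have "s < t" using mn_le[OF s(3)] s(1) by auto
  then show thesis using that[OF s(3) \<open>s \<in> T\<close>] \<open>cnt s \<le> k\<close> \<open>k < K\<close> k s(1) by auto
qed

text \<open>For every \<open>j\<close> the pointer selects the least candidate above
  \<open>x\<close>, because \<open>E\<close> is increasing. The next sum is
  \<open>t = s + b j\<close> with \<open>s \<le> x\<close>, so \<open>s\<close> is already in
  \<open>E\<close>, at the pointer or behind it. A strictly smaller candidate above \<open>x\<close>
  would contradict the choice of \<open>t\<close>, so \<open>s\<close> is at the pointer. The bounds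
  on the counts ensure that among the candidates equal to \<open>t\<close> the least count is
  \<open>cnt t\<close>.\<close>

lemma next_sum:
  assumes E: "enumerates E k {y \<in> T. y \<le> x \<and> cnt y < K}" and "0 \<le> x"
    and p: "\<forall>j<q. p j \<le> k \<and> (\<forall>i<k. i < p j \<longleftrightarrow> E i + b j \<le> x)"
  shows "\<And>j. j < q \<Longrightarrow> p j < k \<Longrightarrow> E (p j) + b j \<in> T \<and> x < E (p j) + b j \<and>
      cnt (E (p j) + b j) \<le> cnt (E (p j)) + 1"
    and "\<And>t. t \<in> T \<Longrightarrow> x < t \<Longrightarrow> (\<And>s. s \<in> T \<Longrightarrow> x < s \<Longrightarrow> t \<le> s) \<Longrightarrow>
      \<exists>j<q. p j < k \<and> E (p j) + b j = t \<and> cnt (E (p j)) + 1 \<le> cnt t"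
proof -
  have img: "E ` {..<k} = {y \<in> T. y \<le> x \<and> cnt y < K}"
    using E unfolding enumerates_def by auto
  have Ei: "E i \<in> T \<and> E i \<le> x \<and> cnt (E i) < K" if "i < k" for i
    using img that by (metis (mono_tags, lifting) imageI lessThan_iff mem_Collect_eq)
  show sound: "E (p j) + b j \<in> T \<and> x < E (p j) + b j \<and> cnt (E (p j) + b j) \<le> cnt (E (p j)) + 1"
    if "j < q" "p j < k" for j
    using Ei[OF that(2)] cand_sound[OF _ _ that(1), of "E (p j)"] spec[OF p, of j] that by auto
  show "\<exists>j<q. p j < k \<and> E (p j) + b j = t \<and> cnt (E (p j)) + 1 \<le> cnt t"
    if t: "t \<in> T" "x < t" "\<And>s. s \<in> T \<Longrightarrow> x < s \<Longrightarrow> t \<le> s" for t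
  proof -
    obtain s j where s: "j < q" "s \<in> T" "cnt s < K" "cnt s + 1 \<le> cnt t" "s < t" "t = s + b j"
      using next_decompose[OF t(1)] t(2) \<open>0 \<le> x\<close> by (metis order.strict_trans1)
    have "s \<le> x" using t(3)[OF s(2)] s(5) by force
    with s(2,3) have "s \<in> E ` {..<k}" unfolding img by simp
    then obtain i where i: "i < k" "E i = s" by auto
    have "p j \<le> i" using p i s(1,6) t(2) by force
    then have lt: "p j < k" using i(1) by simp
    have "E (p j) \<le> E i" using \<open>p j \<le> i\<close> i(1) enumerates_less[OF E, of "p j" i]
      by (cases "p j = i") auto
    moreover have "t \<le> E (p j) + b j" using t(3) sound[OF s(1) lt] by auto
    ultimately have "E (p j) = s" using i(2) s(6) by simp
    then show ?thesis using s lt by blast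
  qed
qed

end

section \<open>A program that enumerates the sums\<close>

abbreviation Or :: "bexp \<Rightarrow> bexp \<Rightarrow> bexp" where "Or a b \<equiv> Not (And (Not a) (Not b))"

text \<open>
  Segment \<open>val\<close> collects the sums, \<open>E\<close> those that have fewer than \<open>n - 1\<close> summands (without the
  offset \<open>lo\<close>) and \<open>g\<close> their least numbers of summands.  The pointer \<open>p j\<close> is the position of the
  first element of \<open>E\<close> that exceeds the current sum \<open>x\<close> when summand \<open>j\<close> is added.
\<close>

definition append_sum :: com where
  "append_sum =
     Store ''val'' (var ''L'') (Add (var ''x'') (var ''lo'')) ;;
     ''L'' ::= Add (var ''L'') (Const 1) ;;
     If (Less (Add (var ''gx'') (Const 1)) (var ''n''))
       (Store ''E'' (var ''k'') (var ''x'') ;;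
        Store ''g'' (var ''k'') (var ''gx'') ;;
        ''k'' ::= Add (var ''k'') (Const 1))
       Skip ;;
     ''go'' ::= Const 0"

definition advance :: com where
  "advance =
     ''b'' ::= Sub (Sub (Const 0) (Cell ''weight'' (var ''j''))) (var ''mn'') ;;
     If (And (Less (Cell ''p'' (var ''j'')) (var ''k''))
             (Not (Less (var ''x'') (Add (Cell ''E'' (Cell ''p'' (var ''j''))) (var ''b'')))))
       (Store ''p'' (var ''j'') (Add (Cell ''p'' (var ''j'')) (Const 1)))
       Skip"

text \<open>Several candidates may coincide, and then the smallest count is the right one.
  \<open>go\<close> tells whether \<open>y\<close> and \<open>gy\<close> hold a candidate yet; if it
  remains 0, the sums are exhausted.\<close>

definition compare :: com where
  "compare =
     If (Less (Cell ''p'' (var ''j'')) (var ''k''))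
       (''c'' ::= Add (Cell ''E'' (Cell ''p'' (var ''j''))) (var ''b'') ;;
        ''h'' ::= Add (Cell ''g'' (Cell ''p'' (var ''j''))) (Const 1) ;;
        If (Or (Less (var ''go'') (Const 1))
              (Or (Less (var ''c'') (var ''y''))
                (And (Not (Less (var ''y'') (var ''c''))) (Less (var ''h'') (var ''gy'')))))
          (''go'' ::= Const 1 ;; ''y'' ::= var ''c'' ;; ''gy'' ::= var ''h'')
          Skip)
       Skip"

definition scan_step :: com where "scan_step = advance ;; compare"

lemma writes_scan_step: "writes scan_step = {''b'', ''p'', ''c'', ''h'', ''go'', ''y'', ''gy''}"
  by (auto simp: scan_step_def advance_def compare_def)

definition generate :: com where
  "generate =
     ''x'' ::= Const 0 ;; ''gx'' ::= Const 0 ;; ''L'' ::= Const 0 ;; ''k'' ::= Const 0 ;;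
     ''go'' ::= Const 1 ;;
     While (Less (Const 0) (var ''go''))
       (append_sum ;; For ''j'' ''q'' scan_step ;; ''x'' ::= var ''y'' ;; ''gx'' ::= var ''gy'')"

context sum_generation
begin

definition ctx :: "memory \<Rightarrow> bool" where
  "ctx M \<longleftrightarrow> M ''n'' 0 = int (Suc K) \<and> M ''q'' 0 = int q \<and> M ''mn'' 0 = mn \<and> M ''lo'' 0 = lo \<and>
     M ''weight'' = wt"

text \<open>The pointers separate the candidates at \<open>< x\<close>. Appending \<open>x\<close>
  leaves this unchanged, and the scan moves it to \<open>\<le> x\<close>, which is the same as
  \<open><\<close> for the next sum.\<close>

definition before_append :: "int \<Rightarrow> memory \<Rightarrow> bool" where
  "before_append x M \<longleftrightarrow> ctx M \<and> x \<in> T \<and> M ''x'' 0 = x \<and> M ''gx'' 0 = int (cnt x) \<and>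
    (\<exists>L k. M ''L'' 0 = int L \<and> M ''k'' 0 = int k \<and>
       enumerates (\<lambda>i. M ''val'' i - lo) L {y \<in> T. y < x} \<and>
       enumerates (M ''E'') k {y \<in> T. y < x \<and> cnt y < K} \<and>
       (\<forall>i<k. M ''g'' i = int (cnt (M ''E'' i))) \<and>
       (\<forall>j<q. 0 \<le> M ''p'' j \<and> M ''p'' j \<le> int k \<and>
          (\<forall>i<k. int i < M ''p'' j \<longleftrightarrow> M ''E'' i + b j < x)))"

definition after_append :: "int \<Rightarrow> memory \<Rightarrow> bool" where
  "after_append x M \<longleftrightarrow> ctx M \<and> x \<in> T \<and> M ''x'' 0 = x \<and> M ''go'' 0 = 0 \<and>
    (\<exists>L k. M ''L'' 0 = int L \<and> M ''k'' 0 = int k \<and>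
       enumerates (\<lambda>i. M ''val'' i - lo) L {y \<in> T. y \<le> x} \<and>
       enumerates (M ''E'') k {y \<in> T. y \<le> x \<and> cnt y < K} \<and>
       (\<forall>i<k. M ''g'' i = int (cnt (M ''E'' i))) \<and>
       (\<forall>j<q. 0 \<le> M ''p'' j \<and> M ''p'' j \<le> int k \<and>
          (\<forall>i<k. int i < M ''p'' j \<longleftrightarrow> M ''E'' i + b j < x)))"

lemma append_sum_correct:
  assumes "before_append x M"
  shows "run append_sum M 60 (\<lambda>M' _. after_append x M')"
proof -
  from assms obtain L k where *: "ctx M" "x \<in> T" "M ''x'' 0 = x" "M ''gx'' 0 = int (cnt x)"
    "M ''L'' 0 = int L" "M ''k'' 0 = int k"
    and V: "enumerates (\<lambda>i. M ''val'' i - lo) L {y \<in> T. y < x}"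
    and E: "enumerates (M ''E'') k {y \<in> T. y < x \<and> cnt y < K}"
    and g: "\<And>i. i < k \<Longrightarrow> M ''g'' i = int (cnt (M ''E'' i))"
    and p: "\<And>j. j < q \<Longrightarrow> 0 \<le> M ''p'' j \<and> M ''p'' j \<le> int k \<and>
          (\<forall>i<k. int i < M ''p'' j \<longleftrightarrow> M ''E'' i + b j < x)"
    unfolding before_append_def by blast
  note ctxD = *(1)[unfolded ctx_def]
  have V': "enumerates (\<lambda>i. ((M ''val'')(L := x + lo)) i - lo) (Suc L) {y \<in> T. y \<le> x}"
  proof -
    have "insert x {y \<in> T. y < x} = {y \<in> T. y \<le> x}" using \<open>x \<in> T\<close> by auto
    then show ?thesis using enumerates_snoc[OF V, of x] by auto
  qed
  show ?thesis
  proof (cases "cnt x < K")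
    case True
    have "insert x {y \<in> T. y < x \<and> cnt y < K} = {y \<in> T. y \<le> x \<and> cnt y < K}"
      using \<open>x \<in> T\<close> True by auto
    then have E': "enumerates ((M ''E'')(k := x)) (Suc k) {y \<in> T. y \<le> x \<and> cnt y < K}"
      using enumerates_snoc[OF E, of x] by auto
    \<comment> \<open>The new last element \<open>x\<close> is not skipped by any pointer, as
      \<open>b j\<close> is nonnegative.\<close>
    have p': "0 \<le> M ''p'' j \<and> M ''p'' j \<le> int (Suc k) \<and>
          (\<forall>i<Suc k. int i < M ''p'' j \<longleftrightarrow> ((M ''E'')(k := x)) i + b j < x)" if "j < q" for j
      using p[OF that] mn_le[OF that] by (auto simp: less_Suc_eq)
    show ?thesis
      using True V' E' g p'
      by (simp add: append_sum_def * ctxD, unfold after_append_def,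
          intro conjI exI[of _ "Suc L"] exI[of _ "Suc k"])
        (simp_all add: * ctx_def ctxD less_Suc_eq)
  next
    case False
    \<comment> \<open>A sum that needs all \<open>K\<close> summands is recorded in
      \<open>val\<close> but is never extended, so \<open>E\<close> remains as it is.\<close>
    have "{y \<in> T. y < x \<and> cnt y < K} = {y \<in> T. y \<le> x \<and> cnt y < K}"
      using \<open>x \<in> T\<close> False by (auto simp: order_le_less)
    with False V' E g p show ?thesis
      by (simp add: append_sum_def * ctxD, unfold after_append_def,
          intro conjI exI[of _ "Suc L"] exI[of _ k])
        (simp_all add: * ctx_def ctxD)
  qed
qed

definition least_candidate ::
  "(nat \<Rightarrow> int) \<Rightarrow> nat \<Rightarrow> (nat \<Rightarrow> nat) \<Rightarrow> nat set \<Rightarrow> int \<Rightarrow> int \<Rightarrow> bool" where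
  "least_candidate E k p J c h \<longleftrightarrow>
     (\<exists>j\<in>J. p j < k \<and> E (p j) + b j = c \<and> int (cnt (E (p j))) + 1 = h) \<and>
     (\<forall>j\<in>J. p j < k \<longrightarrow> c < E (p j) + b j \<or> c = E (p j) + b j \<and> h \<le> int (cnt (E (p j))) + 1)"

lemma least_candidate_Suc:
  assumes "p i < k"
  shows "\<forall>j<i. \<not> p j < k \<Longrightarrow> least_candidate E k p {..<Suc i} (E (p i) + b i) (int (cnt (E (p i))) + 1)"
    and "least_candidate E k p {..<i} c h \<Longrightarrow>
      E (p i) + b i < c \<or> E (p i) + b i = c \<and> int (cnt (E (p i))) + 1 \<le> h \<Longrightarrow>
      least_candidate E k p {..<Suc i} (E (p i) + b i) (int (cnt (E (p i))) + 1)"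
    and "least_candidate E k p {..<i} c h \<Longrightarrow>
      c < E (p i) + b i \<or> c = E (p i) + b i \<and> h \<le> int (cnt (E (p i))) + 1 \<Longrightarrow>
      least_candidate E k p {..<Suc i} c h"
  using assms unfolding least_candidate_def lessThan_Suc ball_simps bex_simps by fastforce+

lemma least_candidate_skip:
  "\<not> p i < k \<Longrightarrow> least_candidate E k p {..<i} c h \<Longrightarrow> least_candidate E k p {..<Suc i} c h"
  unfolding least_candidate_def lessThan_Suc by auto

definition after_scan :: "int \<Rightarrow> memory \<Rightarrow> bool" where
  "after_scan x M \<longleftrightarrow> ctx M \<and> x \<in> T \<and>
    (\<exists>L k p. M ''L'' 0 = int L \<and> M ''k'' 0 = int k \<and>
       enumerates (\<lambda>i. M ''val'' i - lo) L {y \<in> T. y \<le> x} \<and>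
       enumerates (M ''E'') k {y \<in> T. y \<le> x \<and> cnt y < K} \<and>
       (\<forall>i<k. M ''g'' i = int (cnt (M ''E'' i))) \<and>
       (\<forall>j<q. M ''p'' j = int (p j) \<and> p j \<le> k \<and> (\<forall>i<k. i < p j \<longleftrightarrow> M ''E'' i + b j \<le> x)) \<and>
       (M ''go'' 0 = 0 \<and> (\<forall>j<q. \<not> p j < k) \<or>
        M ''go'' 0 = 1 \<and> least_candidate (M ''E'') k p {..<q} (M ''y'' 0) (M ''gy'' 0)))"

lemma scan_correct:
  assumes "after_append x M" and k': "q * (150 + 12) + 9 \<le> k'"
    and post: "\<And>M' k''. after_scan x M' \<Longrightarrow> k' - (q * (150 + 12) + 9) \<le> k'' \<Longrightarrow> R M' k''"
  shows "run (For ''j'' ''q'' scan_step) M k' R"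
proof -
  from assms obtain L k where *: "ctx M" "x \<in> T" "M ''x'' 0 = x" "M ''go'' 0 = 0"
    "M ''L'' 0 = int L" "M ''k'' 0 = int k"
    and V: "enumerates (\<lambda>i. M ''val'' i - lo) L {y \<in> T. y \<le> x}"
    and E: "enumerates (M ''E'') k {y \<in> T. y \<le> x \<and> cnt y < K}"
    and g: "\<And>i. i < k \<Longrightarrow> M ''g'' i = int (cnt (M ''E'' i))"
    and p: "\<And>j. j < q \<Longrightarrow> 0 \<le> M ''p'' j \<and> M ''p'' j \<le> int k \<and>
          (\<forall>i<k. int i < M ''p'' j \<longleftrightarrow> M ''E'' i + b j < x)"
    unfolding after_append_def by blast
  note ctxD = *(1)[unfolded ctx_def]
  define p0 where "p0 j = nat (M ''p'' j)" for j
  \<comment> \<open>Elements with \<open>E i + b j < x\<close> have already been passed. As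
    \<open>E\<close> is strictly increasing, at most one further element yields exactly
    \<open>x\<close>, so a single increment per round suffices.\<close>
  define p1 where "p1 j = (if p0 j < k \<and> M ''E'' (p0 j) + b j \<le> x then p0 j + 1 else p0 j)" for j
  have p0: "M ''p'' j = int (p0 j)" "p0 j \<le> k" "\<And>i. i < k \<Longrightarrow> i < p0 j \<longleftrightarrow> M ''E'' i + b j < x"
    if "j < q" for j
    using p[OF that] unfolding p0_def by (auto simp: zless_nat_eq_int_zless)
  have p1: "p1 j \<le> k" "i < p1 j \<longleftrightarrow> M ''E'' i + b j \<le> x" if "j < q" "i < k" for i j
  proof -
    note mono = enumerates_less[OF E]
    show "p1 j \<le> k" using p0(2)[OF that(1)] by (auto simp: p1_def)
    show "i < p1 j \<longleftrightarrow> M ''E'' i + b j \<le> x"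
      using p0(3)[OF that(1) that(2)] p0(3)[OF that(1), of "p0 j"] mono[of i "p0 j"] mono[of "p0 j" i] that(2)
      unfolding p1_def by (cases i "p0 j" rule: linorder_cases) auto
  qed
  have p1_le: "p1 j \<le> k" if "j < q" for j
    using p0(2)[OF that] by (auto simp: p1_def)
  define J where "J i M' \<longleftrightarrow> (\<forall>j<q. M' ''p'' j = int (if j < i then p1 j else p0 j)) \<and>
    (M' ''go'' 0 = 0 \<and> (\<forall>j<i. \<not> p1 j < k) \<or>
     M' ''go'' 0 = 1 \<and> least_candidate (M ''E'') k p1 {..<i} (M' ''y'' 0) (M' ''gy'' 0))" for i M'
  show ?thesis
  proof (rule run_For[where N = q and C = 150 and J = J, OF _ _ _ _ k'])
    show "J 0 (set_var M ''j'' 0)" unfolding J_def using p0 * by simp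
  next
    fix i M' assume i: "i < q" "M' ''j'' 0 = int i" "M' ''q'' 0 = int q" and J: "J i M'"
      and fr: "\<And>z. z \<notin> insert ''j'' (writes scan_step) \<Longrightarrow> M' z = M z"
    have fr': "M' ''weight'' = wt" "M' ''mn'' 0 = mn" "M' ''k'' 0 = int k" "M' ''x'' 0 = x"
      "M' ''E'' = M ''E''" "M' ''g'' = M ''g''"
      using fr * ctxD by (simp_all add: writes_scan_step)
    have pi: "M' ''p'' i = int (p0 i)" using J i(1) unfolding J_def by simp
    have ps: "((M' ''p'')(i := int (p1 i))) j = int (if j < Suc i then p1 j else p0 j)" if "j < q" for j
      using J that unfolding J_def by (auto simp: less_Suc_eq)
    have go: "M' ''go'' 0 = 0 \<and> (\<forall>j<i. \<not> p1 j < k) \<or>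
        M' ''go'' 0 = 1 \<and> least_candidate (M ''E'') k p1 {..<i} (M' ''y'' 0) (M' ''gy'' 0)"
      using J unfolding J_def by simp
    show "run scan_step M' 150 (\<lambda>M'' _. J (Suc i) (set_var M'' ''j'' (int (Suc i))))"
      unfolding scan_step_def run_Seq
    proof (rule run_frame[where C = 60])
      show "run advance M' 60 (\<lambda>N _. N ''b'' 0 = b i \<and> N ''p'' = (M' ''p'')(i := int (p1 i)))"
      proof (cases "p0 i < k \<and> M ''E'' (p0 i) + b i \<le> x")
        case True
        then have "int (p0 i) + 1 = int (p1 i)" by (simp add: p1_def)
        with True show ?thesis by (simp add: advance_def fr' pi i)
      next
        case False
        then have "p1 i = p0 i" by (auto simp: p1_def)
        moreover have "(M' ''p'')(i := int (p0 i)) = M' ''p''" using pi by auto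
        ultimately show ?thesis using False by (auto simp: advance_def fr' pi i)
      qed
    next
      fix N k\<^sub>N
      assume "N ''b'' 0 = b i \<and> N ''p'' = (M' ''p'')(i := int (p1 i))"
        and frN: "\<And>z. z \<notin> writes advance \<Longrightarrow> N z = M' z"
      then have N: "N ''b'' 0 = b i" "N ''p'' = (M' ''p'')(i := int (p1 i))" "N ''j'' 0 = int i"
        "N ''k'' 0 = int k" "N ''E'' = M ''E''" "N ''g'' = M ''g''"
        using fr' i(2) by (simp_all add: advance_def)
      have go: "N ''go'' 0 = 0 \<and> (\<forall>j<i. \<not> p1 j < k) \<or>
          N ''go'' 0 = 1 \<and> least_candidate (M ''E'') k p1 {..<i} (N ''y'' 0) (N ''gy'' 0)"
        using go frN by (simp add: advance_def)
      have JI: "J (Suc i) M''" if "M'' ''p'' = N ''p''"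
        "M'' ''go'' 0 = 0 \<and> (\<forall>j<Suc i. \<not> p1 j < k) \<or>
         M'' ''go'' 0 = 1 \<and> least_candidate (M ''E'') k p1 {..<Suc i} (M'' ''y'' 0) (M'' ''gy'' 0)" for M''
        using that ps N(2) unfolding J_def by auto
      have "run compare N 90 (\<lambda>M'' _. J (Suc i) (set_var M'' ''j'' (int (Suc i))))"
      proof (cases "p1 i < k")
        case False
        then have "J (Suc i) (set_var N ''j'' (int (Suc i)))"
          using go by (intro JI) (auto simp: less_Suc_eq least_candidate_skip)
        with False show ?thesis by (simp add: compare_def N)
      next
        case True
        define c h where "c = M ''E'' (p1 i) + b i" and "h = int (cnt (M ''E'' (p1 i))) + 1"
        have E_g: "M ''E'' (p1 i) + b i = c" "M ''g'' (p1 i) + 1 = h"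
          using g[OF True] by (simp_all add: c_def h_def)
        note lc = least_candidate_Suc[of p1 i k "M ''E''", OF True, folded c_def h_def]
        show ?thesis
        proof (cases "N ''go'' 0 < 1 \<or> c < N ''y'' 0 \<or> \<not> N ''y'' 0 < c \<and> h < N ''gy'' 0")
          case take: True
          have "least_candidate (M ''E'') k p1 {..<Suc i} c h"
            using take go lc(1) lc(2)[of "N ''y'' 0" "N ''gy'' 0"]
            by (cases c "N ''y'' 0" rule: linorder_cases) auto
          then have "J (Suc i) M''"
            if "M'' ''p'' = N ''p''" "M'' ''go'' 0 = 1" "M'' ''y'' 0 = c" "M'' ''gy'' 0 = h" for M''
            using that by (intro JI) auto
          with True take show ?thesis by (simp add: compare_def N E_g del: not_less) force
        next
          case keep: False
          then have "N ''go'' 0 = 1 \<and> least_candidate (M ''E'') k p1 {..<Suc i} (N ''y'' 0) (N ''gy'' 0)"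
            using go lc(3)[of "N ''y'' 0" "N ''gy'' 0"]
            by (cases c "N ''y'' 0" rule: linorder_cases) auto
          then have "J (Suc i) M''"
            if "M'' ''p'' = N ''p''" "M'' ''go'' 0 = N ''go'' 0" "M'' ''y'' 0 = N ''y'' 0"
              "M'' ''gy'' 0 = N ''gy'' 0" for M''
            using that by (intro JI) auto
          with True keep show ?thesis by (auto simp: compare_def N E_g)
        qed
      qed
      then show "run compare N (150 - 60 + k\<^sub>N) (\<lambda>M'' _. J (Suc i) (set_var M'' ''j'' (int (Suc i))))"
        by (rule run_frame) auto
    qed simp
  next
    fix M' k'' assume J: "J q M'" and fr: "\<And>z. z \<notin> insert ''j'' (writes scan_step) \<Longrightarrow> M' z = M z"
      and k'': "k' - (q * (150 + 12) + 9) \<le> k''"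
    have fr': "M' ''k'' 0 = int k" "M' ''L'' 0 = int L" "M' ''val'' = M ''val''"
      "M' ''E'' = M ''E''" "M' ''g'' = M ''g''"
      using fr * ctxD by (simp_all add: writes_scan_step)
    have "ctx M'" unfolding ctx_def using fr ctxD by (simp add: writes_scan_step)
    have "after_scan x M'"
      unfolding after_scan_def
      by (intro conjI exI[of _ L] exI[of _ k] exI[of _ p1])
        (use J \<open>ctx M'\<close> * V E g p1 p1_le in \<open>simp_all add: J_def fr'\<close>)
    then show "R M' k''" using post k'' by blast
  qed (use ctxD in \<open>simp_all add: writes_scan_step\<close>)
qed

text \<open>The candidate found is a sum above \<open>x\<close>, hence at least the next sum, which
  is itself among the candidates. Ties are resolved in favour of the least count, so
  \<open>gy\<close> is exact.\<close>

lemma after_scan_next: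
  assumes "after_scan x M" "M ''go'' 0 = 1"
  shows "before_append (M ''y'' 0) (set_var (set_var M ''x'' (M ''y'' 0)) ''gx'' (M ''gy'' 0))"
    and "{t \<in> T. x < t} = {t \<in> T. M ''y'' 0 \<le> t}" "M ''y'' 0 \<in> T"
proof -
  define y where "y = M ''y'' 0"
  from assms obtain L k p where *: "ctx M" "x \<in> T" "M ''L'' 0 = int L" "M ''k'' 0 = int k"
    and V: "enumerates (\<lambda>i. M ''val'' i - lo) L {y \<in> T. y \<le> x}"
    and E: "enumerates (M ''E'') k {y \<in> T. y \<le> x \<and> cnt y < K}"
    and g: "\<And>i. i < k \<Longrightarrow> M ''g'' i = int (cnt (M ''E'' i))"
    and p: "\<And>j. j < q \<Longrightarrow> M ''p'' j = int (p j) \<and> p j \<le> k \<and> (\<forall>i<k. i < p j \<longleftrightarrow> M ''E'' i + b j \<le> x)"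
    and lc: "least_candidate (M ''E'') k p {..<q} y (M ''gy'' 0)"
    unfolding after_scan_def y_def by auto
  have p': "\<forall>j<q. p j \<le> k \<and> (\<forall>i<k. i < p j \<longleftrightarrow> M ''E'' i + b j \<le> x)" using p by auto
  note next_sum = next_sum[OF E T_nonneg[OF *(2)] p']
  from lc obtain j where j: "j < q" "p j < k" "M ''E'' (p j) + b j = y"
    "int (cnt (M ''E'' (p j))) + 1 = M ''gy'' 0" unfolding least_candidate_def by auto
  have y: "y \<in> T" "x < y" "int (cnt y) \<le> M ''gy'' 0"
    using next_sum(1)[OF j(1,2)] j(3,4) by auto
  define t where "t = Min {t \<in> T. x < t}"
  have "t \<in> {t \<in> T. x < t}" unfolding t_def using y by (intro Min_in) auto
  then have t: "t \<in> T" "x < t" "\<And>s. s \<in> T \<Longrightarrow> x < s \<Longrightarrow> t \<le> s"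
    unfolding t_def by auto
  from next_sum(2)[OF t] obtain i where i: "i < q" "p i < k" "M ''E'' (p i) + b i = t"
    "cnt (M ''E'' (p i)) + 1 \<le> cnt t" by auto
  with lc have "y < t \<or> y = t \<and> M ''gy'' 0 \<le> int (cnt (M ''E'' (p i))) + 1"
    unfolding least_candidate_def by auto
  with t(3)[OF y(1,2)] have yt: "y = t" and "M ''gy'' 0 \<le> int (cnt t)" using i(4) by auto
  with y(3) have gy: "M ''gy'' 0 = int (cnt y)" by simp
  have eq: "s \<le> x \<longleftrightarrow> s < y" if "s \<in> T" for s
    using t(2) t(3)[of s] that unfolding yt by force
  show "{t \<in> T. x < t} = {t \<in> T. M ''y'' 0 \<le> t}" "M ''y'' 0 \<in> T"
    using eq y(1) unfolding y_def[symmetric] by force+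
  have sets: "{s \<in> T. s \<le> x} = {s \<in> T. s < y}"
    "{s \<in> T. s \<le> x \<and> cnt s < K} = {s \<in> T. s < y \<and> cnt s < K}" using eq by auto
  \<comment> \<open>\<open>E i\<close> can still be extended, so \<open>E i + b j\<close> lies in
    \<open>T\<close>, and no element of \<open>T\<close> is strictly between \<open>x\<close> and
    \<open>y\<close>.\<close>
  have le_iff: "M ''E'' i + b j \<le> x \<longleftrightarrow> M ''E'' i + b j < y" if "i < k" "j < q" for i j
  proof -
    have "M ''E'' i \<in> {y \<in> T. y \<le> x \<and> cnt y < K}"
      using E that(1) unfolding enumerates_def by auto
    then show ?thesis using cand_sound(1)[OF _ _ that(2)] eq by simp
  qed
  show "before_append (M ''y'' 0) (set_var (set_var M ''x'' (M ''y'' 0)) ''gx'' (M ''gy'' 0))"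
    unfolding before_append_def y_def[symmetric]
    by (intro conjI exI[of _ L] exI[of _ k])
      (use * V E g p le_iff y(1) gy in \<open>simp_all add: ctx_def sets\<close>)
qed

lemma after_scan_exit:
  assumes "after_scan x M" "M ''go'' 0 = 0"
  shows "\<exists>L. M ''L'' 0 = int L \<and> enumerates (\<lambda>i. M ''val'' i - lo) L T"
proof -
  from assms obtain L k p where *: "ctx M" "x \<in> T" "M ''L'' 0 = int L" "M ''k'' 0 = int k"
    and V: "enumerates (\<lambda>i. M ''val'' i - lo) L {y \<in> T. y \<le> x}"
    and E: "enumerates (M ''E'') k {y \<in> T. y \<le> x \<and> cnt y < K}"
    and p: "\<And>j. j < q \<Longrightarrow> M ''p'' j = int (p j) \<and> p j \<le> k \<and> (\<forall>i<k. i < p j \<longleftrightarrow> M ''E'' i + b j \<le> x)"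
    and stuck: "\<forall>j<q. \<not> p j < k"
    unfolding after_scan_def by auto
  have p': "\<forall>j<q. p j \<le> k \<and> (\<forall>i<k. i < p j \<longleftrightarrow> M ''E'' i + b j \<le> x)" using p by auto
  have "{t \<in> T. x < t} = {}"
  proof (rule ccontr)
    assume ne: "{t \<in> T. x < t} \<noteq> {}"
    define t where "t = Min {t \<in> T. x < t}"
    have "t \<in> {t \<in> T. x < t}" unfolding t_def using ne by (intro Min_in) auto
    then have t: "t \<in> T" "x < t" "\<And>s. s \<in> T \<Longrightarrow> x < s \<Longrightarrow> t \<le> s"
      unfolding t_def by auto
    from next_sum(2)[OF E T_nonneg[OF *(2)], OF p' t] stuck show False by auto
  qed
  then have "{y \<in> T. y \<le> x} = T" by force
  with V *(3) show ?thesis by auto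
qed

lemma generate_correct:
  assumes M: "ctx M" "\<And>j. M ''p'' j = 0"
    and k: "card T * (q * 162 + 100) + 30 \<le> k"
    and post: "\<And>M' k' L. M' ''L'' 0 = int L \<Longrightarrow> enumerates (\<lambda>i. M' ''val'' i - lo) L T \<Longrightarrow>
      (\<And>z. z \<notin> writes generate \<Longrightarrow> M' z = M z) \<Longrightarrow>
      k - (card T * (q * 162 + 100) + 30) \<le> k' \<Longrightarrow> R M' k'"
  shows "run generate M k R"
proof -
  let ?C = "q * 162 + 100" and ?k = "k - (card T * (q * 162 + 100) + 30)"
  \<comment> \<open>Each sum not yet appended holds the credit for its own round: 162 per summand
    for the scan and 100 for the rest.\<close>
  define I where "I M' k' \<longleftrightarrow> (\<forall>z. z \<notin> writes generate \<longrightarrow> M' z = M z) \<and>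
    (M' ''go'' 0 = 1 \<and> (\<exists>x\<in>T. before_append x M' \<and> ?k + card {t \<in> T. x \<le> t} * ?C + 10 \<le> k') \<or>
     M' ''go'' 0 = 0 \<and> (\<exists>L. M' ''L'' 0 = int L \<and> enumerates (\<lambda>i. M' ''val'' i - lo) L T) \<and>
       ?k + 10 \<le> k')" for M' k'
  let ?loop = "While (Less (Const 0) (var ''go''))
       (append_sum ;; For ''j'' ''q'' scan_step ;; ''x'' ::= var ''y'' ;; ''gx'' ::= var ''gy'')"
  let ?M = "set_var (set_var (set_var (set_var (set_var M ''x'' 0) ''gx'' 0) ''L'' 0) ''k'' 0) ''go'' 1"
  have "run ?loop ?M (k - 15) R"
  proof (rule run_While[where I = I])
    have "{t \<in> T. 0 \<le> t} = T" using T_nonneg by auto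
    have "enumerates f 0 {y \<in> T. y < 0}" "enumerates f 0 {y \<in> T. y < 0 \<and> cnt y < K}" for f
      using T_nonneg unfolding enumerates_def by force+
    then have "before_append 0 ?M"
      unfolding before_append_def
      by (intro conjI exI[of _ 0]) (use M zero_T cnt_0 in \<open>simp_all add: ctx_def\<close>)
    with \<open>{t \<in> T. 0 \<le> t} = T\<close> zero_T k show "I ?M (k - 15)"
      unfolding I_def by (auto simp: generate_def)
  next
    fix M' k' assume "I M' k'"
    then show "bcost (Less (Const 0) (var ''go'')) + 1 \<le> k'" unfolding I_def by auto
  next
    fix M' k' assume I: "I M' k'" and go: "bval (Less (Const 0) (var ''go'')) M'"
    then obtain x where x: "x \<in> T" "before_append x M'" "?k + card {t \<in> T. x \<le> t} * ?C + 10 \<le> k'"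
      and fr: "\<And>z. z \<notin> writes generate \<Longrightarrow> M' z = M z"
      unfolding I_def by auto
    have split: "{t \<in> T. x \<le> t} = insert x {t \<in> T. x < t}" using x(1) by auto
    have "card {t \<in> T. x \<le> t} = Suc (card {t \<in> T. x < t})" unfolding split by simp
    then have k': "?k + card {t \<in> T. x < t} * ?C + ?C + 10 \<le> k'" using x(3) by simp
    show "run (append_sum ;; For ''j'' ''q'' scan_step ;; ''x'' ::= var ''y'' ;; ''gx'' ::= var ''gy'')
        M' (k' - (bcost (Less (Const 0) (var ''go'')) + 1)) I"
      unfolding run_Seq
    proof (rule run_frame[OF append_sum_correct[OF x(2)]])
      fix M\<^sub>1 k\<^sub>1 assume M1: "after_append x M\<^sub>1" and fr1: "\<And>z. z \<notin> writes append_sum \<Longrightarrow> M\<^sub>1 z = M' z"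
      let ?k1 = "k' - (bcost (Less (Const 0) (var ''go'')) + 1) - 60 + k\<^sub>1"
      have k1: "?k + card {t \<in> T. x < t} * ?C + q * 162 + 40 \<le> ?k1" using k' by simp
      show "run (For ''j'' ''q'' scan_step) M\<^sub>1 ?k1
          (\<lambda>M k. run (''x'' ::= var ''y'') M k (\<lambda>M k. run (''gx'' ::= var ''gy'') M k I))"
      proof (rule run_frame[where C = ?k1])
        show "run (For ''j'' ''q'' scan_step) M\<^sub>1 ?k1 (\<lambda>M\<^sub>2 k\<^sub>2. after_scan x M\<^sub>2 \<and> ?k1 - (q * (150 + 12) + 9) \<le> k\<^sub>2)"
          using k1 by (intro scan_correct[OF M1]) auto
      next
        fix M\<^sub>2 k\<^sub>2 assume "after_scan x M\<^sub>2 \<and> ?k1 - (q * (150 + 12) + 9) \<le> k\<^sub>2"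
          and fr2: "\<And>z. z \<notin> writes (For ''j'' ''q'' scan_step) \<Longrightarrow> M\<^sub>2 z = M\<^sub>1 z"
        then have M2: "after_scan x M\<^sub>2" and k2: "?k + card {t \<in> T. x < t} * ?C + 31 \<le> k\<^sub>2"
          using k1 by auto
        let ?M3 = "set_var (set_var M\<^sub>2 ''x'' (M\<^sub>2 ''y'' 0)) ''gx'' (M\<^sub>2 ''gy'' 0)"
        have fr3: "?M3 z = M z" if "z \<notin> writes generate" for z
          using fr[OF that] fr1[of z] fr2[of z] that by (simp add: generate_def)
        have "I ?M3 (k\<^sub>2 - 8)"
        proof (cases "M\<^sub>2 ''go'' 0 = 1")
          case True
          then show ?thesis unfolding I_def
            using after_scan_next[OF M2 True] fr3 k2 by auto
        next
          case False
          then have "M\<^sub>2 ''go'' 0 = 0" using M2 unfolding after_scan_def by auto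
          then show ?thesis unfolding I_def
            using after_scan_exit[OF M2] fr3 k2 by auto
        qed
        then show "run (''x'' ::= var ''y'') M\<^sub>2 (?k1 - ?k1 + k\<^sub>2) (\<lambda>M k. run (''gx'' ::= var ''gy'') M k I)"
          using k2 by simp
      qed simp
    qed (use k' in simp)
  next
    fix M' k' assume I: "I M' k'" and "\<not> bval (Less (Const 0) (var ''go'')) M'"
    then show "R M' (k' - (bcost (Less (Const 0) (var ''go'')) + 1))"
      using post[of M'] unfolding I_def by auto
  qed
  moreover have "30 \<le> k" using k by simp
  ultimately show ?thesis unfolding generate_def by (simp; arith)
qed

end

section \<open>Value iteration on the machine\<close>

text \<open>
  The arcs with \<open>key j = v\<close> form a linked list in decreasing order.  Arc \<open>j\<close> is represented by
  \<open>j + 1\<close>, and 0 ends the list; \<open>prv key v k\<close> is the link to the first arc below \<open>k\<close>.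
\<close>

primrec prv :: "(nat \<Rightarrow> nat) \<Rightarrow> nat \<Rightarrow> nat \<Rightarrow> nat" where
  "prv key v 0 = 0"
| "prv key v (Suc k) = (if key k = v then Suc k else prv key v k)"

lemma prv_le: "prv key v k \<le> k"
  by (induction k) auto

lemma prv_Suc: "prv key v k = Suc j \<Longrightarrow> key j = v"
  by (induction k) (simp_all split: if_splits)

lemma prv_none: "prv key v k \<le> j \<Longrightarrow> j < k \<Longrightarrow> key j \<noteq> v"
proof (induction k)
  case (Suc k)
  then show ?case by (cases "j = k") (auto split: if_splits)
qed simp

definition traverse :: "string \<Rightarrow> string \<Rightarrow> com \<Rightarrow> com" where
  "traverse hs nx c =
     ''e'' ::= Cell hs (var ''v'') ;;
     While (Less (Const 0) (var ''e''))
       (''e'' ::= Sub (var ''e'') (Const 1) ;; c ;; ''e'' ::= Cell nx (var ''e''))"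

lemma writes_traverse [simp]: "writes (traverse hs nx c) = insert ''e'' (writes c)"
  by (auto simp: traverse_def)

text \<open>The list is decreasing, so the arcs visited before link \<open>e\<close> are exactly
  those with key \<open>v\<close> and index at least \<open>e\<close>. This lets \<open>J\<close>
  depend on the set of visited arcs instead of a list.\<close>

lemma run_traverse:
  assumes c: "''e'' \<notin> writes c" "nx \<notin> writes c" "nx \<noteq> ''e''"
    and v: "M ''v'' 0 = int v" "M hs v = int (prv key v m)"
    and nx: "\<And>j. j < m \<Longrightarrow> M nx j = int (prv key (key j) j)"
    and k: "card {j. j < m \<and> key j = v} * (C + 30) + 20 \<le> k"
    and init: "J {} M"
    and e: "\<And>P M x. J P M \<Longrightarrow> J P (set_var M ''e'' x)"
    and body: "\<And>P M' j. j < m \<Longrightarrow> key j = v \<Longrightarrow> finite P \<Longrightarrow> j \<notin> P \<Longrightarrow> M' ''e'' 0 = int j \<Longrightarrow> J P M' \<Longrightarrow>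
      (\<And>x. x \<notin> insert ''e'' (writes c) \<Longrightarrow> M' x = M x) \<Longrightarrow> run c M' C (\<lambda>M'' _. J (insert j P) M'')"
    and post: "\<And>M' k'. J {j. j < m \<and> key j = v} M' \<Longrightarrow> (\<And>x. x \<notin> insert ''e'' (writes c) \<Longrightarrow> M' x = M x) \<Longrightarrow>
      k - (card {j. j < m \<and> key j = v} * (C + 30) + 20) \<le> k' \<Longrightarrow> R M' k'"
  shows "run (traverse hs nx c) M k R"
proof -
  let ?k = "k - (card {j. j < m \<and> key j = v} * (C + 30) + 20)"
  \<comment> \<open>\<open>prv key v e = e\<close> holds exactly if \<open>e\<close> is 0 or the
    link to an arc with key \<open>v\<close>.\<close>
  define I where "I M' k' \<longleftrightarrow> (\<exists>e\<le>m. M' ''e'' 0 = int e \<and> prv key v e = e \<and>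
    J {j. j < m \<and> key j = v \<and> e \<le> j} M' \<and> (\<forall>x. x \<notin> insert ''e'' (writes c) \<longrightarrow> M' x = M x) \<and>
    ?k + card {j. j < e \<and> key j = v} * (C + 30) + 10 \<le> k')" for M' k'
  have prv_prv: "prv key v (prv key v k) = prv key v k" for k by (induction k) auto
  have none: "{j. j < k \<and> key j = v \<and> prv key v k \<le> j} = {}" for k using prv_none by auto
  have fewer: "{j. j < prv key v k \<and> key j = v} = {j. j < k \<and> key j = v}" for k
  proof (rule set_eqI)
    show "i \<in> {j. j < prv key v k \<and> key j = v} \<longleftrightarrow> i \<in> {j. j < k \<and> key j = v}" for i
      using prv_none[of key v k i] prv_le[of key v k] by (cases "prv key v k \<le> i") auto
  qed
  have "run (While (Less (Const 0) (var ''e''))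
       (''e'' ::= Sub (var ''e'') (Const 1) ;; c ;; ''e'' ::= Cell nx (var ''e'')))
      (set_var M ''e'' (int (prv key v m))) (k - 5) R"
  proof (rule run_While[where I = I])
    show "I (set_var M ''e'' (int (prv key v m))) (k - 5)"
      unfolding I_def using e[OF init] k
      by (intro exI[of _ "prv key v m"]) (auto simp: prv_le prv_prv none fewer)
  next
    fix M' k' assume "I M' k'"
    then show "bcost (Less (Const 0) (var ''e'')) + 1 \<le> k'" unfolding I_def by auto
  next
    fix M' k' assume I: "I M' k'" and go: "bval (Less (Const 0) (var ''e'')) M'"
    then obtain e where e': "e \<le> m" "M' ''e'' 0 = int e" "prv key v e = e"
      and J: "J {j. j < m \<and> key j = v \<and> e \<le> j} M'"
      and fr: "\<And>x. x \<notin> insert ''e'' (writes c) \<Longrightarrow> M' x = M x"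
      and k': "?k + card {j. j < e \<and> key j = v} * (C + 30) + 10 \<le> k'" and "0 < e"
      unfolding I_def by auto
    then obtain j where j: "e = Suc j" by (cases e) auto
    have key: "key j = v" by (rule prv_Suc[of key v e]) (metis e'(3) j)
    have "{j. j < e \<and> key j = v} = insert j {i. i < j \<and> key i = v}"
      unfolding j using key by (auto simp: less_Suc_eq)
    then have card: "card {j. j < e \<and> key j = v} = Suc (card {i. i < j \<and> key i = v})" by simp
    have kk: "?k + card {i. i < j \<and> key i = v} * (C + 30) + C + 40 \<le> k'"
      using k' unfolding card by simp
    let ?M = "set_var M' ''e'' (int j)"
    have P: "insert j {j. j < m \<and> key j = v \<and> e \<le> j} = {i. i < m \<and> key i = v \<and> prv key v j \<le> i}"
    proof (rule set_eqI)
      show "i \<in> insert j {j. j < m \<and> key j = v \<and> e \<le> j} \<longleftrightarrow>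
          i \<in> {i. i < m \<and> key i = v \<and> prv key v j \<le> i}" for i
        using e'(1) j key prv_none[of key v j i] prv_le[of key v j]
        by (cases i j rule: linorder_cases) auto
    qed
    \<comment> \<open>11 credits are spent so far: 5 for the test and 6 for decrementing
      \<open>e\<close>.\<close>
    have "run (c ;; ''e'' ::= Cell nx (var ''e'')) ?M (k' - 11) I"
      unfolding run_Seq
    proof (rule run_frame[OF body])
      show "j < m" "key j = v" "?M ''e'' 0 = int j" "finite {j. j < m \<and> key j = v \<and> e \<le> j}"
        "j \<notin> {j. j < m \<and> key j = v \<and> e \<le> j}" using e'(1) j key by auto
      show "J {j. j < m \<and> key j = v \<and> e \<le> j} ?M" using e[OF J] .
      show "?M x = M x" if "x \<notin> insert ''e'' (writes c)" for x using fr[OF that] that by auto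
      show "C \<le> k' - 11" using kk by simp
    next
      fix M'' k'' assume J': "J (insert j {j. j < m \<and> key j = v \<and> e \<le> j}) M''"
        and fr': "\<And>x. x \<notin> writes c \<Longrightarrow> M'' x = ?M x"
      have eq: "M'' ''e'' 0 = int j" "M'' nx j = int (prv key v j)"
        using fr'[OF c(1)] fr'[OF c(2)] fr[of nx] c nx[of j] e'(1) j key by auto
      have "I (set_var M'' ''e'' (int (prv key v j))) kk" if "?k + card {i. i < j \<and> key i = v} * (C + 30) + 10 \<le> kk" for kk
        unfolding I_def
      proof (intro exI[of _ "prv key v j"] conjI allI impI)
        show "prv key v j \<le> m" using prv_le[of key v j] e'(1) j by simp
        show "J {i. i < m \<and> key i = v \<and> prv key v j \<le> i} (set_var M'' ''e'' (int (prv key v j)))"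
          using e[OF J'] unfolding P .
        show "(set_var M'' ''e'' (int (prv key v j))) x = M x" if "x \<notin> insert ''e'' (writes c)" for x
          using fr'[of x] fr[OF that] that by auto
      qed (use that prv_prv fewer in auto)
      then show "run (''e'' ::= Cell nx (var ''e'')) M'' (k' - 11 - C + k'') I"
        using kk by (simp add: eq)
    qed
    then show "run (''e'' ::= Sub (var ''e'') (Const 1) ;; c ;; ''e'' ::= Cell nx (var ''e''))
        M' (k' - (bcost (Less (Const 0) (var ''e'')) + 1)) I"
      using e'(2) j kk by simp
  next
    fix M' k' assume I: "I M' k'" and "\<not> bval (Less (Const 0) (var ''e'')) M'"
    then have "J {j. j < m \<and> key j = v} M'" "\<And>x. x \<notin> insert ''e'' (writes c) \<Longrightarrow> M' x = M x"
      "?k + 10 \<le> k'" unfolding I_def by auto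
    then show "R M' (k' - (bcost (Less (Const 0) (var ''e'')) + 1))"
      using post[of M'] by simp
  qed
  moreover have "20 \<le> k" using k by simp
  ultimately show ?thesis unfolding traverse_def using v by simp
qed

text \<open>
  Segment \<open>f\<close> holds the position in \<open>val\<close> of the value of each node (\<open>L\<close> stands for \<open>\<infinity>\<close>), \<open>u\<close> flags
  the arcs whose inequality fails, \<open>sl\<close> is the number of further failing arcs that would force a
  node to be raised, and \<open>st\<close> is a stack that contains all nodes to be raised, possibly repeatedly
  and together with others.
\<close>

definition test_arc :: com where
  "test_arc =
     ''s'' ::= Cell ''source'' (var ''e'') ;;
     ''t'' ::= Cell ''target'' (var ''e'') ;;
     ''new'' ::= Const 0 ;;
     If (Less (Cell ''f'' (var ''s'')) (var ''L''))
       (If (Less (Cell ''f'' (var ''t'')) (var ''L''))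
          (If (Less (Add (Cell ''val'' (Cell ''f'' (var ''s''))) (Cell ''weight'' (var ''e'')))
                    (Cell ''val'' (Cell ''f'' (var ''t''))))
             (''new'' ::= Const 1) Skip)
          (''new'' ::= Const 1))
       Skip"

text \<open>The old flag is cancelled from the slack before the new one is subtracted, so an arc may
  be updated repeatedly. The source is pushed without a test; entries that need no raise are
  discarded when popped.\<close>

definition update :: com where
  "update =
     test_arc ;;
     Store ''sl'' (var ''s'')
       (Sub (Add (Cell ''sl'' (var ''s'')) (Cell ''u'' (var ''e''))) (var ''new'')) ;;
     Store ''u'' (var ''e'') (var ''new'') ;;
     Store ''st'' (var ''sp'') (var ''s'') ;;
     ''sp'' ::= Add (var ''sp'') (Const 1)"

lemma writes_update: "writes update = {''s'', ''t'', ''new'', ''sl'', ''u'', ''st'', ''sp''}"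
  by (auto simp: update_def test_arc_def)

definition iterate :: com where
  "iterate =
     While (Less (Const 0) (var ''sp''))
       (''sp'' ::= Sub (var ''sp'') (Const 1) ;;
        ''v'' ::= Cell ''st'' (var ''sp'') ;;
        If (And (Less (Cell ''f'' (var ''v'')) (var ''L'')) (Less (Cell ''sl'' (var ''v'')) (Const 1)))
          (Store ''f'' (var ''v'') (Add (Cell ''f'' (var ''v'')) (Const 1)) ;;
           traverse ''oh'' ''on'' update ;;
           traverse ''ih'' ''in'' update)
          Skip)"

section \<open>Failing arcs, slack and stack as invariants\<close>

locale arena =
  fixes N m :: nat and S D :: "nat \<Rightarrow> nat" and W :: "nat \<Rightarrow> int" and al :: "nat \<Rightarrow> bool"
    and val :: "nat \<Rightarrow> int" and L z :: nat
  assumes S: "\<And>j. j < m \<Longrightarrow> S j < N" and D: "\<And>j. j < m \<Longrightarrow> D j < N"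
    and out: "\<And>i. i < N \<Longrightarrow> \<exists>j<m. S j = i"
    and val: "\<And>i i'. i < i' \<Longrightarrow> i' < L \<Longrightarrow> val i < val i'"
    and z: "z \<le> L"
begin

definition unsat :: "(nat \<Rightarrow> nat) \<Rightarrow> nat \<Rightarrow> bool" where
  "unsat f j \<longleftrightarrow> f (S j) < L \<and> (f (D j) < L \<longrightarrow> val (f (S j)) + W j < val (f (D j)))"

definition viol :: "(nat \<Rightarrow> nat) \<Rightarrow> nat \<Rightarrow> bool" where
  "viol f i \<longleftrightarrow> f i < L \<and>
     (if al i then \<forall>j<m. S j = i \<longrightarrow> unsat f j else \<exists>j<m. S j = i \<and> unsat f j)"

lemma unsat_mono:
  assumes "unsat f j" "f (S j) = r (S j)" "f (D j) \<le> r (D j)"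
  shows "unsat r j"
proof -
  have "val (f (D j)) \<le> val (r (D j))" if "r (D j) < L"
    using val[of "f (D j)" "r (D j)"] that assms(3) by (cases "f (D j) = r (D j)") auto
  then show ?thesis using assms unfolding unsat_def by fastforce
qed

text \<open>If \<open>f i = r i\<close>, then passing from \<open>f\<close> to \<open>r\<close> only
  makes the targets of the arcs at \<open>i\<close> larger, so \<open>r\<close> would fail at
  \<open>i\<close> too. Raising a failing node by one position therefore never passes a stable
  \<open>r\<close> above \<open>f\<close>.\<close>

lemma viol_less:
  assumes "viol f i" "\<not> viol r i" "\<And>i. i < N \<Longrightarrow> f i \<le> r i" "i < N"
  shows "f i < r i"
proof (rule ccontr)
  assume "\<not> f i < r i"
  then have eq: "f i = r i" using assms(3)[OF assms(4)] by simp
  have "unsat r j" if "unsat f j" "j < m" "S j = i" for j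
    using unsat_mono[OF that(1)] eq that D assms(3) by auto
  then show False using assms(1,2) eq unfolding viol_def by auto metis
qed

text \<open>The number of failing arcs at which a node fails: all its arcs for Alice, one for Bob. A
  slack below 1 then means failure for both.\<close>

definition thr :: "nat \<Rightarrow> int" where
  "thr i = (if al i then (\<Sum>j<m. of_bool (S j = i)) else 1)"

definition static :: "memory \<Rightarrow> bool" where
  "static M \<longleftrightarrow> M ''L'' 0 = int L \<and> (\<forall>i<L. M ''val'' i = val i) \<and>
     (\<forall>j<m. M ''source'' j = int (S j) \<and> M ''target'' j = int (D j) \<and> M ''weight'' j = W j)"

text \<open>The stored flags \<open>F\<close> are kept apart from \<open>unsat f\<close>: after a
  raise they are outdated until the arcs are updated, whereas the slack agrees with the stored flags
  at all times.\<close>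

definition mem_ok :: "(nat \<Rightarrow> nat) \<Rightarrow> (nat \<Rightarrow> bool) \<Rightarrow> memory \<Rightarrow> bool" where
  "mem_ok f F M \<longleftrightarrow> static M \<and> (\<forall>i<N. M ''f'' i = int (f i)) \<and> (\<forall>j<m. M ''u'' j = of_bool (F j)) \<and>
     (\<forall>i<N. M ''sl'' i = thr i - (\<Sum>j<m. of_bool (S j = i \<and> F j)))"

lemma sum_upd:
  assumes "j < m"
  shows "(\<Sum>j'<m. of_bool (S j' = i \<and> (F(j := x)) j')) =
    (\<Sum>j'<m. of_bool (S j' = i \<and> F j')) + of_bool (S j = i) * (of_bool x - of_bool (F j) :: int)"
proof -
  have "(\<Sum>j'<m. of_bool (S j' = i \<and> (F(j := x)) j') :: int) =
      of_bool (S j = i \<and> x) + (\<Sum>j'\<in>{..<m} - {j}. of_bool (S j' = i \<and> F j'))"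
    using assms by (subst sum.remove[of _ j]) auto
  moreover have "(\<Sum>j'<m. of_bool (S j' = i \<and> F j') :: int) =
      of_bool (S j = i \<and> F j) + (\<Sum>j'\<in>{..<m} - {j}. of_bool (S j' = i \<and> F j'))"
    using assms by (subst sum.remove[of _ j]) auto
  ultimately show ?thesis by auto
qed

lemma update_correct:
  assumes M: "mem_ok f F M" and j: "j < m" "M ''e'' 0 = int j" and sp: "M ''sp'' 0 = int sp"
  shows "run update M 150 (\<lambda>M' _. mem_ok f (F(j := unsat f j)) M' \<and> M' ''sp'' 0 = int (Suc sp) \<and>
    M' ''st'' = (M ''st'')(sp := int (S j)))"
proof -
  have st: "static M" and f: "\<And>i. i < N \<Longrightarrow> M ''f'' i = int (f i)"
    and u: "\<And>j. j < m \<Longrightarrow> M ''u'' j = of_bool (F j)"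
    and sl: "\<And>i. i < N \<Longrightarrow> M ''sl'' i = thr i - (\<Sum>j<m. of_bool (S j = i \<and> F j))"
    using M unfolding mem_ok_def by auto
  have e: "M ''source'' j = int (S j)" "M ''target'' j = int (D j)" "M ''weight'' j = W j"
    "M ''f'' (S j) = int (f (S j))" "M ''f'' (D j) = int (f (D j))" "M ''L'' 0 = int L"
    "M ''u'' j = of_bool (F j)"
    using st f u j(1) S[OF j(1)] D[OF j(1)] unfolding static_def by auto
  have val: "M ''val'' i = val i" if "i < L" for i using st that unfolding static_def by auto
  have fin: "mem_ok f (F(j := unsat f j)) M'"
    if M': "M' ''L'' = M ''L''" "M' ''val'' = M ''val''" "M' ''source'' = M ''source''"
      "M' ''target'' = M ''target''" "M' ''weight'' = M ''weight''" "M' ''f'' = M ''f''"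
      "M' ''sl'' = (M ''sl'')(S j := M ''sl'' (S j) + of_bool (F j) - of_bool (unsat f j))"
      "M' ''u'' = (M ''u'')(j := of_bool (unsat f j))" for M'
  proof -
    have "static M'" using st unfolding static_def M' .
    then show ?thesis unfolding mem_ok_def M' using f u sl sum_upd[OF j(1)] by auto
  qed
  have test: "run test_arc M 70 (\<lambda>M' _. M' ''s'' 0 = int (S j) \<and> M' ''new'' 0 = of_bool (unsat f j))"
    by (cases "f (S j) < L"; cases "f (D j) < L"; simp add: test_arc_def unsat_def j e val)
  show ?thesis
    unfolding update_def run_Seq
  proof (rule run_frame[OF test])
    fix M\<^sub>1 k\<^sub>1
    assume "M\<^sub>1 ''s'' 0 = int (S j) \<and> M\<^sub>1 ''new'' 0 = of_bool (unsat f j)"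
      and fr: "\<And>x. x \<notin> writes test_arc \<Longrightarrow> M\<^sub>1 x = M x"
    then have M1: "M\<^sub>1 ''s'' 0 = int (S j)" "M\<^sub>1 ''new'' 0 = of_bool (unsat f j)" by auto
    have fr: "M\<^sub>1 x = M x" if "x \<notin> {''s'', ''t'', ''new''}" for x
      using fr[of x] that by (auto simp: test_arc_def)
    let ?M = "M\<^sub>1(''sl'' := (M ''sl'')(S j := M ''sl'' (S j) + of_bool (F j) - of_bool (unsat f j)),
      ''u'' := (M ''u'')(j := of_bool (unsat f j)), ''st'' := (M ''st'')(sp := int (S j)),
      ''sp'' := (M ''sp'')(0 := int sp + 1))"
    have "mem_ok f (F(j := unsat f j)) ?M" by (rule fin) (simp_all add: fr)
    then show "run (Store ''sl'' (var ''s'')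
       (Sub (Add (Cell ''sl'' (var ''s'')) (Cell ''u'' (var ''e''))) (var ''new''))) M\<^sub>1 (150 - 70 + k\<^sub>1)
     (\<lambda>N k. run (Store ''u'' (var ''e'') (var ''new'')) N k
     (\<lambda>N k. run (Store ''st'' (var ''sp'') (var ''s'')) N k
     (\<lambda>N k. run (''sp'' ::= Add (var ''sp'') (Const 1)) N k
     (\<lambda>M' _. mem_ok f (F(j := unsat f j)) M' \<and> M' ''sp'' 0 = int (Suc sp) \<and>
       M' ''st'' = (M ''st'')(sp := int (S j))))))"
      by (simp add: M1 fr e(7) j sp add.commute split del: split_of_bool)
  qed simp
qed

definition pending :: "memory \<Rightarrow> nat \<Rightarrow> bool" where
  "pending M i \<longleftrightarrow> (\<exists>a. int a < M ''sp'' 0 \<and> M ''st'' a = int i)"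

text \<open>
  While the arcs at a raised node \<open>v\<close> are being updated, only those in \<open>P\<close> have correct flags.
\<close>

definition partial :: "(nat \<Rightarrow> nat) \<Rightarrow> nat \<Rightarrow> nat set \<Rightarrow> nat \<Rightarrow> memory \<Rightarrow> bool" where
  "partial f v P sp M \<longleftrightarrow> M ''sp'' 0 = int sp \<and> (\<forall>a<sp. \<exists>i<N. M ''st'' a = int i) \<and>
     (\<exists>F. mem_ok f F M \<and> (\<forall>j<m. (S j = v \<or> D j = v \<longrightarrow> j \<in> P) \<longrightarrow> F j = unsat f j)) \<and>
     (\<forall>i<N. (i = v \<longrightarrow> (\<exists>j\<in>P. S j = v)) \<longrightarrow> f i < L \<longrightarrow> M ''sl'' i < 1 \<longrightarrow> pending M i)"

definition complete :: "(nat \<Rightarrow> nat) \<Rightarrow> nat \<Rightarrow> memory \<Rightarrow> bool" where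
  "complete f sp M \<longleftrightarrow> M ''sp'' 0 = int sp \<and> (\<forall>a<sp. \<exists>i<N. M ''st'' a = int i) \<and>
     mem_ok f (unsat f) M \<and> (\<forall>i<N. viol f i \<longrightarrow> pending M i)"

text \<open>The failing arcs of a node are a subset of its outgoing arcs, so for Alice comparing the
  two cardinalities decides whether all arcs fail.\<close>

lemma slack_viol:
  assumes "mem_ok f (unsat f) M" "i < N"
  shows "f i < L \<and> M ''sl'' i < 1 \<longleftrightarrow> viol f i"
proof -
  let ?u = "{j. j < m \<and> S j = i \<and> unsat f j}" and ?a = "{j. j < m \<and> S j = i}"
  have fin: "finite ?u" "finite ?a" by auto
  have "M ''sl'' i = thr i - int (card ?u)"
    using assms unfolding mem_ok_def by (simp add: sum_of_bool_eq Int_def conj_commute)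
  moreover have "thr i = (if al i then int (card ?a) else 1)"
    unfolding thr_def by (simp add: sum_of_bool_eq Int_def conj_commute)
  moreover have "card ?a \<le> card ?u \<longleftrightarrow> (\<forall>j<m. S j = i \<longrightarrow> unsat f j)"
  proof
    assume "card ?a \<le> card ?u"
    then have "?u = ?a" using fin by (intro card_seteq) auto
    then show "\<forall>j<m. S j = i \<longrightarrow> unsat f j" by auto
  next
    assume "\<forall>j<m. S j = i \<longrightarrow> unsat f j"
    then have "?u = ?a" by auto
    then show "card ?a \<le> card ?u" by simp
  qed
  moreover have "0 < card ?u \<longleftrightarrow> (\<exists>j<m. S j = i \<and> unsat f j)"
    using fin(1) by (auto simp: card_gt_0_iff)
  ultimately have "M ''sl'' i < 1 \<longleftrightarrow> (if al i then \<forall>j<m. S j = i \<longrightarrow> unsat f j else \<exists>j<m. S j = i \<and> unsat f j)"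
    by (smt (verit) of_nat_0_less_iff of_nat_le_iff)
  then show ?thesis unfolding viol_def by simp
qed

text \<open>Only the slack of the source of \<open>j\<close> changes, and this node is pushed; every
  other node keeps its slack and its stack entries.\<close>

lemma partial_update:
  assumes M: "partial f v P sp M" and j: "j < m" "M ''e'' 0 = int j"
  shows "run update M 150 (\<lambda>M' _. partial f v (insert j P) (Suc sp) M')"
proof -
  from M obtain F where sp: "M ''sp'' 0 = int sp" and st: "\<And>a. a < sp \<Longrightarrow> \<exists>i<N. M ''st'' a = int i"
    and F: "mem_ok f F M" "\<And>j. j < m \<Longrightarrow> (S j = v \<or> D j = v \<longrightarrow> j \<in> P) \<Longrightarrow> F j = unsat f j"
    and pend: "\<And>i. i < N \<Longrightarrow> (i = v \<longrightarrow> (\<exists>j\<in>P. S j = v)) \<Longrightarrow> f i < L \<Longrightarrow> M ''sl'' i < 1 \<Longrightarrow> pending M i"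
    unfolding partial_def by blast
  show ?thesis
  proof (rule run_frame[OF update_correct[OF F(1) j sp]])
    fix M' k'
    assume *: "mem_ok f (F(j := unsat f j)) M' \<and> M' ''sp'' 0 = int (Suc sp) \<and>
        M' ''st'' = (M ''st'')(sp := int (S j))"
    then have sp': "M' ''sp'' 0 = int (Suc sp)" "M' ''st'' = (M ''st'')(sp := int (S j))" by auto
    have keep: "pending M' i" if "pending M i" for i
      using that sp sp' unfolding pending_def by (metis add.commute fun_upd_apply less_irrefl of_nat_Suc zless_add1_eq)
    have new: "pending M' (S j)" unfolding pending_def using sp' by (intro exI[of _ sp]) auto
    have same: "M' ''sl'' i = M ''sl'' i" if "i < N" "i \<noteq> S j" for i
    proof -
      have "M' ''sl'' i = thr i - (\<Sum>j'<m. of_bool (S j' = i \<and> (F(j := unsat f j)) j'))"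
        using * that unfolding mem_ok_def by blast
      also have "\<dots> = thr i - (\<Sum>j'<m. of_bool (S j' = i \<and> F j'))"
        using that(2) by (intro arg_cong[where f = "\<lambda>x. thr i - x"] sum.cong) auto
      finally show ?thesis using F(1) that unfolding mem_ok_def by simp
    qed
    have "pending M' i" if "i < N" "i = v \<longrightarrow> (\<exists>j\<in>insert j P. S j = v)" "f i < L" "M' ''sl'' i < 1" for i
    proof (cases "i = S j")
      case False
      then show ?thesis using that same[OF that(1) False] by (intro keep pend) auto
    qed (use new in simp)
    moreover have "\<exists>i<N. M' ''st'' a = int i" if "a < Suc sp" for a
      using sp'(2) st[of a] S[OF j(1)] that by (cases "a = sp") auto
    ultimately show "partial f v (insert j P) (Suc sp) M'"
      unfolding partial_def using * F(2) by (intro conjI exI[of _ "F(j := unsat f j)"]) auto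
  qed simp
qed

end

section \<open>Amortised analysis of the raises\<close>

context arena begin

definition out_deg :: "nat \<Rightarrow> nat" where "out_deg i = card {j. j < m \<and> S j = i}"
definition in_deg :: "nat \<Rightarrow> nat" where "in_deg i = card {j. j < m \<and> D j = i}"

definition linked :: "memory \<Rightarrow> bool" where
  "linked M \<longleftrightarrow> (\<forall>i<N. M ''oh'' i = int (prv S i m) \<and> M ''ih'' i = int (prv D i m)) \<and>
     (\<forall>j<m. M ''on'' j = int (prv S (S j) j) \<and> M ''in'' j = int (prv D (D j) j))"

lemma partial_set_e: "partial f v P sp M \<Longrightarrow> partial f v P sp (set_var M ''e'' x)"
proof -
  assume "partial f v P sp M"
  moreover have "mem_ok f F (set_var M ''e'' x) = mem_ok f F M" for F
    by (simp add: mem_ok_def static_def)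
  moreover have "pending (set_var M ''e'' x) = pending M"
    by (simp add: fun_eq_iff pending_def)
  ultimately show ?thesis unfolding partial_def by simp
qed

text \<open>The popped node \<open>v\<close> is exempt from being pending until one of its outgoing
  arcs has been updated. By \<open>out\<close> there is such an arc, so the exemption has lapsed at
  the end.\<close>

lemma partial_complete:
  assumes "partial f v P sp M" "v < N" "\<And>j. j < m \<Longrightarrow> S j = v \<or> D j = v \<Longrightarrow> j \<in> P"
  shows "complete f sp M"
proof -
  from assms(1) obtain F where F: "mem_ok f F M" "\<And>j. j < m \<Longrightarrow> F j = unsat f j"
    using assms(3) unfolding partial_def by blast
  have "(\<Sum>j<m. of_bool (S j = i \<and> F j) :: int) = (\<Sum>j<m. of_bool (S j = i \<and> unsat f j))" for i
    using F(2) by (intro sum.cong) auto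
  then have ok: "mem_ok f (unsat f) M" using F unfolding mem_ok_def by auto
  obtain j where "j < m" "S j = v" using out[OF assms(2)] by blast
  then have "\<exists>j\<in>P. S j = v" using assms(3) by blast
  then have "pending M i" if "i < N" "viol f i" for i
    using assms(1) slack_viol[OF ok that(1)] that unfolding partial_def by blast
  then show ?thesis using assms(1) ok unfolding complete_def partial_def by blast
qed

lemma raise_correct:
  assumes M: "complete f (Suc sp) M" and v: "v < N" "M ''st'' sp = int v" "viol f v" and links: "linked M"
    and M1: "M\<^sub>1 = M(''sp'' := (M ''sp'')(0 := int sp), ''v'' := (M ''v'')(0 := int v),
      ''f'' := (M ''f'')(v := int (f v) + 1))"
    and k: "(out_deg v + in_deg v) * 180 + 40 \<le> k"
    and post: "\<And>M' k'. complete (f(v := Suc (f v))) (sp + out_deg v + in_deg v) M' \<Longrightarrow>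
       k - ((out_deg v + in_deg v) * 180 + 40) \<le> k' \<Longrightarrow> R M' k'"
  shows "run (traverse ''oh'' ''on'' update ;; traverse ''ih'' ''in'' update) M\<^sub>1 k R"
proof -
  let ?f = "f(v := Suc (f v))"
  let ?O = "{j. j < m \<and> S j = v}" and ?I = "{j. j < m \<and> D j = v}"
  have sp: "M ''sp'' 0 = int (Suc sp)" and st: "\<And>a. a < Suc sp \<Longrightarrow> \<exists>i<N. M ''st'' a = int i"
    and ok: "mem_ok f (unsat f) M" and pend: "\<And>i. i < N \<Longrightarrow> viol f i \<Longrightarrow> pending M i"
    using M unfolding complete_def by auto
  \<comment> \<open>The flags still belong to the old \<open>f\<close>; they can be wrong only for
    arcs that start or end in \<open>v\<close>.\<close>
  have "mem_ok ?f (unsat f) M\<^sub>1"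
    using ok unfolding mem_ok_def static_def M1 by auto
  moreover have "unsat f j = unsat ?f j" if "S j \<noteq> v" "D j \<noteq> v" for j
    using that unfolding unsat_def by simp
  moreover have "pending M\<^sub>1 i" if "i < N" "i \<noteq> v" "f i < L" "M ''sl'' i < 1" for i
  proof -
    have "pending M i" using slack_viol[OF ok that(1)] that pend by blast
    then obtain a where "int a < int (Suc sp)" "M ''st'' a = int i" unfolding pending_def sp by blast
    moreover from this have "a \<noteq> sp" using v(2) that(2) by auto
    ultimately show ?thesis unfolding pending_def M1 by (intro exI[of _ a]) auto
  qed
  ultimately have init: "partial ?f v {} sp M\<^sub>1"
    unfolding partial_def using st by (auto simp: M1 intro!: exI[of _ "unsat f"])
  note w = writes_update
  have k1: "out_deg v * (150 + 30) + 20 \<le> k" using k by simp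
  \<comment> \<open>A self-loop at \<open>v\<close> occurs in both lists and is pushed twice. The
    stack height therefore counts the lists separately, while the updated arcs form a union.\<close>
  have upd: "run update M' 150 (\<lambda>M'' _. partial ?f v (Q \<union> insert j P) (c + card (insert j P)) M'')"
    if "j < m" "finite P" "j \<notin> P" "M' ''e'' 0 = int j" "partial ?f v (Q \<union> P) (c + card P) M'" for P Q M' j c
    using partial_update[OF that(5,1,4)] that(2,3) by simp
  show ?thesis
    unfolding run_Seq
  proof (rule run_traverse[where C = 150 and key = S and v = v and m = m and
        J = "\<lambda>P M'. partial ?f v ({} \<union> P) (sp + card P) M'", folded out_deg_def])
    show "partial ?f v ({} \<union> {}) (sp + card {}) M\<^sub>1" using init by simp
    show "M\<^sub>1 ''v'' 0 = int v" "M\<^sub>1 ''oh'' v = int (prv S v m)"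
      "\<And>j. j < m \<Longrightarrow> M\<^sub>1 ''on'' j = int (prv S (S j) j)"
      using links v(1) unfolding linked_def M1 by auto
    fix M' k' assume J: "partial ?f v ({} \<union> ?O) (sp + out_deg v) M'"
      and fr: "\<And>x. x \<notin> insert ''e'' (writes update) \<Longrightarrow> M' x = M\<^sub>1 x"
      and k': "k - (out_deg v * (150 + 30) + 20) \<le> k'"
    show "run (traverse ''ih'' ''in'' update) M' k' R"
    proof (rule run_traverse[where C = 150 and key = D and v = v and m = m and
        J = "\<lambda>P M'. partial ?f v (?O \<union> P) (sp + out_deg v + card P) M'", folded in_deg_def])
      show "partial ?f v (?O \<union> {}) (sp + out_deg v + card {}) M'" using J by simp
      show "M' ''v'' 0 = int v" "M' ''ih'' v = int (prv D v m)"
        "\<And>j. j < m \<Longrightarrow> M' ''in'' j = int (prv D (D j) j)"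
        using links v(1) fr[of "''v''"] fr[of "''ih''"] fr[of "''in''"] unfolding linked_def w M1 by auto
      show "in_deg v * (150 + 30) + 20 \<le> k'" using k k' by simp
    next
      fix M'' k'' assume J: "partial ?f v (?O \<union> ?I) (sp + out_deg v + in_deg v) M''"
        and k'': "k' - (in_deg v * (150 + 30) + 20) \<le> k''"
      show "R M'' k''"
      proof (rule post)
        show "complete ?f (sp + out_deg v + in_deg v) M''"
          using partial_complete[OF J v(1)] by blast
        show "k - ((out_deg v + in_deg v) * 180 + 40) \<le> k''" using k' k'' by (simp add: algebra_simps)
      qed
    next
      show "partial ?f v (?O \<union> P) (sp + out_deg v + card P) (set_var M'' ''e'' x)"
        if "partial ?f v (?O \<union> P) (sp + out_deg v + card P) M''" for P M'' x
        using partial_set_e[OF that] .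
      show "run update M'' 150 (\<lambda>M'' _. partial ?f v (?O \<union> insert j P) (sp + out_deg v + card (insert j P)) M'')"
        if "j < m" "finite P" "j \<notin> P" "M'' ''e'' 0 = int j" "partial ?f v (?O \<union> P) (sp + out_deg v + card P) M''" for P M'' j
        using upd[OF that] .
    qed (simp_all add: w)
  next
    show "partial ?f v ({} \<union> P) (sp + card P) (set_var M'' ''e'' x)"
      if "partial ?f v ({} \<union> P) (sp + card P) M''" for P M'' x
      using partial_set_e[OF that] .
    show "run update M'' 150 (\<lambda>M'' _. partial ?f v ({} \<union> insert j P) (sp + card (insert j P)) M'')"
      if "j < m" "finite P" "j \<notin> P" "M'' ''e'' 0 = int j" "partial ?f v ({} \<union> P) (sp + card P) M''" for P M'' j
      using upd[OF that] .
    show "out_deg v * (150 + 30) + 20 \<le> k" by (rule k1)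
  qed (simp_all add: w)
qed

text \<open>Credit for all raises still possible. Per incident arc, 180 pays for the update and 40
  for removing the pushed entry later; the 100 covers the fixed part of a raise.\<close>

definition potential :: "(nat \<Rightarrow> nat) \<Rightarrow> nat" where
  "potential f = (\<Sum>i<N. (L - f i) * ((out_deg i + in_deg i) * 220 + 100))"

lemma potential_raise:
  assumes "v < N" "f v < L"
  shows "potential f = potential (f(v := Suc (f v))) + ((out_deg v + in_deg v) * 220 + 100)"
proof -
  have "L - f v = Suc (L - Suc (f v))" using assms(2) by simp
  then show ?thesis
    unfolding potential_def using assms(1)
    by (simp add: sum.remove[of "{..<N}" v] add.commute)
qed

lemma sum_deg: "(\<Sum>i<N. out_deg i) = m" "(\<Sum>i<N. in_deg i) = m"
proof -
  have "(\<Sum>i<N. card {j. j < m \<and> key j = i}) = m" if "\<And>j. j < m \<Longrightarrow> key j < N" for key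
  proof -
    have "(\<Sum>i<N. card {j. j < m \<and> key j = i}) = card (\<Union>i<N. {j. j < m \<and> key j = i})"
      by (intro card_UN_disjoint[symmetric]) auto
    also have "(\<Union>i<N. {j. j < m \<and> key j = i}) = {..<m}" using that by auto
    finally show ?thesis by simp
  qed
  then show "(\<Sum>i<N. out_deg i) = m" "(\<Sum>i<N. in_deg i) = m"
    unfolding out_deg_def in_deg_def using S D by auto
qed

lemma potential_le: "potential f \<le> L * (m * 440 + N * 100)"
proof -
  have "potential f \<le> (\<Sum>i<N. L * ((out_deg i + in_deg i) * 220 + 100))"
    unfolding potential_def by (intro sum_mono mult_le_mono) auto
  also have "\<dots> = L * (((\<Sum>i<N. out_deg i) + (\<Sum>i<N. in_deg i)) * 220 + N * 100)"
    by (simp add: sum.distrib sum_distrib_left sum_distrib_right algebra_simps)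
  also have "\<dots> = L * (m * 440 + N * 100)" unfolding sum_deg by simp
  finally show ?thesis .
qed

text \<open>By \<open>viol_less\<close> no value passes \<open>r\<close>. An empty stack means that
  no node fails, and then \<open>least\<close> gives the converse inequality. All that the program
  needs to know about the game is contained in the assumptions on \<open>r\<close>.\<close>

lemma iterate_correct:
  assumes M: "complete f sp M" "linked M" "\<And>i. i < N \<Longrightarrow> z \<le> f i \<and> f i \<le> r i"
    and r: "\<And>i. i < N \<Longrightarrow> r i \<le> L \<and> \<not> viol r i"
    and least: "\<And>f. (\<And>i. i < N \<Longrightarrow> z \<le> f i \<and> f i \<le> L \<and> \<not> viol f i) \<Longrightarrow> (\<And>i. i < N \<Longrightarrow> r i \<le> f i)"
    and k: "sp * 40 + potential f + 10 \<le> k"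
    and post: "\<And>M' k'. (\<And>i. i < N \<Longrightarrow> M' ''f'' i = int (r i)) \<Longrightarrow>
       (\<And>x. x \<notin> writes iterate \<Longrightarrow> M' x = M x) \<Longrightarrow>
       k - (sp * 40 + potential f + 10) \<le> k' \<Longrightarrow> R M' k'"
  shows "run iterate M k R"
proof -
  let ?k = "k - (sp * 40 + potential f + 10)"
  define I where "I M' k' \<longleftrightarrow> (\<exists>f sp. complete f sp M' \<and> (\<forall>i<N. z \<le> f i \<and> f i \<le> r i) \<and>
    (\<forall>x. x \<notin> writes iterate \<longrightarrow> M' x = M x) \<and> ?k + sp * 40 + potential f + 10 \<le> k')" for M' k'
  have w: "writes iterate = {''sp'', ''v'', ''f'', ''e'', ''s'', ''t'', ''new'', ''sl'', ''u'', ''st''}"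
    by (auto simp: iterate_def writes_update)
  show ?thesis
    unfolding iterate_def
  proof (rule run_While[where I = I])
    show "I M k" unfolding I_def using M k by (intro exI[of _ f] exI[of _ sp]) auto
  next
    fix M' k' assume "I M' k'"
    then show "bcost (Less (Const 0) (var ''sp'')) + 1 \<le> k'" unfolding I_def by auto
  next
    fix M' k' assume "I M' k'" and "bval (Less (Const 0) (var ''sp'')) M'"
    then obtain f sp' where *: "complete f sp' M'" "\<And>i. i < N \<Longrightarrow> z \<le> f i \<and> f i \<le> r i"
      and fr: "\<And>x. x \<notin> writes iterate \<Longrightarrow> M' x = M x"
      and k': "?k + sp' * 40 + potential f + 10 \<le> k'" and pos: "0 < M' ''sp'' 0"
      unfolding I_def by auto
    then obtain sp where sp': "sp' = Suc sp" unfolding complete_def by (cases sp') auto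
    note c = *(1)[unfolded sp']
    from c obtain v where v: "v < N" "M' ''st'' sp = int v" unfolding complete_def by blast
    have st: "M' ''sp'' 0 = int (Suc sp)" "M' ''L'' 0 = int L" "M' ''f'' v = int (f v)"
      and ok: "mem_ok f (unsat f) M'"
      using c v(1) unfolding complete_def mem_ok_def static_def by auto
    have links: "linked M'"
      using M(2) fr[of "''oh''"] fr[of "''ih''"] fr[of "''on''"] fr[of "''in''"]
      unfolding linked_def w by auto
    let ?M0 = "M'(''sp'' := (M' ''sp'')(0 := int sp), ''v'' := (M' ''v'')(0 := int v))"
    let ?M1 = "M'(''sp'' := (M' ''sp'')(0 := int sp), ''v'' := (M' ''v'')(0 := int v),
      ''f'' := (M' ''f'')(v := int (f v) + 1))"
    have k40: "?k + sp * 40 + potential f + 50 \<le> k'" using k' unfolding sp' by simp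
    show "run (''sp'' ::= Sub (var ''sp'') (Const 1) ;; ''v'' ::= Cell ''st'' (var ''sp'') ;;
        If (And (Less (Cell ''f'' (var ''v'')) (var ''L'')) (Less (Cell ''sl'' (var ''v'')) (Const 1)))
          (Store ''f'' (var ''v'') (Add (Cell ''f'' (var ''v'')) (Const 1)) ;;
           traverse ''oh'' ''on'' update ;; traverse ''ih'' ''in'' update) Skip)
        M' (k' - (bcost (Less (Const 0) (var ''sp'')) + 1)) I"
    proof (cases "viol f v")
      case True
      have cond: "f v < L" "M' ''sl'' v < 1" using slack_viol[OF ok v(1)] True by auto
      note drop = potential_raise[of v f, OF v(1) cond(1)]
      \<comment> \<open>The 37 credits consist of 5 for the loop test, 6 and 5 for popping, 13 for
        the condition and 8 for the increment of \<open>f\<close>.\<close>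
      have "run (traverse ''oh'' ''on'' update ;; traverse ''ih'' ''in'' update) ?M1 (k' - 37) I"
      proof (rule run_frame[OF raise_correct[OF c v True links refl order.refl,
            where R = "\<lambda>M'' _. complete (f(v := Suc (f v))) (sp + out_deg v + in_deg v) M''"]])
        show "(out_deg v + in_deg v) * 180 + 40 \<le> k' - 37" using k40 drop by simp
      next
        fix M'' k'' assume c'': "complete (f(v := Suc (f v))) (sp + out_deg v + in_deg v) M''"
          and fr'': "\<And>x. x \<notin> writes (traverse ''oh'' ''on'' update ;; traverse ''ih'' ''in'' update) \<Longrightarrow> M'' x = ?M1 x"
        have "f v < r v" using viol_less[OF True _ _ v(1)] r[OF v(1)] *(2) by blast
        then have "z \<le> (f(v := Suc (f v))) i \<and> (f(v := Suc (f v))) i \<le> r i" if "i < N" for i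
          using *(2)[OF that] by auto
        moreover have "M'' x = M x" if "x \<notin> writes iterate" for x
          using fr''[of x] fr[OF that] that unfolding w by (auto simp: writes_update)
        ultimately show "I M'' (k' - 37 - ((out_deg v + in_deg v) * 180 + 40) + k'')"
          unfolding I_def using c'' k40 drop
          by (intro exI[of _ "f(v := Suc (f v))"] exI[of _ "sp + out_deg v + in_deg v"]) auto
      qed
      moreover have "50 \<le> k'" using k40 by simp
      ultimately show ?thesis using cond by (simp add: st v(2); arith)
    next
      case False
      then have cond: "\<not> (f v < L \<and> M' ''sl'' v < 1)" using slack_viol[OF ok v(1)] by auto
      have "complete f sp ?M0"
      proof -
        have "pending ?M0 i" if "i < N" "viol f i" for i
        proof -
          have "pending M' i" using c that unfolding complete_def by blast
          then obtain a where "int a < int (Suc sp)" "M' ''st'' a = int i" unfolding pending_def st by blast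
          moreover from this have "a \<noteq> sp" using v(2) that(2) False by auto
          ultimately show ?thesis unfolding pending_def by (intro exI[of _ a]) auto
        qed
        moreover have "mem_ok f (unsat f) ?M0" using ok unfolding mem_ok_def static_def by simp
        ultimately show ?thesis using c unfolding complete_def by simp
      qed
      then have "I ?M0 kk" if "?k + sp * 40 + potential f + 10 \<le> kk" for kk
        unfolding I_def using that *(2) fr by (intro exI[of _ f] exI[of _ sp]) (auto simp: w)
      then show ?thesis using k40 cond by (auto simp: st v(2))
    qed
  next
    fix M' k' assume "I M' k'" and "\<not> bval (Less (Const 0) (var ''sp'')) M'"
    then obtain f sp where *: "complete f sp M'" "\<And>i. i < N \<Longrightarrow> z \<le> f i \<and> f i \<le> r i"
      and fr: "\<And>x. x \<notin> writes iterate \<Longrightarrow> M' x = M x"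
      and k': "?k + sp * 40 + potential f + 10 \<le> k'" and pos: "\<not> 0 < M' ''sp'' 0"
      unfolding I_def by auto
    have "\<not> pending M' i" for i using pos unfolding pending_def by auto
    then have stable: "\<not> viol f i" if "i < N" for i using *(1) that unfolding complete_def by blast
    have "r i \<le> f i" if "i < N" for i
    proof (rule least[OF _ that])
      fix i assume "i < N"
      then show "z \<le> f i \<and> f i \<le> L \<and> \<not> viol f i"
        using *(2)[of i] r[of i] stable[of i] by auto
    qed
    then have "M' ''f'' i = int (r i)" if "i < N" for i
      using *(1) *(2)[OF that] that unfolding complete_def mem_ok_def by (metis le_antisym)
    then show "R M' (k' - (bcost (Less (Const 0) (var ''sp'')) + 1))"
      using fr k' by (intro post) auto
  qed
qed

end

section \<open>Preparation of the data and output\<close>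

definition preprocess :: com where
  "preprocess =
     ''q'' ::= Add (var ''m'') (Const 1) ;;
     ''mn'' ::= Const 0 ;;
     For ''j'' ''q'' (If (Less (Sub (Const 0) (Cell ''weight'' (var ''j''))) (var ''mn''))
        (''mn'' ::= Sub (Const 0) (Cell ''weight'' (var ''j''))) Skip) ;;
     ''lo'' ::= Sub (Const 0) (var ''mn'') ;;
     For ''i'' ''n'' (''lo'' ::= Add (var ''lo'') (var ''mn''))"

definition find_zero :: com where
  "find_zero =
     ''z'' ::= Const 0 ;;
     While (Less (Cell ''val'' (var ''z'')) (Const 0)) (''z'' ::= Add (var ''z'') (Const 1))"

definition link :: com where
  "link =
     ''s'' ::= Cell ''source'' (var ''j'') ;;
     ''t'' ::= Cell ''target'' (var ''j'') ;;
     Store ''on'' (var ''j'') (Cell ''oh'' (var ''s'')) ;;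
     Store ''oh'' (var ''s'') (Add (var ''j'') (Const 1)) ;;
     Store ''in'' (var ''j'') (Cell ''ih'' (var ''t'')) ;;
     Store ''ih'' (var ''t'') (Add (var ''j'') (Const 1)) ;;
     If (Less (Cell ''alice'' (var ''s'')) (Const 1))
       (Store ''sl'' (var ''s'') (Const 1))
       (Store ''sl'' (var ''s'') (Add (Cell ''sl'' (var ''s'')) (Const 1)))"

definition initialize :: com where
  "initialize =
     For ''i'' ''n'' (Store ''f'' (var ''i'') (var ''z'')) ;;
     For ''j'' ''m'' link ;;
     For ''e'' ''m'' update"

definition write_result :: com where
  "write_result =
     For ''i'' ''n'' (If (Less (Cell ''f'' (var ''i'')) (var ''L''))
       (Store ''energy'' (var ''i'') (Cell ''val'' (Cell ''f'' (var ''i''))))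
       (Store ''energy'' (var ''i'') (Const (- 1))))"

definition solver :: com where
  "solver = preprocess ;; generate ;; find_zero ;; initialize ;; iterate ;; write_result"

text \<open>Lacking multiplication, the program obtains \<open>lo = int K * mn\<close> by adding
  \<open>mn\<close> to \<open>- mn\<close> in \<open>Suc K\<close> rounds. The minimum ranges over
  cell \<open>m\<close> as well, so that the zero there counts as a regular summand.\<close>

lemma preprocess_correct:
  assumes M: "M ''n'' 0 = int (Suc K)" "M ''m'' 0 = int m" "M ''weight'' = wt" "wt m = 0"
    and k: "m * 100 + K * 100 + 300 \<le> k"
    and post: "\<And>M' k' mn. M' ''q'' 0 = int (Suc m) \<Longrightarrow> M' ''mn'' 0 = mn \<Longrightarrow> M' ''lo'' 0 = int K * mn \<Longrightarrow>
       (\<And>j. j < Suc m \<Longrightarrow> mn \<le> - wt j) \<Longrightarrow> (\<exists>j<Suc m. mn = - wt j) \<Longrightarrow>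
       (\<And>x. x \<notin> writes preprocess \<Longrightarrow> M' x = M x) \<Longrightarrow>
       k - (m * 100 + K * 100 + 300) \<le> k' \<Longrightarrow> R M' k'"
  shows "run preprocess M k R"
proof -
  \<comment> \<open>The inserted 0 is the initial content of \<open>mn\<close>. It equals
    \<open>- wt m\<close>, so the minimum is attained by a summand.\<close>
  define low where "low i = Min (insert 0 ((\<lambda>j. - wt j) ` {..<i}))" for i
  have low_Suc: "low (Suc i) = min (- wt i) (low i)" for i
  proof -
    have "insert 0 ((\<lambda>j. - wt j) ` {..<Suc i}) = insert (- wt i) (insert 0 ((\<lambda>j. - wt j) ` {..<i}))"
      by (auto simp: lessThan_Suc)
    then show ?thesis unfolding low_def by (simp only:) (rule Min_insert, auto)
  qed
  have low: "\<And>j. j < Suc m \<Longrightarrow> low (Suc m) \<le> - wt j" "\<exists>j<Suc m. low (Suc m) = - wt j"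
  proof -
    show "low (Suc m) \<le> - wt j" if "j < Suc m" for j
      unfolding low_def using that by (intro Min_le) auto
    have "low (Suc m) \<in> insert 0 ((\<lambda>j. - wt j) ` {..<Suc m})" unfolding low_def by (rule Min_in) auto
    then show "\<exists>j<Suc m. low (Suc m) = - wt j" using M(4) by auto
  qed
  let ?M = "set_var (set_var M ''q'' (int m + 1)) ''mn'' 0"
  have 1: "run (For ''j'' ''q'' (If (Less (Sub (Const 0) (Cell ''weight'' (var ''j''))) (var ''mn''))
        (''mn'' ::= Sub (Const 0) (Cell ''weight'' (var ''j''))) Skip)) ?M (k - 9)
      (\<lambda>M' k'. M' ''mn'' 0 = low (Suc m) \<and> (\<forall>x. x \<notin> {''j'', ''mn''} \<longrightarrow> M' x = ?M x) \<and>
         k - (Suc m * 42 + 18) \<le> k')"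
    (is "run (For _ _ ?c) _ _ _")
  proof (rule run_For[where N = "Suc m" and C = 30 and J = "\<lambda>i M. M ''mn'' 0 = low i"])
    show "Suc m * (30 + 12) + 9 \<le> k - 9" using k by simp
    show "run ?c M' 30 (\<lambda>M' _. set_var M' ''j'' (int (Suc i)) ''mn'' 0 = low (Suc i))"
      if "i < Suc m" "M' ''j'' 0 = int i" "M' ''mn'' 0 = low i"
        "\<And>z. z \<notin> insert ''j'' (writes ?c) \<Longrightarrow> M' z = ?M z" for i M'
      using that(2,3) that(4)[of "''weight''"] M(3) by (simp add: low_Suc)
  qed (use M in \<open>auto simp: low_def\<close>)
  have 2: "run (For ''i'' ''n'' (''lo'' ::= Add (var ''lo'') (var ''mn''))) (set_var M' ''lo'' (- mn)) k' R"
    if "M' ''mn'' 0 = mn" "mn = low (Suc m)" "\<And>x. x \<notin> {''j'', ''mn''} \<Longrightarrow> M' x = ?M x"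
      "k - (Suc m * 42 + 40) \<le> k'" for M' k' mn
  proof (rule run_For[where N = "Suc K" and C = 10 and J = "\<lambda>i M. M ''lo'' 0 = int i * mn - mn"])
    show "Suc K * (10 + 12) + 9 \<le> k'" using that(4) k by simp
    show "set_var M' ''lo'' (- mn) ''n'' 0 = int (Suc K)" using that(3)[of "''n''"] M(1) by simp
    show "run (''lo'' ::= Add (var ''lo'') (var ''mn'')) M'' 10
        (\<lambda>M'' _. set_var M'' ''i'' (int (Suc i)) ''lo'' 0 = int (Suc i) * mn - mn)"
      if "M'' ''lo'' 0 = int i * mn - mn" "\<And>z. z \<notin> insert ''i'' (writes (''lo'' ::= Add (var ''lo'') (var ''mn''))) \<Longrightarrow>
        M'' z = set_var M' ''lo'' (- mn) z" for i M''
      using that(1) that(2)[of "''mn''"] \<open>M' ''mn'' 0 = mn\<close> by (simp add: algebra_simps)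
    fix M'' k'' assume "M'' ''lo'' 0 = int (Suc K) * mn - mn"
      and fr: "\<And>z. z \<notin> insert ''i'' (writes (''lo'' ::= Add (var ''lo'') (var ''mn''))) \<Longrightarrow>
        M'' z = set_var M' ''lo'' (- mn) z"
      and k'': "k' - (Suc K * (10 + 12) + 9) \<le> k''"
    then show "R M'' k''"
      using low that(1,2) that(3)[of "''q''"] fr[of "''q''"] fr[of "''mn''"] that(3,4)
      by (intro post[where mn = mn]) (auto simp: algebra_simps preprocess_def)
  qed auto
  have "run (For ''j'' ''q'' ?c) ?M (k - 9) (\<lambda>M' k'. 6 \<le> k' \<and>
      run (For ''i'' ''n'' (''lo'' ::= Add (var ''lo'') (var ''mn''))) (set_var M' ''lo'' (- M' ''mn'' 0)) (k' - 6) R)"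
    by (rule run_mono[OF 1]) (use 2 k in auto)
  moreover have "9 \<le> k" using k by simp
  ultimately show ?thesis unfolding preprocess_def using M(2) by (simp add: add.commute; arith)
qed

lemma find_zero_correct:
  assumes z: "\<And>i. i < z \<Longrightarrow> M ''val'' i < 0" "M ''val'' z = 0"
    and k: "z * 20 + 20 \<le> k"
    and post: "\<And>M' k'. M' ''z'' 0 = int z \<Longrightarrow> (\<And>x. x \<notin> writes find_zero \<Longrightarrow> M' x = M x) \<Longrightarrow>
       k - (z * 20 + 20) \<le> k' \<Longrightarrow> R M' k'"
  shows "run find_zero M k R"
proof -
  define I where "I M' k' \<longleftrightarrow> (\<exists>y\<le>z. M' ''z'' 0 = int y \<and> (\<forall>x. x \<notin> writes find_zero \<longrightarrow> M' x = M x) \<and>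
    k - (z * 20 + 20) + (z - y) * 20 + 10 \<le> k')" for M' k'
  have "run (While (Less (Cell ''val'' (var ''z'')) (Const 0)) (''z'' ::= Add (var ''z'') (Const 1)))
      (set_var M ''z'' 0) (k - 3) R"
  proof (rule run_While[where I = I])
    show "I (set_var M ''z'' 0) (k - 3)"
      unfolding I_def using k by (intro exI[of _ 0]) (auto simp: find_zero_def)
  next
    fix M' k' assume "I M' k'"
    then show "bcost (Less (Cell ''val'' (var ''z'')) (Const 0)) + 1 \<le> k'" unfolding I_def by auto
  next
    fix M' k' assume "I M' k'" and neg: "bval (Less (Cell ''val'' (var ''z'')) (Const 0)) M'"
    then obtain y where y: "y \<le> z" "M' ''z'' 0 = int y" "\<And>x. x \<notin> writes find_zero \<Longrightarrow> M' x = M x"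
      "k - (z * 20 + 20) + (z - y) * 20 + 10 \<le> k'" unfolding I_def by blast
    have "M ''val'' y < 0" using neg y(2) y(3)[of "''val''"] by (simp add: find_zero_def)
    then have "y < z" using z(2) y(1) by (cases "y = z") auto
    then have "(z - y) * 20 = (z - Suc y) * 20 + 20" by auto
    then have "I (set_var M' ''z'' (int (Suc y))) kk" if "k' - 12 \<le> kk" for kk
      unfolding I_def using y \<open>y < z\<close> that
      by (intro exI[of _ "Suc y"]) (auto simp: find_zero_def)
    moreover have "20 \<le> k'" using y(4) \<open>y < z\<close> by auto
    ultimately show "run (''z'' ::= Add (var ''z'') (Const 1)) M'
        (k' - (bcost (Less (Cell ''val'' (var ''z'')) (Const 0)) + 1)) I"
      using y(2) by (simp add: add.commute; arith?)
  next
    fix M' k' assume "I M' k'" and neg: "\<not> bval (Less (Cell ''val'' (var ''z'')) (Const 0)) M'"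
    then obtain y where y: "y \<le> z" "M' ''z'' 0 = int y" "\<And>x. x \<notin> writes find_zero \<Longrightarrow> M' x = M x"
      "k - (z * 20 + 20) + (z - y) * 20 + 10 \<le> k'" unfolding I_def by blast
    have "\<not> M ''val'' y < 0" using neg y(2) y(3)[of "''val''"] by (simp add: find_zero_def)
    then have "y = z" using z(1)[of y] y(1) by (cases "y = z") auto
    then show "R M' (k' - (bcost (Less (Cell ''val'' (var ''z'')) (Const 0)) + 1))"
      using y by (intro post) auto
  qed
  moreover have "3 \<le> k" using k by simp
  ultimately show ?thesis unfolding find_zero_def by simp
qed

lemma write_result_correct:
  assumes M: "M ''n'' 0 = int N" "M ''L'' 0 = int L" "\<And>i. i < N \<Longrightarrow> M ''f'' i = int (r i)"
    and k: "N * 60 + 9 \<le> k"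
    and post: "\<And>M' k'. (\<And>i. i < N \<Longrightarrow> M' ''energy'' i = (if r i < L then M ''val'' (r i) else - 1)) \<Longrightarrow> R M' k'"
  shows "run write_result M k R"
  unfolding write_result_def
proof (rule run_For[where N = N and C = 48 and
      J = "\<lambda>i M'. \<forall>i'<i. M' ''energy'' i' = (if r i' < L then M ''val'' (r i') else - 1)"])
  fix i M' assume i: "i < N" "M' ''i'' 0 = int i"
    and J: "\<forall>i'<i. M' ''energy'' i' = (if r i' < L then M ''val'' (r i') else - 1)"
    and fr: "\<And>z. z \<notin> insert ''i'' (writes (If (Less (Cell ''f'' (var ''i'')) (var ''L''))
       (Store ''energy'' (var ''i'') (Cell ''val'' (Cell ''f'' (var ''i''))))
       (Store ''energy'' (var ''i'') (Const (- 1))))) \<Longrightarrow> M' z = M z"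
  have "M' ''f'' i = int (r i)" "M' ''L'' 0 = int L" "M' ''val'' = M ''val''"
    using M i(1) fr by auto
  then show "run (If (Less (Cell ''f'' (var ''i'')) (var ''L''))
       (Store ''energy'' (var ''i'') (Cell ''val'' (Cell ''f'' (var ''i''))))
       (Store ''energy'' (var ''i'') (Const (- 1)))) M' 48
     (\<lambda>M''. \<lambda>_. \<forall>i'<Suc i. (set_var M'' ''i'' (int (Suc i))) ''energy'' i' = (if r i' < L then M ''val'' (r i') else - 1))"
    using i(2) J by (auto simp: less_Suc_eq)
qed (use M k post in auto)

context arena
begin

lemma link_correct:
  assumes M: "M ''m'' 0 = int m" "\<And>j. j < m \<Longrightarrow> M ''source'' j = int (S j) \<and> M ''target'' j = int (D j)"
      "\<And>i. i < N \<Longrightarrow> M ''alice'' i = of_bool (al i)"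
    and 0: "\<And>i. M ''oh'' i = 0" "\<And>i. M ''ih'' i = 0" "\<And>i. M ''sl'' i = 0"
    and k: "m * 100 + 9 \<le> k"
    and post: "\<And>M' k'. linked M' \<Longrightarrow> (\<And>i. i < N \<Longrightarrow> M' ''sl'' i = thr i) \<Longrightarrow>
       (\<And>x. x \<notin> insert ''j'' (writes link) \<Longrightarrow> M' x = M x) \<Longrightarrow> k - (m * 100 + 9) \<le> k' \<Longrightarrow> R M' k'"
  shows "run (For ''j'' ''m'' link) M k R"
proof -
  \<comment> \<open>The slack of a node of Bob is set to 1 at each of its arcs. Since every node has
    an arc, the final values agree with \<open>thr\<close>.\<close>
  define th :: "nat \<Rightarrow> nat \<Rightarrow> int" where
    "th i k = (if al i then (\<Sum>j<k. of_bool (S j = i)) else of_bool (\<exists>j<k. S j = i))" for i k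
  define J where "J k M' \<longleftrightarrow> (\<forall>i<N. M' ''oh'' i = int (prv S i k) \<and> M' ''ih'' i = int (prv D i k) \<and>
      M' ''sl'' i = th i k) \<and>
    (\<forall>j<k. M' ''on'' j = int (prv S (S j) j) \<and> M' ''in'' j = int (prv D (D j) j))" for k M'
  show ?thesis
  proof (rule run_For[where N = m and C = 88 and J = J])
    show "J 0 (set_var M ''j'' 0)" using 0 by (simp add: J_def th_def)
  next
    fix j M' assume j: "j < m" "M' ''j'' 0 = int j" and J: "J j M'"
      and fr: "\<And>z. z \<notin> insert ''j'' (writes link) \<Longrightarrow> M' z = M z"
    have e: "M' ''source'' j = int (S j)" "M' ''target'' j = int (D j)" "M' ''alice'' (S j) = of_bool (al (S j))"
      using M(2)[OF j(1)] M(3)[OF S[OF j(1)]] fr[of "''source''"] fr[of "''target''"] fr[of "''alice''"]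
      by (simp_all add: link_def)
    have h: "M' ''oh'' (S j) = int (prv S (S j) j)" "M' ''ih'' (D j) = int (prv D (D j) j)"
      "M' ''sl'' (S j) = th (S j) j"
      using J S[OF j(1)] D[OF j(1)] unfolding J_def by auto
    have th: "th i (Suc j) = (if S j = i then if al i then th i j + 1 else 1 else th i j)" for i
      by (auto simp: th_def less_Suc_eq)
    have fin: "J (Suc j) M''"
      if "M'' ''oh'' = (M' ''oh'')(S j := int j + 1)" "M'' ''ih'' = (M' ''ih'')(D j := int j + 1)"
        "M'' ''on'' = (M' ''on'')(j := int (prv S (S j) j))" "M'' ''in'' = (M' ''in'')(j := int (prv D (D j) j))"
        "M'' ''sl'' = (M' ''sl'')(S j := th (S j) (Suc j))" for M''
      using J unfolding J_def that by (auto simp: less_Suc_eq th)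
    show "run link M' 88 (\<lambda>M'' _. J (Suc j) (set_var M'' ''j'' (int (Suc j))))"
    proof (cases "al (S j)")
      case True
      then show ?thesis unfolding link_def by (simp add: j e h) (intro fin, simp_all add: th)
    next
      case False
      then show ?thesis unfolding link_def by (simp add: j e h) (intro fin, simp_all add: th)
    qed
  next
    fix M' k' assume J: "J m M'" and fr: "\<And>z. z \<notin> insert ''j'' (writes link) \<Longrightarrow> M' z = M z"
      and k': "k - (m * (88 + 12) + 9) \<le> k'"
    have "th i m = thr i" if "i < N" for i using out[OF that] by (auto simp: th_def thr_def)
    then show "R M' k'" using J fr k' by (intro post) (auto simp: J_def linked_def)
  qed (use M k in \<open>auto simp: link_def\<close>)
qed

text \<open>Flags that are all down match a slack of \<open>thr\<close>, so the initial pass is an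
  ordinary round of updates. Each update pushes its source, and as every node has an outgoing arc,
  all nodes are on the stack afterwards.\<close>

lemma update_all_correct:
  assumes M: "M ''m'' 0 = int m" "M ''sp'' 0 = 0" "mem_ok f (\<lambda>_. False) M"
    and k: "m * 162 + 9 \<le> k"
    and post: "\<And>M' k'. complete f m M' \<Longrightarrow>
       (\<And>x. x \<notin> insert ''e'' (writes update) \<Longrightarrow> M' x = M x) \<Longrightarrow> k - (m * 162 + 9) \<le> k' \<Longrightarrow> R M' k'"
  shows "run (For ''e'' ''m'' update) M k R"
proof -
  define J where "J k M' \<longleftrightarrow> mem_ok f (\<lambda>j. j < k \<and> unsat f j) M' \<and> M' ''sp'' 0 = int k \<and>
    (\<forall>a<k. M' ''st'' a = int (S a))" for k M'
  have set_e: "J k (set_var M' ''e'' x) = J k M'" for k M' x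
    unfolding J_def mem_ok_def static_def by simp
  show ?thesis
  proof (rule run_For[where N = m and C = 150 and J = J])
    show "J 0 (set_var M ''e'' 0)" unfolding set_e using M by (simp add: J_def)
  next
    fix j M' assume j: "j < m" "M' ''e'' 0 = int j" and J: "J j M'"
    have eq: "(\<lambda>j'. j' < j \<and> unsat f j')(j := unsat f j) = (\<lambda>j'. j' < Suc j \<and> unsat f j')"
      by (auto simp: fun_eq_iff less_Suc_eq)
    have "run update M' 150 (\<lambda>M'' _. J (Suc j) M'')"
      using J unfolding J_def
      by (intro run_mono[OF update_correct[where M = M' and f = f and F = "\<lambda>j'. j' < j \<and> unsat f j'", OF _ j]]) (auto simp: eq less_Suc_eq)
    then show "run update M' 150 (\<lambda>M'' _. J (Suc j) (set_var M'' ''e'' (int (Suc j))))"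
      unfolding set_e .
  next
    fix M' k' assume J: "J m M'" and fr: "\<And>z. z \<notin> insert ''e'' (writes update) \<Longrightarrow> M' z = M z"
      and k': "k - (m * (150 + 12) + 9) \<le> k'"
    have "(\<Sum>j<m. of_bool (S j = i \<and> j < m \<and> unsat f j) :: int) = (\<Sum>j<m. of_bool (S j = i \<and> unsat f j))" for i
      by (intro sum.cong) auto
    then have "mem_ok f (unsat f) M'" using J unfolding J_def mem_ok_def by simp
    moreover have "pending M' i" if i: "i < N" for i
    proof -
      obtain j where "j < m" "S j = i" using out[OF i] by blast
      then show ?thesis using J unfolding J_def pending_def by (intro exI[of _ j]) auto
    qed
    ultimately have "complete f m M'" using J S unfolding complete_def J_def by auto
    then show "R M' k'" using fr k' by (intro post) auto
  qed (use M k in \<open>auto simp: writes_update\<close>)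
qed

lemma initialize_correct:
  assumes M: "M ''n'' 0 = int N" "M ''m'' 0 = int m" "M ''z'' 0 = int z" "static M"
      "\<And>i. i < N \<Longrightarrow> M ''alice'' i = of_bool (al i)"
    and 0: "\<And>i. M ''oh'' i = 0" "\<And>i. M ''ih'' i = 0" "\<And>i. M ''sl'' i = 0" "\<And>i. M ''u'' i = 0" "M ''sp'' 0 = 0"
    and k: "N * 40 + m * 262 + 27 \<le> k"
    and post: "\<And>M' k'. complete (\<lambda>_. z) m M' \<Longrightarrow> linked M' \<Longrightarrow> (\<And>x. x \<notin> writes initialize \<Longrightarrow> M' x = M x) \<Longrightarrow>
      k - (N * 40 + m * 262 + 27) \<le> k' \<Longrightarrow> R M' k'"
  shows "run initialize M k R"
  unfolding initialize_def run_Seq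
proof (rule run_For[where N = N and C = 28 and J = "\<lambda>i M. \<forall>i'<i. M ''f'' i' = int z"])
  show "run (Store ''f'' (var ''i'') (var ''z'')) M' 28
      (\<lambda>M'' _. \<forall>i'<Suc i. (set_var M'' ''i'' (int (Suc i))) ''f'' i' = int z)"
    if "M' ''i'' 0 = int i" "\<forall>i'<i. M' ''f'' i' = int z"
      "\<And>x. x \<notin> insert ''i'' (writes (Store ''f'' (var ''i'') (var ''z''))) \<Longrightarrow> M' x = M x" for i M'
    using that(1,2) that(3)[of "''z''"] M(3) by (simp add: less_Suc_eq)
  fix M\<^sub>1 k\<^sub>1 assume f: "\<forall>i<N. M\<^sub>1 ''f'' i = int z"
    and fr1: "\<And>x. x \<notin> insert ''i'' (writes (Store ''f'' (var ''i'') (var ''z''))) \<Longrightarrow> M\<^sub>1 x = M x"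
    and k1: "k - (N * (28 + 12) + 9) \<le> k\<^sub>1"
  have stat: "static M'" if "\<And>x. x \<in> {''L'', ''val'', ''source'', ''target'', ''weight''} \<Longrightarrow> M' x = M x" for M'
    using M(4) that unfolding static_def by simp
  show "run (For ''j'' ''m'' link) M\<^sub>1 k\<^sub>1 (\<lambda>M k. run (For ''e'' ''m'' update) M k R)"
  proof (rule link_correct)
    fix M\<^sub>2 k\<^sub>2 assume l: "linked M\<^sub>2" "\<And>i. i < N \<Longrightarrow> M\<^sub>2 ''sl'' i = thr i"
      and fr2: "\<And>x. x \<notin> insert ''j'' (writes link) \<Longrightarrow> M\<^sub>2 x = M\<^sub>1 x" and k2: "k\<^sub>1 - (m * 100 + 9) \<le> k\<^sub>2"
    have fr: "M\<^sub>2 x = M x" if "x \<notin> {''f'', ''i'', ''j'', ''s'', ''t'', ''on'', ''oh'', ''in'', ''ih'', ''sl''}" for x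
      using fr1[of x] fr2[of x] that by (simp add: link_def)
    have "static M\<^sub>2" by (rule stat) (auto intro!: fr)
    then have ok: "mem_ok (\<lambda>_. z) (\<lambda>_. False) M\<^sub>2"
      using l(2) f fr2[of "''f''"] fr[of "''u''"] 0 unfolding mem_ok_def by (simp add: link_def)
    show "run (For ''e'' ''m'' update) M\<^sub>2 k\<^sub>2 R"
    proof (rule update_all_correct[OF _ _ ok])
      fix M\<^sub>3 k\<^sub>3 assume c: "complete (\<lambda>_. z) m M\<^sub>3"
        and fr3: "\<And>x. x \<notin> insert ''e'' (writes update) \<Longrightarrow> M\<^sub>3 x = M\<^sub>2 x" and k3: "k\<^sub>2 - (m * 162 + 9) \<le> k\<^sub>3"
      have "linked M\<^sub>3" using l(1) fr3 unfolding linked_def by (simp add: writes_update)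
      moreover have "M\<^sub>3 x = M x" if "x \<notin> writes initialize" for x
        using fr[of x] fr3[of x] that by (simp add: initialize_def link_def writes_update)
      ultimately show "R M\<^sub>3 k\<^sub>3" using c k1 k2 k3 by (intro post) auto
    qed (use fr M 0 k k1 k2 in auto)
  qed (use fr1 M 0 k k1 in \<open>auto simp: static_def\<close>)
qed (use M k in auto)

end

section \<open>Energies as ranks in the list of sums\<close>

lemma index_of_nth: "distinct vs \<Longrightarrow> i < length vs \<Longrightarrow> index_of vs (vs ! i) = i"
  unfolding index_of_def by (rule the_equality) (auto simp: nth_eq_iff_index_eq)

lemma index_of:
  assumes "distinct vs" "v \<in> set vs"
  shows "index_of vs v < length vs" "vs ! index_of vs v = v"
  using assms index_of_nth by (metis in_set_conv_nth)+

text \<open>\<open>x i\<close> counts the summands assigned to window \<open>i\<close>, with the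
  sign of \<open>c\<close> reversed because the summands are negated weights. Small summands, in
  particular the padding 0, need no window: they contribute only to the error, so the exponent
  remains the number of windows.\<close>

lemma sums_of_windows:
  assumes "\<And>j. j < q \<Longrightarrow> \<bar>a j\<bar> \<le> \<delta> \<or> (\<exists>i\<in>I. \<bar>a j + c i\<bar> \<le> \<delta>)" "finite I" "0 \<le> \<delta>"
    and "t \<in> sums_of a q k"
  shows "\<exists>x. (\<forall>i\<in>I. x i \<le> k) \<and> \<bar>t + (\<Sum>i\<in>I. int (x i) * c i)\<bar> \<le> int k * \<delta>"
  using assms(4)
proof (induction k arbitrary: t)
  case 0
  then show ?case by (intro exI[of _ "\<lambda>_. 0"]) auto
next
  case (Suc k)
  then obtain s j where t: "t = s + a j" "s \<in> sums_of a q k" "j < q" by (metis sums_of_SucE)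
  from Suc.IH[OF t(2)] obtain x where x: "\<forall>i\<in>I. x i \<le> k"
    "\<bar>s + (\<Sum>i\<in>I. int (x i) * c i)\<bar> \<le> int k * \<delta>" by auto
  show ?case
  proof (cases "\<bar>a j\<bar> \<le> \<delta>")
    case True
    then show ?thesis using x t(1) by (intro exI[of _ x]) (auto simp: algebra_simps)
  next
    case False
    then obtain i where i: "i \<in> I" "\<bar>a j + c i\<bar> \<le> \<delta>" using assms(1)[OF t(3)] by auto
    have "(\<Sum>i'\<in>I. int ((x(i := Suc (x i))) i') * c i') = (\<Sum>i'\<in>I. int (x i') * c i') + c i"
      using i(1) assms(2) by (simp add: sum.remove[of I i] algebra_simps)
    then show ?thesis using x t(1) i by (intro exI[of _ "x(i := Suc (x i))"]) (auto simp: algebra_simps)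
  qed
qed

text \<open>A sum is recovered from its counts \<open>x\<close> and its error, for which there are
  \<open>Suc k ^ d\<close> and \<open>2 * (k * \<delta>) + 1\<close> possibilities.\<close>

lemma card_sums_of_windows:
  assumes "\<And>j. j < q \<Longrightarrow> \<bar>a j\<bar> \<le> int \<delta> \<or> (\<exists>i\<in>{1..d}. \<bar>a j + c i\<bar> \<le> int \<delta>)"
  shows "card (sums_of a q k) \<le> Suc k ^ d * (2 * (k * \<delta>) + 1)"
proof -
  let ?F = "\<lambda>(x, s). s - (\<Sum>i\<in>{1..d}. int (x i) * c i)"
  let ?X = "({1..d} \<rightarrow>\<^sub>E {..k}) \<times> {- int (k * \<delta>)..int (k * \<delta>)}"
  have "sums_of a q k \<subseteq> ?F ` ?X"
  proof
    fix t assume "t \<in> sums_of a q k"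
    then obtain x where x: "\<forall>i\<in>{1..d}. x i \<le> k"
      "\<bar>t + (\<Sum>i\<in>{1..d}. int (x i) * c i)\<bar> \<le> int k * int \<delta>"
      using sums_of_windows[where a = a and q = q and k = k and I = "{1..d}" and c = c, OF assms] by fastforce
    let ?x = "restrict x {1..d}"
    have eq: "(\<Sum>i\<in>{1..d}. int (?x i) * c i) = (\<Sum>i\<in>{1..d}. int (x i) * c i)"
      by (intro sum.cong) auto
    have "t = ?F (?x, t + (\<Sum>i\<in>{1..d}. int (x i) * c i))" using eq by simp
    moreover have "(?x, t + (\<Sum>i\<in>{1..d}. int (x i) * c i)) \<in> ?X" using x by auto
    ultimately show "t \<in> ?F ` ?X" by blast
  qed
  moreover have "finite ?X" by (intro finite_SigmaI finite_PiE) auto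
  ultimately have "card (sums_of a q k) \<le> card ?X"
    by (meson card_image_le card_mono finite_imageI order_trans)
  also have "\<dots> = Suc k ^ d * (2 * (k * \<delta>) + 1)"
    by (simp add: card_cartesian_product card_PiE nat_add_distrib nat_mult_distrib algebra_simps)
  finally show ?thesis .
qed

section \<open>The game with nodes and arcs numbered by position\<close>

locale game_input = game_graph G V\<^sub>A V\<^sub>B
  for G :: "'v pair_pre_digraph" and V\<^sub>A V\<^sub>B +
  fixes w :: "'v \<times> 'v \<Rightarrow> int" and vs :: "'v list" and es :: "('v \<times> 'v) list"
  assumes vs: "distinct vs" "set vs = pverts G" and es: "distinct es" "set es = parcs G"
    and nonempty: "pverts G \<noteq> {}"
begin

abbreviation N :: nat where "N \<equiv> length vs"
abbreviation m :: nat where "m \<equiv> length es"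
definition S :: "nat \<Rightarrow> nat" where "S j = index_of vs (fst (es ! j))"
definition D :: "nat \<Rightarrow> nat" where "D j = index_of vs (snd (es ! j))"
definition energy :: "nat \<Rightarrow> enat" where "energy i = min_energy G V\<^sub>A V\<^sub>B w (vs ! i)"
text \<open>Cell \<open>m\<close> of the weights reads 0, which makes sums of fewer than \<open>n - 1\<close> weights available.\<close>

definition wt :: "nat \<Rightarrow> int" where "wt j = (if j < m then w (es ! j) else 0)"

definition A :: "int set" where "A = sums_of (\<lambda>j. - wt j) (Suc m) (N - 1)"

lemma N_eq: "N = card (pverts G)" using vs distinct_card by metis

lemma m_eq: "m = card (parcs G)" using es distinct_card by metis

lemma N_pos: "0 < N" using vs nonempty by auto

lemma arc: assumes "j < m" shows "S j < N" "D j < N" "es ! j = (vs ! S j, vs ! D j)"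
proof -
  have "es ! j \<in> parcs G" using assms es(2) nth_mem by blast
  then have "fst (es ! j) \<in> set vs" "snd (es ! j) \<in> set vs"
    unfolding vs(2) using arc_fst_in_verts arc_snd_in_verts by auto
  then show "S j < N" "D j < N" "es ! j = (vs ! S j, vs ! D j)"
    unfolding S_def D_def using index_of[OF vs(1)] by auto
qed

lemma arc_index:
  assumes "(vs ! i, v) \<in> parcs G" "i < N"
  obtains j where "j < m" "S j = i" "vs ! D j = v"
proof -
  obtain j where j: "j < m" "es ! j = (vs ! i, v)" using assms(1) es(2) by (metis in_set_conv_nth)
  with arc[OF j(1)] vs(1) assms(2) that show thesis by (auto simp: nth_eq_iff_index_eq)
qed

lemma arc_exists: "i < N \<Longrightarrow> \<exists>j<m. S j = i"
  using out_neighbor_exists[of "vs ! i"] vs(2) nth_mem by (metis arc_index)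

text \<open>Every node is the source of an arc. Costs linear in the number of nodes are thereby
  absorbed by \<open>m\<close>.\<close>

lemma N_le_m: "N \<le> m"
proof -
  have "{..<N} \<subseteq> S ` {..<m}" using arc_exists by force
  then have "card {..<N} \<le> card {..<m}" by (meson card_image_le card_mono finite_imageI finite_lessThan order_trans)
  then show ?thesis by simp
qed

lemma finite_A: "finite A" by (simp add: A_def)

lemma sums_of_subset_A: "k \<le> N - 1 \<Longrightarrow> sums_of (\<lambda>j. - wt j) (Suc m) k \<subseteq> A"
  unfolding A_def by (rule sums_of_pad[of m]) (auto simp: wt_def)

lemma zero_A: "0 \<in> A"
  using sums_of_subset_A[of 0] by auto

lemma energy_A: assumes "energy i = enat x" "i < N" shows "int x \<in> A"
proof -
  have "vs ! i \<in> pverts G" using assms(2) vs(2) nth_mem by blast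
  with assms(1) consider "x = 0" | p where "set p \<subseteq> parcs G" "length p < N" "int x = - weight w p"
    unfolding energy_def N_eq using min_energy_eqD by blast
  then show ?thesis
  proof cases
    case 1
    then show ?thesis using zero_A by simp
  next
    case 2
    have "- weight w p \<in> sums_of (\<lambda>j. - wt j) (Suc m) (length p)"
      using 2(1)
    proof (induction p)
      case (Cons e p)
      then have "e \<in> set es" using es(2) by simp
      then obtain j where j: "j < m" "es ! j = e" by (metis in_set_conv_nth)
      have "- weight w p \<in> sums_of (\<lambda>j. - wt j) (Suc m) (length p)" using Cons by simp
      from sums_of_SucI[OF this, of j] j show ?case by (simp add: wt_def add.commute)
    qed simp
    moreover have "length p \<le> N - 1" using 2(2) by simp
    ultimately show ?thesis using sums_of_subset_A 2(3) by auto
  qed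
qed

text \<open>For \<open>\<delta> = 0\<close> the summand 1 is all that remains of the error range;
  \<open>max 1 \<delta>\<close> keeps the estimate valid in this case.\<close>

lemma card_A_le:
  assumes "\<forall>e\<in>parcs G. \<exists>i\<in>{1..d}. w e \<in> {c i - int \<delta>..c i + int \<delta>}"
  shows "card A \<le> 2 * (max 1 \<delta> * N ^ (d + 1))"
proof -
  have "\<bar>- wt j\<bar> \<le> int \<delta> \<or> (\<exists>i\<in>{1..d}. \<bar>- wt j + c i\<bar> \<le> int \<delta>)" for j
  proof (cases "j < m")
    case True
    then have "es ! j \<in> parcs G" using es(2) nth_mem by blast
    with assms obtain i where "i \<in> {1..d}" "w (es ! j) \<in> {c i - int \<delta>..c i + int \<delta>}" by blast
    then show ?thesis using True by (intro disjI2 bexI[of _ i]) (auto simp: wt_def)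
  qed (simp add: wt_def)
  then have "card A \<le> Suc (N - 1) ^ d * (2 * ((N - 1) * \<delta>) + 1)"
    unfolding A_def by (intro card_sums_of_windows)
  also have "\<dots> = N ^ d * (2 * ((N - 1) * \<delta>) + 1)" using N_pos by simp
  also have "\<dots> \<le> N ^ d * (2 * (N * max 1 \<delta>))"
  proof (rule mult_le_mono2)
    have "(N - 1) * \<delta> \<le> (N - 1) * max 1 \<delta>" by (intro mult_le_mono) auto
    moreover have "N * max 1 \<delta> = (N - 1) * max 1 \<delta> + max 1 \<delta>"
      using N_pos by (cases N) auto
    ultimately show "2 * ((N - 1) * \<delta>) + 1 \<le> 2 * (N * max 1 \<delta>)" by linarith
  qed
  also have "\<dots> = 2 * (max 1 \<delta> * N ^ (d + 1))" by (simp add: power_add)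
  finally show ?thesis .
qed

end

locale ranked_game = game_input G V\<^sub>A V\<^sub>B w vs es
  for G :: "'v pair_pre_digraph" and V\<^sub>A V\<^sub>B w vs es +
  fixes val :: "nat \<Rightarrow> int" and L :: nat
  assumes val: "enumerates val L A"
begin

definition pos :: "int \<Rightarrow> nat" where "pos x = (SOME i. i < L \<and> val i = x)"

definition rank :: "nat \<Rightarrow> nat" where
  "rank i = (case energy i of enat x \<Rightarrow> pos (int x) | \<infinity> \<Rightarrow> L)"

lemma pos: assumes "x \<in> A" shows "pos x < L" "val (pos x) = x"
proof -
  have "\<exists>i. i < L \<and> val i = x" using assms val unfolding enumerates_def by force
  then have "pos x < L \<and> val (pos x) = x" unfolding pos_def by (rule someI_ex)
  then show "pos x < L" "val (pos x) = x" by auto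
qed

lemma val_le_iff: "i < L \<Longrightarrow> i' < L \<Longrightarrow> val i \<le> val i' \<longleftrightarrow> i \<le> i'"
  using enumerates_less[OF val, of i i'] enumerates_less[OF val, of i' i]
  by (cases i i' rule: linorder_cases) auto

sublocale arena N m S D "\<lambda>j. w (es ! j)" "\<lambda>i. vs ! i \<in> V\<^sub>A" val L "pos 0"
  using arc arc_exists enumerates_less[OF val] pos(1)[OF zero_A] by unfold_locales auto

lemma rank_finite:
  assumes "i < N" "energy i = enat x"
  shows "rank i < L" "val (rank i) = int x"
  using assms pos[OF energy_A[OF assms(2,1)]] by (auto simp: rank_def)

lemma rank_infinite: "energy i = \<infinity> \<Longrightarrow> rank i = L"
  by (simp add: rank_def)

lemma rank_bounds: assumes "i < N" shows "pos 0 \<le> rank i" "rank i \<le> L"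
proof -
  have "pos 0 \<le> rank i \<and> rank i \<le> L"
  proof (cases "energy i")
    case (enat x)
    then show ?thesis
      using rank_finite[OF assms enat] val_le_iff[of "pos 0" "rank i"] pos[OF zero_A] by auto
  next
    case infinity
    then show ?thesis using rank_infinite pos(1)[OF zero_A] by auto
  qed
  then show "pos 0 \<le> rank i" "rank i \<le> L" by auto
qed

text \<open>Every finite energy lies in \<open>A\<close>, so \<open>val (rank i)\<close> is the
  energy itself without rounding, and an inequality between energies is one between values of
  ranks.\<close>

lemma rank_sat:
  assumes "i < N" "energy i = enat x" "j < m" "S j = i"
    and "0 \<le> int x + w (vs ! i, vs ! D j)"
    and "min_energy G V\<^sub>A V\<^sub>B w (vs ! D j) \<le> enat (nat (int x + w (vs ! i, vs ! D j)))"
  shows "\<not> unsat rank j"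
proof -
  obtain y where y: "energy (D j) = enat y" "int y \<le> int x + w (vs ! i, vs ! D j)"
    using assms(5,6) unfolding energy_def
    by (cases "min_energy G V\<^sub>A V\<^sub>B w (vs ! D j)") auto
  then show ?thesis
    using rank_finite[OF assms(1,2)] rank_finite[OF arc(2)[OF assms(3)] y(1)] arc(3)[OF assms(3)] assms(4)
    unfolding unsat_def by auto
qed

lemma rank_stable: assumes "i < N" shows "\<not> viol rank i"
proof (cases "energy i")
  case infinity
  then show ?thesis using rank_infinite by (simp add: viol_def)
next
  case (enat x)
  then have e: "min_energy G V\<^sub>A V\<^sub>B w (vs ! i) = enat x" unfolding energy_def .
  show ?thesis
  proof (cases "vs ! i \<in> V\<^sub>A")
    case True
    from min_energy_step_alice[OF e True] obtain v where v: "(vs ! i, v) \<in> parcs G"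
      "0 \<le> int x + w (vs ! i, v)"
      "min_energy G V\<^sub>A V\<^sub>B w v \<le> enat (nat (int x + w (vs ! i, v)))" by blast
    then obtain j where "j < m" "S j = i" "vs ! D j = v" using arc_index assms by metis
    then have "j < m \<and> S j = i \<and> \<not> unsat rank j" using rank_sat[OF assms enat] v by auto
    then show ?thesis using True unfolding viol_def by auto
  next
    case False
    then have B: "vs ! i \<in> V\<^sub>B" using assms vs(2) partition(1) nth_mem by blast
    have "\<not> unsat rank j" if "j < m" "S j = i" for j
    proof -
      have "(vs ! i, vs ! D j) \<in> parcs G" using arc(3)[OF that(1)] that es(2) nth_mem by metis
      from min_energy_step_bob[OF e B this] show ?thesis using rank_sat[OF assms enat that] by blast
    qed
    then show ?thesis using False unfolding viol_def by auto
  qed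
qed

text \<open>A stable \<open>f\<close> is itself a potential, finite where \<open>f\<close> is below
  \<open>L\<close> and nonnegative because \<open>f\<close> is at least \<open>pos 0\<close>. The
  energies lie below every potential, and monotonicity of \<open>val\<close> transfers this to
  ranks.\<close>

lemma rank_least:
  assumes f: "\<And>i. i < N \<Longrightarrow> pos 0 \<le> f i \<and> f i \<le> L \<and> \<not> viol f i" and i: "i < N"
  shows "rank i \<le> f i"
proof (cases "f i < L")
  case False
  then show ?thesis using f[OF i] rank_bounds(2)[OF i] by simp
next
  case True
  let ?P = "\<lambda>v. f (index_of vs v) < L" and ?h = "\<lambda>v. val (f (index_of vs v))"
  have nonneg: "0 \<le> val (f i)" if "i < N" "f i < L" for i
    using f[OF that(1)] that(2) val_le_iff[of "pos 0" "f i"] pos[OF zero_A] by auto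
  have sat: "?P (vs ! D j) \<and> ?h (vs ! D j) \<le> ?h (vs ! S j) + w (vs ! S j, vs ! D j)"
    if "j < m" "\<not> unsat f j" "f (S j) < L" for j
    using that arc[OF that(1)] f[of "D j"] index_of_nth[OF vs(1)] unfolding unsat_def by auto
  have node: "\<exists>i<N. vs ! i = u \<and> index_of vs u = i" if "u \<in> pverts G" for u
    using that index_of[OF vs(1)] unfolding vs(2)[symmetric] by blast
  have "min_energy G V\<^sub>A V\<^sub>B w (vs ! i) \<le> enat (nat (?h (vs ! i)))"
  proof (rule min_energy_le_potential[where P = ?P])
    show "0 \<le> ?h u" if "u \<in> pverts G" "?P u" for u
    proof -
      from node[OF that(1)] obtain k where "k < N" "index_of vs u = k" by blast
      then show ?thesis using that(2) nonneg[of k] by simp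
    qed
  next
    fix u assume u: "u \<in> V\<^sub>A" "?P u"
    then obtain k where k: "k < N" "vs ! k = u" "index_of vs u = k" using node partition by blast
    then obtain j where j: "j < m" "S j = k" "\<not> unsat f j"
      using f[OF k(1)] u unfolding viol_def by auto
    have "(u, vs ! D j) \<in> parcs G" using arc(3)[OF j(1)] j k es(2) nth_mem by metis
    then show "\<exists>v. (u, v) \<in> parcs G \<and> ?P v \<and> ?h v \<le> ?h u + w (u, v)"
      using sat[OF j(1,3)] j(2) k u(2) by auto
  next
    fix u v assume u: "u \<in> V\<^sub>B" "?P u" "(u, v) \<in> parcs G"
    then obtain k where k: "k < N" "vs ! k = u" "index_of vs u = k" using node partition by blast
    moreover obtain j where j: "j < m" "S j = k" "vs ! D j = v" using arc_index u(3) k by metis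
    moreover have "u \<notin> V\<^sub>A" using u(1) partition by auto
    ultimately have "\<not> unsat f j" using f[OF k(1)] u unfolding viol_def by auto
    then show "?P v \<and> ?h v \<le> ?h u + w (u, v)"
      using sat[OF j(1)] j k u(2) by auto
  next
    show "vs ! i \<in> pverts G" "?P (vs ! i)" using i True vs index_of_nth nth_mem by metis+
  qed
  then have "energy i \<le> enat (nat (val (f i)))"
    unfolding energy_def using index_of_nth[OF vs(1) i] by simp
  then obtain x where x: "energy i = enat x" "x \<le> nat (val (f i))" by (cases "energy i") auto
  then show ?thesis
    using rank_finite[OF i x(1)] val_le_iff[of "rank i" "f i"] True nonneg[OF i True] by auto
qed

lemma rank_encode: "i < N \<Longrightarrow> (if rank i < L then val (rank i) else - 1) = encode_energy (energy i)"
  using rank_finite[of i] rank_infinite[of i] by (cases "energy i") (auto simp: encode_energy_def)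

end

context game_input
begin

text \<open>Each phase is bounded by a multiple of \<open>m * card A\<close>: 500 for preprocessing,
  500 for generating the sums, 50 for finding 0, 329 for initialisation, 600 for the iteration and
  69 for the output, which together stay below 2200.\<close>

lemma solver_correct:
  "run solver (input_memory V\<^sub>A w vs es) (2200 * (m * card A))
     (\<lambda>M _. \<forall>i<N. M ''energy'' i = encode_energy (energy i))"
proof -
  let ?M0 = "input_memory V\<^sub>A w vs es" and ?X = "m * card A"
  have X: "m \<le> ?X" "N \<le> ?X" "1 \<le> ?X" "card A \<le> ?X" "card A * m = ?X" "card A * N \<le> ?X"
  proof -
    have "1 \<le> card A" using zero_A finite_A card_0_eq[of A] by (cases "card A") auto
    moreover have "1 \<le> m" using N_pos N_le_m by linarith
    ultimately show "m \<le> ?X" "card A \<le> ?X" by auto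
    with \<open>1 \<le> m\<close> N_le_m show "1 \<le> ?X" "N \<le> ?X" by linarith+
    show "card A * m = ?X" by simp
    show "card A * N \<le> ?X" using N_le_m by simp
  qed
  have input: "?M0 ''n'' 0 = int N" "?M0 ''m'' 0 = int m" "?M0 ''weight'' = wt"
    "\<And>i. i < N \<Longrightarrow> ?M0 ''alice'' i = of_bool (vs ! i \<in> V\<^sub>A)"
    "\<And>j. j < m \<Longrightarrow> ?M0 ''source'' j = int (S j)" "\<And>j. j < m \<Longrightarrow> ?M0 ''target'' j = int (D j)"
    by (auto simp: input_memory_def wt_def S_def D_def fun_eq_iff)
  \<comment> \<open>The pointers \<open>p\<close>, the list heads, the slack, the flags and the
    stack height rely on the work segments being zero at the start.\<close>
  have blank: "?M0 x = (\<lambda>_. 0)"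
    if "x \<notin> {''n'', ''m'', ''weight'', ''alice'', ''source'', ''target''}" for x
    using that by (auto simp: input_memory_def fun_eq_iff)
  show ?thesis
    unfolding solver_def run_Seq
  proof (rule preprocess_correct[where K = "N - 1" and m = m and wt = wt])
    fix M\<^sub>1 k\<^sub>1 mn
    assume M1: "M\<^sub>1 ''q'' 0 = int (Suc m)" "M\<^sub>1 ''mn'' 0 = mn" "M\<^sub>1 ''lo'' 0 = int (N - 1) * mn"
      and mn: "\<And>j. j < Suc m \<Longrightarrow> mn \<le> - wt j" "\<exists>j<Suc m. mn = - wt j"
      and fr1: "\<And>x. x \<notin> writes preprocess \<Longrightarrow> M\<^sub>1 x = ?M0 x"
      and k1: "2200 * ?X - (m * 100 + (N - 1) * 100 + 300) \<le> k\<^sub>1"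
    have k1: "1700 * ?X \<le> k\<^sub>1" using k1 X by linarith
    interpret sg: sum_generation wt mn "int (N - 1) * mn" "Suc m" "N - 1"
      using mn by unfold_locales
    have T_iff: "x \<in> sg.T \<longleftrightarrow> x + int (N - 1) * mn \<in> A" for x
      unfolding sg.T_def A_def using sums_of_shift[of x "\<lambda>j. - wt j" mn] by simp
    \<comment> \<open>Undoing the shift is a bijection, so the number of generated sums is the one
      estimated from the windows.\<close>
    have "bij_betw (\<lambda>x. x + int (N - 1) * mn) sg.T A"
      by (rule bij_betwI[where g = "\<lambda>x. x - int (N - 1) * mn"]) (auto simp: T_iff)
    then have card_T: "card sg.T = card A" by (rule bij_betw_same_card)
    have gen: "card sg.T * (Suc m * 162 + 100) + 30 \<le> 500 * ?X"
    proof -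
      have "card A * (Suc m * 162 + 100) = 162 * (card A * m) + 262 * card A" by (simp add: algebra_simps)
      then show ?thesis unfolding card_T using X by linarith
    qed
    show "run generate M\<^sub>1 k\<^sub>1 (\<lambda>M k. run find_zero M k (\<lambda>M k. run initialize M k (\<lambda>M k.
        run iterate M k (\<lambda>M k. run write_result M k (\<lambda>M _. \<forall>i<N. M ''energy'' i = encode_energy (energy i))))))"
    proof (rule sg.generate_correct)
      show "sg.ctx M\<^sub>1"
      proof -
        have "int (N - 1) = int N - 1" "int (Suc (N - 1)) = int N" using N_pos by linarith+
        then show ?thesis
          unfolding sg.ctx_def using M1 fr1 input by (simp add: preprocess_def)
      qed
      show "M\<^sub>1 ''p'' j = 0" for j using fr1 blank by (simp add: preprocess_def)
      show "card sg.T * (Suc m * 162 + 100) + 30 \<le> k\<^sub>1" using gen k1 by simp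
    next
      fix M\<^sub>2 k\<^sub>2 L
      assume M2: "M\<^sub>2 ''L'' 0 = int L" "enumerates (\<lambda>i. M\<^sub>2 ''val'' i - int (N - 1) * mn) L sg.T"
        and fr2: "\<And>x. x \<notin> writes generate \<Longrightarrow> M\<^sub>2 x = M\<^sub>1 x"
        and k2: "k\<^sub>1 - (card sg.T * (Suc m * 162 + 100) + 30) \<le> k\<^sub>2"
      have k2: "1200 * ?X \<le> k\<^sub>2" using k1 k2 gen by simp
      have L: "L = card A" using enumerates_card[OF M2(2)] card_T by simp
      have val: "enumerates (M\<^sub>2 ''val'') L A"
      proof -
        have "strict_mono_on {..<L} (M\<^sub>2 ''val'')"
          using enumerates_less[OF M2(2)] by (intro strict_mono_onI) auto
        moreover have "M\<^sub>2 ''val'' ` {..<L} = (\<lambda>x. x + int (N - 1) * mn) ` sg.T"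
          using M2(2) unfolding enumerates_def by force
        moreover have "\<dots> = A"
          using \<open>bij_betw (\<lambda>x. x + int (N - 1) * mn) sg.T A\<close> by (rule bij_betw_imp_surj_on)
        ultimately show ?thesis unfolding enumerates_def by simp
      qed
      interpret ranked_game G V\<^sub>A V\<^sub>B w vs es "M\<^sub>2 ''val''" L
        using val by unfold_locales
      have z: "pos 0 < L" "M\<^sub>2 ''val'' (pos 0) = 0" using pos[OF zero_A] by auto
      show "run find_zero M\<^sub>2 k\<^sub>2 (\<lambda>M k. run initialize M k (\<lambda>M k.
        run iterate M k (\<lambda>M k. run write_result M k (\<lambda>M _. \<forall>i<N. M ''energy'' i = encode_energy (energy i)))))"
      proof (rule find_zero_correct[where z = "pos 0"])
        show "M\<^sub>2 ''val'' i < 0" if "i < pos 0" for i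
          using enumerates_less[OF val that z(1)] z(2) by simp
        show "M\<^sub>2 ''val'' (pos 0) = 0" by (rule z(2))
        show "pos 0 * 20 + 20 \<le> k\<^sub>2" using z(1) L X k2 by linarith
      next
        fix M\<^sub>3 k\<^sub>3 assume M3: "M\<^sub>3 ''z'' 0 = int (pos 0)"
          and fr3: "\<And>x. x \<notin> writes find_zero \<Longrightarrow> M\<^sub>3 x = M\<^sub>2 x"
          and "k\<^sub>2 - (pos 0 * 20 + 20) \<le> k\<^sub>3"
        then have k3: "1150 * ?X \<le> k\<^sub>3" using z(1) L X k2 by linarith
        have fr: "M\<^sub>3 x = ?M0 x" if "x \<notin> writes preprocess" "x \<notin> writes generate" "x \<notin> writes find_zero" for x
          using fr1 fr2 fr3 that by simp
        have init: "N * 40 + m * 262 + 27 \<le> 329 * ?X" using X by linarith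
        show "run initialize M\<^sub>3 k\<^sub>3 (\<lambda>M k.
          run iterate M k (\<lambda>M k. run write_result M k (\<lambda>M _. \<forall>i<N. M ''energy'' i = encode_energy (energy i))))"
        proof (rule initialize_correct)
          have "M\<^sub>3 ''source'' = ?M0 ''source''" "M\<^sub>3 ''target'' = ?M0 ''target''" "M\<^sub>3 ''weight'' = wt"
            by (simp_all add: fr preprocess_def generate_def append_sum_def writes_scan_step find_zero_def input(3))
          moreover have "M\<^sub>3 ''L'' 0 = int L" "M\<^sub>3 ''val'' = M\<^sub>2 ''val''"
            using fr3 M2(1) by (simp_all add: find_zero_def)
          ultimately show "static M\<^sub>3" unfolding static_def using input(5,6) by (simp add: wt_def)
          show "N * 40 + m * 262 + 27 \<le> k\<^sub>3" using init k3 by linarith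
        next
          fix M\<^sub>4 k\<^sub>4 assume M4: "complete (\<lambda>_. pos 0) m M\<^sub>4" "linked M\<^sub>4"
            and fr4: "\<And>x. x \<notin> writes initialize \<Longrightarrow> M\<^sub>4 x = M\<^sub>3 x"
            and "k\<^sub>3 - (N * 40 + m * 262 + 27) \<le> k\<^sub>4"
          then have k4: "821 * ?X \<le> k\<^sub>4" using init k3 by linarith
          have "potential (\<lambda>_. pos 0) \<le> L * (m * 440 + N * 100)" by (rule potential_le)
          also have "\<dots> = 440 * (card A * m) + 100 * (card A * N)" unfolding L by (simp add: algebra_simps)
          also have "\<dots> \<le> 540 * ?X" using X by linarith
          finally have it: "m * 40 + potential (\<lambda>_. pos 0) + 10 \<le> 600 * ?X" using X by linarith
          show "run iterate M\<^sub>4 k\<^sub>4 (\<lambda>M k. run write_result M k (\<lambda>M _. \<forall>i<N. M ''energy'' i = encode_energy (energy i)))"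
          proof (rule iterate_correct[OF M4, where r = rank])
            show "pos 0 \<le> pos 0 \<and> pos 0 \<le> rank i" "rank i \<le> L \<and> \<not> viol rank i" if "i < N" for i
              using rank_bounds[OF that] rank_stable[OF that] by auto
            show "rank i \<le> f i" if "\<And>i. i < N \<Longrightarrow> pos 0 \<le> f i \<and> f i \<le> L \<and> \<not> viol f i" "i < N" for f i
              using rank_least[OF that] .
            show "m * 40 + potential (\<lambda>_. pos 0) + 10 \<le> k\<^sub>4" using it k4 by linarith
          next
            fix M\<^sub>5 k\<^sub>5 assume f: "\<And>i. i < N \<Longrightarrow> M\<^sub>5 ''f'' i = int (rank i)"
              and fr5: "\<And>x. x \<notin> writes iterate \<Longrightarrow> M\<^sub>5 x = M\<^sub>4 x"
              and "k\<^sub>4 - (m * 40 + potential (\<lambda>_. pos 0) + 10) \<le> k\<^sub>5"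
            then have k5: "100 * ?X \<le> k\<^sub>5" using it k4 by linarith
            show "run write_result M\<^sub>5 k\<^sub>5 (\<lambda>M _. \<forall>i<N. M ''energy'' i = encode_energy (energy i))"
            proof (rule write_result_correct[where N = N and L = L and r = rank])
              have same: "M\<^sub>5 x = M\<^sub>3 x" if "x \<in> {''n'', ''L'', ''val''}" for x
                using fr4[of x] fr5[of x] that
                by (auto simp: iterate_def initialize_def link_def writes_update)
              show "M\<^sub>5 ''n'' 0 = int N"
                using same input(1)
                by (simp add: fr preprocess_def generate_def append_sum_def writes_scan_step find_zero_def)
              show "M\<^sub>5 ''L'' 0 = int L" using same fr3 M2(1) by (simp add: find_zero_def)
              have "M\<^sub>5 ''val'' = M\<^sub>2 ''val''" using same fr3 by (simp add: find_zero_def)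
              then show "\<forall>i<N. M' ''energy'' i = encode_energy (energy i)"
                if "\<And>i. i < N \<Longrightarrow> M' ''energy'' i = (if rank i < L then M\<^sub>5 ''val'' (rank i) else - 1)" for M'
                using that rank_encode by metis
              show "N * 60 + 9 \<le> k\<^sub>5" using k5 X by linarith
            qed (rule f)
          qed
        qed (use M3 input in \<open>simp_all add: fr blank preprocess_def generate_def append_sum_def writes_scan_step find_zero_def\<close>)
      qed
    qed
  next
    show "m * 100 + (N - 1) * 100 + 300 \<le> 2200 * ?X" using X by linarith
  qed (use input N_pos in \<open>auto simp: wt_def\<close>)
qed

end

theorem theorem3:
  shows "\<exists>prog K. \<forall>(G :: 'v pair_pre_digraph) V\<^sub>A V\<^sub>B (w :: 'v \<times> 'v \<Rightarrow> int)
      (d :: nat) (c :: nat \<Rightarrow> int) (\<delta> :: nat).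
    game_graph G V\<^sub>A V\<^sub>B \<longrightarrow> pverts G \<noteq> {} \<longrightarrow>
    (\<forall>e \<in> parcs G. \<exists>i \<in> {1..d}. w e \<in> {c i - int \<delta> .. c i + int \<delta>}) \<longrightarrow>
    computes_min_energies_within prog G V\<^sub>A V\<^sub>B w
      (K * (card (parcs G) * max 1 \<delta> * card (pverts G) ^ (d + 1)))"
\<comment> \<open>The program and the constant are fixed before the graph and the windows. 4400 is
  2200 times the factor 2 of \<open>card_A_le\<close>.\<close>
proof (intro exI[of _ solver] exI[of _ 4400] allI impI)
  fix G :: "'v pair_pre_digraph" and V\<^sub>A V\<^sub>B and w :: "'v \<times> 'v \<Rightarrow> int" and d :: nat
    and c :: "nat \<Rightarrow> int" and \<delta> :: nat
  assume G: "game_graph G V\<^sub>A V\<^sub>B" "pverts G \<noteq> {}"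
    and windows: "\<forall>e \<in> parcs G. \<exists>i \<in> {1..d}. w e \<in> {c i - int \<delta> .. c i + int \<delta>}"
  show "computes_min_energies_within solver G V\<^sub>A V\<^sub>B w
      (4400 * (card (parcs G) * max 1 \<delta> * card (pverts G) ^ (d + 1)))"
    unfolding computes_min_energies_within_def
  proof (intro allI impI)
    fix vs es assume l: "distinct vs \<and> set vs = pverts G \<and> distinct es \<and> set es = parcs G"
    interpret game_graph G V\<^sub>A V\<^sub>B by fact
    interpret game_input G V\<^sub>A V\<^sub>B w vs es
      using l G(2) by unfold_locales auto
    from solver_correct obtain t M where t: "exec solver (input_memory V\<^sub>A w vs es) t M"
      "t \<le> 2200 * (m * card A)" "\<forall>i<N. M ''energy'' i = encode_energy (energy i)"
      unfolding run_def by auto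
    note t(2)
    also have "2200 * (m * card A) \<le> 2200 * (m * (2 * (max 1 \<delta> * N ^ (d + 1))))"
      using card_A_le[OF windows] by (intro mult_le_mono le_refl)
    also have "\<dots> = 4400 * (card (parcs G) * max 1 \<delta> * card (pverts G) ^ (d + 1))"
      unfolding m_eq[symmetric] N_eq[symmetric] by simp
    finally show "\<exists>t M. exec solver (input_memory V\<^sub>A w vs es) t M \<and>
        t \<le> 4400 * (card (parcs G) * max 1 \<delta> * card (pverts G) ^ (d + 1)) \<and>
        (\<forall>i<length vs. M ''energy'' i = encode_energy (min_energy G V\<^sub>A V\<^sub>B w (vs ! i)))"
      using t(1,3) unfolding energy_def by blast
  qed
qed

end
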